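(* Let $(S_t)_{t=0}^T$ be an adapted $\mathbb R^d$-valued process (discounted asset prices), and let $B_t$, $0\le t\le T-1$, be $\mathcal F_t$-measurable random convex cones in $\mathbb R^d$ (portfolio constraints). Assume that the cones $B_t$ are polyhedral and that the no-arbitrage (NA) condition is satisfied. Let $f_T$ be a contingent claim, i.e. an $\mathcal F_T$-measurable real random variable. If the upper price $\overline\pi_0$ and the lower price $\underline\pi_0$ of $f_T$ are finite, then they can be computed recursively by $\overline\pi_T=\underline\pi_T=f_T$ and, for $0\le t\le T-1$, $$\overline\pi_t=\sup\bigl\{y\in\mathbb R:(S_t,y)\in\operatorname{ri}\bigl(\operatorname{conv}\mathcal K((S_{t+1},\overline\pi_{t+1}),\mathcal F_t)\bigr)-(B_t^\circ\times\{0\})\bigr\},$$ $$\underline\pi_t=\inf\bigl\{y\in\mathbb R:(S_t,y)\in\operatorname{ri}\bigl(\operatorname{conv}\mathcal K((S_{t+1},\underline\pi_{t+1}),\mathcal F_t)\bigr)-(B_t^\circ\times\{0\})\bigr\}.$$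
   Context: $(\Omega,\mathcal F,\mathbf P)$ is a probability space with a discrete-time filtration $(\mathcal F_t)_{t=0}^T$, $\mathcal F_0=\{\varnothing,\Omega\}$, $\mathcal F_T=\mathcal F$; all $\sigma$-algebras are assumed complete with respect to $\mathbf P$. Measurability of a random cone (a set-valued map) is understood in the usual sense: $G$ is $\mathcal H$-measurable if $\{\omega:G(\omega)\cap U\ne\varnothing\}\in\mathcal H$ for every open $U$. An admissible portfolio process (investment strategy) is an adapted $\mathbb R^d$-valued process $\gamma$ with $\gamma_n\in B_n$ for all $n$. Its discounted gain is $G_t^\gamma=\sum_{n=1}^t\langle\gamma_{n-1},S_n-S_{n-1}\rangle$. The NA condition: for any admissible $\gamma$, $G_T^\gamma\ge 0$ a.s. implies $G_T^\gamma=0$ a.s. The claim $f_T$ is super-hedgeable (resp. sub-hedgeable) at a price $x\in\mathbb R$ if there exists an admissible portfolio process $\gamma$ such that $x+G_T^\gamma\ge f_T$ (resp. $x-G_T^\gamma\le f_T$) a.s. The upper price $\overline\pi_0$ is the infimum of all $x$ at which $f_T$ is super-hedgeable; the lower price $\underline\pi_0$ is the supremum of all $x$ at which $f_T$ is sub-hedgeable. $\operatorname{ri}$ and $\operatorname{conv}$ denote relative interior and convex hull. For a cone $A\subset\mathbb R^d$, $A^\circ=\{y:\langle x,y\rangle\le 0\text{ for all }x\in A\}$ is its polar. $A-B=\{x-y:x\in A,\ y\in B\}$. For a sub-$\sigma$-algebra $\mathcal H\subset\mathcal F$ and an $\mathcal F$-measurable random vector $\eta$ with values in a finite-dimensional Euclidean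 space, $\mathcal K(\eta,\mathcal H)=\mathcal K(\eta,\mathcal H;\omega)$ is the (closed) support of the regular conditional distribution of $\eta$ with respect to $\mathcal H$; in the recursion $\eta=(S_{t+1},\overline\pi_{t+1})$ or $(S_{t+1},\underline\pi_{t+1})$ is $\mathbb R^{d+1}$-valued, and the formulas are understood $\omega$ by $\omega$, a.s. *)

theory Defs
  imports "HOL-Probability.Probability"
begin

section \<open>Cones\<close>

definition polar :: "'b::real_inner set \<Rightarrow> 'b set" where
  "polar A = {y. \<forall>x\<in>A. x \<bullet> y \<le> 0}"

definition minkowski_diff :: "'b::ab_group_add set \<Rightarrow> 'b set \<Rightarrow> 'b set" where
  "minkowski_diff A B = {x - y | x y. x \<in> A \<and> y \<in> B}"

definition random_convex_cone :: "'a measure \<Rightarrow> ('a \<Rightarrow> 'b::real_normed_vector set) \<Rightarrow> bool" where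
  "random_convex_cone H B \<longleftrightarrow>
     (\<forall>\<omega>\<in>space H. convex_cone (B \<omega>)) \<and>
     (\<forall>U. open U \<longrightarrow> {\<omega>\<in>space H. B \<omega> \<inter> U \<noteq> {}} \<in> sets H)"

section \<open>Filtered probability spaces\<close>

text \<open>
  Both the base space and every \<open>F t\<close> are complete with respect to the probability, so that
  triviality of \<open>F 0\<close> can only be understood modulo null sets. The values \<open>F t\<close> for \<open>t > T\<close>
  are irrelevant. Only the \<open>\<sigma>\<close>-algebra of \<open>F t\<close> matters, not the measure it carries.
\<close>

definition filtered_prob_space :: "'a measure \<Rightarrow> (nat \<Rightarrow> 'a measure) \<Rightarrow> nat \<Rightarrow> bool" where
  "filtered_prob_space M F T \<longleftrightarrow>
     prob_space M \<and> complete_measure M \<and>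
     (\<forall>t\<le>T. subalgebra M (F t) \<and> null_sets M \<subseteq> sets (F t)) \<and>
     (\<forall>s t. s \<le> t \<and> t \<le> T \<longrightarrow> sets (F s) \<subseteq> sets (F t)) \<and>
     (\<forall>A\<in>sets (F 0). measure M A = 0 \<or> measure M A = 1) \<and>
     sets (F T) = sets M"

section \<open>Trading and prices\<close>

definition admissible ::
  "(nat \<Rightarrow> 'a measure) \<Rightarrow> (nat \<Rightarrow> 'a \<Rightarrow> 'b::euclidean_space set) \<Rightarrow> nat \<Rightarrow> (nat \<Rightarrow> 'a \<Rightarrow> 'b) \<Rightarrow> bool" where
  "admissible F B T \<gamma> \<longleftrightarrow>
     (\<forall>n<T. \<gamma> n \<in> borel_measurable (F n) \<and> (\<forall>\<omega>\<in>space (F n). \<gamma> n \<omega> \<in> B n \<omega>))"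

definition gain ::
  "(nat \<Rightarrow> 'a \<Rightarrow> 'b::real_inner) \<Rightarrow> (nat \<Rightarrow> 'a \<Rightarrow> 'b) \<Rightarrow> nat \<Rightarrow> 'a \<Rightarrow> real" where
  "gain S \<gamma> t \<omega> = (\<Sum>n=1..t. \<gamma> (n - 1) \<omega> \<bullet> (S n \<omega> - S (n - 1) \<omega>))"

definition no_arbitrage ::
  "'a measure \<Rightarrow> (nat \<Rightarrow> 'a measure) \<Rightarrow> (nat \<Rightarrow> 'a \<Rightarrow> 'b::euclidean_space) \<Rightarrow>
     (nat \<Rightarrow> 'a \<Rightarrow> 'b set) \<Rightarrow> nat \<Rightarrow> bool" where
  "no_arbitrage M F S B T \<longleftrightarrow>
     (\<forall>\<gamma>. admissible F B T \<gamma> \<longrightarrow> (AE \<omega> in M. gain S \<gamma> T \<omega> \<ge> 0) \<longrightarrow> (AE \<omega> in M. gain S \<gamma> T \<omega> = 0))"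

definition super_hedgeable ::
  "'a measure \<Rightarrow> (nat \<Rightarrow> 'a measure) \<Rightarrow> (nat \<Rightarrow> 'a \<Rightarrow> 'b::euclidean_space) \<Rightarrow>
     (nat \<Rightarrow> 'a \<Rightarrow> 'b set) \<Rightarrow> nat \<Rightarrow> ('a \<Rightarrow> real) \<Rightarrow> real \<Rightarrow> bool" where
  "super_hedgeable M F S B T f x \<longleftrightarrow>
     (\<exists>\<gamma>. admissible F B T \<gamma> \<and> (AE \<omega> in M. x + gain S \<gamma> T \<omega> \<ge> f \<omega>))"

definition sub_hedgeable ::
  "'a measure \<Rightarrow> (nat \<Rightarrow> 'a measure) \<Rightarrow> (nat \<Rightarrow> 'a \<Rightarrow> 'b::euclidean_space) \<Rightarrow>
     (nat \<Rightarrow> 'a \<Rightarrow> 'b set) \<Rightarrow> nat \<Rightarrow> ('a \<Rightarrow> real) \<Rightarrow> real \<Rightarrow> bool" where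
  "sub_hedgeable M F S B T f x \<longleftrightarrow>
     (\<exists>\<gamma>. admissible F B T \<gamma> \<and> (AE \<omega> in M. x - gain S \<gamma> T \<omega> \<le> f \<omega>))"

definition upper_price ::
  "'a measure \<Rightarrow> (nat \<Rightarrow> 'a measure) \<Rightarrow> (nat \<Rightarrow> 'a \<Rightarrow> 'b::euclidean_space) \<Rightarrow>
     (nat \<Rightarrow> 'a \<Rightarrow> 'b set) \<Rightarrow> nat \<Rightarrow> ('a \<Rightarrow> real) \<Rightarrow> ereal" where
  "upper_price M F S B T f = Inf (ereal ` {x. super_hedgeable M F S B T f x})"

definition lower_price ::
  "'a measure \<Rightarrow> (nat \<Rightarrow> 'a measure) \<Rightarrow> (nat \<Rightarrow> 'a \<Rightarrow> 'b::euclidean_space) \<Rightarrow>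
     (nat \<Rightarrow> 'a \<Rightarrow> 'b set) \<Rightarrow> nat \<Rightarrow> ('a \<Rightarrow> real) \<Rightarrow> ereal" where
  "lower_price M F S B T f = Sup (ereal ` {x. sub_hedgeable M F S B T f x})"

section \<open>Conditional supports\<close>

text \<open>
  \<open>\<kappa>\<close> is a version of the regular conditional distribution of \<open>\<eta>\<close> with respect to \<open>H\<close>: a Markov
  kernel that agrees with the conditional probabilities of \<open>\<eta>\<close> almost surely. Such a version is
  determined only up to null sets, hence a predicate rather than a function.
\<close>

definition regular_cond_distr ::
  "'a measure \<Rightarrow> 'a measure \<Rightarrow> ('a \<Rightarrow> 'c::euclidean_space) \<Rightarrow> ('a \<Rightarrow> 'c measure) \<Rightarrow> bool" where
  "regular_cond_distr M H \<eta> \<kappa> \<longleftrightarrow>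
     \<kappa> \<in> measurable H (prob_algebra borel) \<and>
     (\<forall>A\<in>sets borel. AE \<omega> in M. measure (\<kappa> \<omega>) A = real_cond_exp M H (indicat_real (\<eta> -` A)) \<omega>)"

definition closed_support :: "'c::topological_space measure \<Rightarrow> 'c set" where
  "closed_support \<mu> = \<Inter>{C. closed C \<and> emeasure \<mu> (- C) = 0}"

section \<open>The recursions\<close>

definition price_fiber :: "'b::euclidean_space \<Rightarrow> ('b \<times> real) set \<Rightarrow> 'b set \<Rightarrow> real set" where
  "price_fiber s K B =
     {y. (s, y) \<in> minkowski_diff (rel_interior (convex hull K)) (polar B \<times> {0})}"

text \<open>
  A solution of the recursion is a real-valued adapted process, so that \<open>(S (Suc t), \<pi> (Suc t))\<close> is
  a random vector at every step. Supremum and infimum are taken in the extended reals; equality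
  with the real number \<open>\<pi> t \<omega>\<close> therefore includes that the set is nonempty and bounded on the
  relevant side.
\<close>

definition upper_recursion ::
  "'a measure \<Rightarrow> (nat \<Rightarrow> 'a measure) \<Rightarrow> (nat \<Rightarrow> 'a \<Rightarrow> 'b::euclidean_space) \<Rightarrow>
     (nat \<Rightarrow> 'a \<Rightarrow> 'b set) \<Rightarrow> nat \<Rightarrow> ('a \<Rightarrow> real) \<Rightarrow> (nat \<Rightarrow> 'a \<Rightarrow> real) \<Rightarrow> bool" where
  "upper_recursion M F S B T f \<pi> \<longleftrightarrow>
     (\<forall>t\<le>T. \<pi> t \<in> borel_measurable (F t)) \<and>
     (AE \<omega> in M. \<pi> T \<omega> = f \<omega>) \<and>
     (\<forall>t<T. \<exists>\<kappa>. regular_cond_distr M (F t) (\<lambda>\<omega>. (S (Suc t) \<omega>, \<pi> (Suc t) \<omega>)) \<kappa> \<and>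
        (AE \<omega> in M. ereal (\<pi> t \<omega>) =
           Sup (ereal ` price_fiber (S t \<omega>) (closed_support (\<kappa> \<omega>)) (B t \<omega>))))"

definition lower_recursion ::
  "'a measure \<Rightarrow> (nat \<Rightarrow> 'a measure) \<Rightarrow> (nat \<Rightarrow> 'a \<Rightarrow> 'b::euclidean_space) \<Rightarrow>
     (nat \<Rightarrow> 'a \<Rightarrow> 'b set) \<Rightarrow> nat \<Rightarrow> ('a \<Rightarrow> real) \<Rightarrow> (nat \<Rightarrow> 'a \<Rightarrow> real) \<Rightarrow> bool" where
  "lower_recursion M F S B T f \<pi> \<longleftrightarrow>
     (\<forall>t\<le>T. \<pi> t \<in> borel_measurable (F t)) \<and>
     (AE \<omega> in M. \<pi> T \<omega> = f \<omega>) \<and>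
     (\<forall>t<T. \<exists>\<kappa>. regular_cond_distr M (F t) (\<lambda>\<omega>. (S (Suc t) \<omega>, \<pi> (Suc t) \<omega>)) \<kappa> \<and>
        (AE \<omega> in M. ereal (\<pi> t \<omega>) =
           Inf (ereal ` price_fiber (S t \<omega>) (closed_support (\<kappa> \<omega>)) (B t \<omega>))))"

end

theory Submission
  imports Defs
begin

text \<open>
  Fix a scenario and let \<open>K\<close> be the conditional support of \<open>(S\<^bsub>t+1\<^esub>, \<pi>\<^bsub>t+1\<^esub>)\<close>. No arbitrage excludes, almost
  surely, portfolios in \<open>B\<^bsub>t\<^esub>\<close> with nonnegative and not identically vanishing gain on \<open>K\<close>. Under this
  pointwise condition the prices \<open>x\<close> that superhedge all points of \<open>K\<close> are exactly the reals not below
  the supremum in the recursion: if \<open>x\<close> is not below it, then \<open>ri (conv K)\<close>, shifted and lowered by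
  \<open>x\<close>, misses the polar of the polyhedral cone \<open>B\<^bsub>t\<^esub>\<close>, and a separating hyperplane that is not
  vertical yields the hedge. So the infimum is attained, and measurable selection turns a
  solution of the recursion into a superhedging strategy with initial capital \<open>\<pi>\<^bsub>0\<^esub>\<close>. Conversely the
  easy half of the duality bounds a solution by the value process of every superhedge. A super- and a
  sub-hedge at finite prices bound the recursion from both sides, which makes it real-valued. The lower
  price of \<open>f\<close> is minus the upper price of \<open>-f\<close>.
\<close>

text \<open>Proper separation of two convex sets may yield a functional that is nonconstant only on
  the second set. Here the first set comes from the support and the second is a cone inside
  \<open>polar (B t \<omega>)\<close>; finite generation of that cone allows a nonzero value on the
  first set to be demanded. A vertical hyperplane is then a portfolio with nonnegative gain on
  \<open>K\<close>; pointwise no arbitrage makes this gain zero on \<open>K\<close>, hence on the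
  convex hull and its relative interior, against that demand.

  Attainment is what makes the strategy exact: the portfolios that hedge from capital
  \<open>\<pi> t \<omega>\<close> almost surely form a nonempty closed set, so one selection per
  period is enough and no approximation errors have to be added up.

  Conditional laws are fixed only up to null sets, while the convex-analytic statements quantify
  over uncountably many portfolios and capitals. So exceptional null sets are traced back to
  countably many measurable conditions, and what depends on the support is read off from the masses
  of open sets.\<close>

section \<open>Separation from a polyhedral cone and pointwise duality\<close>

text \<open>
  Induction on the generators. Moving the ray of one generator \<open>a\<close> over to \<open>C\<close> gives a functional
  \<open>v\<close>, which may vanish on \<open>C\<close>. In that case the generators not orthogonal to \<open>v\<close> do not matter: separate
  \<open>C\<close> from the others by \<open>w\<close> and add a large multiple of \<open>v\<close>.
\<close>

lemma separating_hyperplane_finite_cone: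
  fixes C :: "'b::euclidean_space set"
  assumes "finite I" "convex C" "C \<noteq> {}" "C \<inter> convex_cone hull I = {}"
  shows "\<exists>v. (\<forall>x\<in>C. v \<bullet> x \<le> 0) \<and> (\<exists>x\<in>C. v \<bullet> x \<noteq> 0) \<and> (\<forall>a\<in>I. 0 \<le> v \<bullet> a)"
  using assms
proof (induction I arbitrary: C rule: finite_psubset_induct)
  case (psubset I)
  show ?case
  proof (cases "I = {}")
    case True
    \<comment> \<open>The cone without generators is \<open>{0}\<close>. Taking the normal from
      \<open>span C\<close> is what makes it nonzero on \<open>C\<close>: orthogonal to all of
      \<open>C\<close>, it would be orthogonal to itself.\<close>
    then have "0 \<notin> C"
      using psubset.prems(3) by auto
    then obtain a where a: "a \<in> span C" "a \<noteq> 0" "\<And>x. x \<in> C \<Longrightarrow> 0 \<le> a \<bullet> x"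
      using separating_hyperplane_set_0_inspan psubset.prems(1,2) by blast
    have "\<exists>x\<in>C. a \<bullet> x \<noteq> 0"
    proof (rule ccontr)
      assume "\<not> ?thesis"
      then have "\<And>x. x \<in> C \<Longrightarrow> orthogonal a x"
        by (auto simp: orthogonal_def)
      then have "orthogonal a a"
        using orthogonal_to_span[OF a(1)] by blast
      with a(2) show False
        by (simp add: orthogonal_def)
    qed
    with a(3) True show ?thesis
      by (intro exI[of _ "- a"]) auto
  next
    case False
    then obtain a where a: "a \<in> I"
      by blast
    define J where "J = I - {a}"
    have J: "J \<subset> I" and I: "I = insert a J"
      using a by (auto simp: J_def)
    let ?ray = "(\<lambda>r. r *\<^sub>R a) ` {0..}"
    define C' where "C' = (\<Union>x\<in>C. \<Union>y\<in>?ray. {x - y})"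
    have "convex ?ray"
      by (intro convex_linear_image bounded_linear.linear bounded_linear_scaleR_left) auto
    then have C'1: "convex C'"
      unfolding C'_def using psubset.prems(1) by (intro convex_differences)
    have C'2: "C' \<noteq> {}"
      using psubset.prems(2) by (auto simp: C'_def)
    have C'3: "C' \<inter> convex_cone hull J = {}"
    proof (rule ccontr)
      assume "C' \<inter> convex_cone hull J \<noteq> {}"
      then obtain x r where x: "x \<in> C" "r \<ge> 0" "x - r *\<^sub>R a \<in> convex_cone hull J"
        by (auto simp: C'_def)
      have "x - r *\<^sub>R a \<in> convex_cone hull I"
        using x(3) hull_mono[of J I convex_cone] J by blast
      moreover have "r *\<^sub>R a \<in> convex_cone hull I"
        using a x(2) by (intro convex_cone_hull_mul hull_inc)
      ultimately have "x \<in> convex_cone hull I"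
        using convex_cone_hull_add[of "x - r *\<^sub>R a" I "r *\<^sub>R a"] by simp
      with x(1) psubset.prems(3) show False
        by blast
    qed
    obtain v where v: "\<And>x. x \<in> C' \<Longrightarrow> v \<bullet> x \<le> 0" "\<exists>x\<in>C'. v \<bullet> x \<noteq> 0" "\<And>b. b \<in> J \<Longrightarrow> 0 \<le> v \<bullet> b"
      using psubset.IH[OF J C'1 C'2 C'3] by blast
    have vC': "v \<bullet> x - r * (v \<bullet> a) \<le> 0" if "x \<in> C" "r \<ge> 0" for x r
      using v(1)[of "x - r *\<^sub>R a"] that by (auto simp: C'_def inner_diff_right)
    have vC: "v \<bullet> x \<le> 0" if "x \<in> C" for x
      using vC'[OF that, of 0] by simp
    obtain x0 where x0: "x0 \<in> C"
      using psubset.prems(2) by blast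
    have va: "0 \<le> v \<bullet> a"
    proof (rule ccontr)
      assume neg: "\<not> ?thesis"
      define r where "r = (\<bar>v \<bullet> x0\<bar> + 1) / - (v \<bullet> a)"
      have "r > 0"
        unfolding r_def using neg by (intro divide_pos_pos) auto
      moreover have "r * (v \<bullet> a) = - (\<bar>v \<bullet> x0\<bar> + 1)"
        using neg by (simp add: r_def)
      ultimately show False
        using vC'[OF x0, of r] by simp
    qed
    have vI: "0 \<le> v \<bullet> b" if "b \<in> I" for b
      using that va v(3) I by blast
    show ?thesis
    proof (cases "\<exists>x\<in>C. v \<bullet> x \<noteq> 0")
      case True
      then show ?thesis
        using vC vI by blast
    next
      case v0: False
      \<comment> \<open>As \<open>v\<close> is nonzero somewhere on \<open>C'\<close> but vanishes
        on \<open>C\<close>, it must be nonzero on the ray. So \<open>I0\<close> omits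
        \<open>a\<close>, and the induction hypothesis applies to it.\<close>
      have "v \<bullet> a \<noteq> 0"
        using v(2) v0 by (auto simp: C'_def inner_diff_right)
      define I0 where "I0 = {b\<in>I. v \<bullet> b = 0}"
      have I0: "I0 \<subset> I"
        using a \<open>v \<bullet> a \<noteq> 0\<close> by (auto simp: I0_def)
      have "C \<inter> convex_cone hull I0 = {}"
        using psubset.prems(3) hull_mono[of I0 I convex_cone] I0 by blast
      then obtain w where w: "\<And>x. x \<in> C \<Longrightarrow> w \<bullet> x \<le> 0" "\<exists>x\<in>C. w \<bullet> x \<noteq> 0" "\<And>b. b \<in> I0 \<Longrightarrow> 0 \<le> w \<bullet> b"
        using psubset.IH[OF I0 psubset.prems(1,2)] by blast
      \<comment> \<open>The sum dominates every single ratio; generators in \<open>I0\<close>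
        contribute 0 because division by zero gives 0.\<close>
      define L where "L = (\<Sum>b\<in>I. \<bar>w \<bullet> b / (v \<bullet> b)\<bar>)"
      have "0 \<le> w \<bullet> b + L * (v \<bullet> b)" if b: "b \<in> I" for b
      proof (cases "v \<bullet> b = 0")
        case True
        then show ?thesis
          using w(3)[of b] b by (simp add: I0_def)
      next
        case False
        then have pos: "v \<bullet> b > 0"
          using vI[OF b] by simp
        have "\<bar>w \<bullet> b / (v \<bullet> b)\<bar> \<le> L"
          unfolding L_def using psubset.hyps b by (intro member_le_sum) auto
        then have "- (w \<bullet> b / (v \<bullet> b)) \<le> L"
          by linarith
        with pos show ?thesis
          by (simp add: field_simps)
      qed
      then show ?thesis
        using w v0 by (intro exI[of _ "w + L *\<^sub>R v"]) (auto simp: inner_add_left)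
    qed
  qed
qed

text \<open>Since \<open>B\<close> contains 0, the right-hand sides \<open>b h\<close> are
  nonnegative, so the homogeneous half-spaces cut out a subset of \<open>B\<close>. Nothing is lost:
  if \<open>a h \<bullet> y > 0\<close> for some \<open>y\<close> in \<open>B\<close>, a multiple of
  \<open>y\<close> far enough out would violate the inequality of \<open>h\<close>. The finitely
  many normals are the generators for the separation lemma.\<close>

lemma polyhedral_convex_cone_halfspaces:
  fixes B :: "'b::euclidean_space set"
  assumes "polyhedron B" "convex_cone B"
  obtains A where "finite A" "B = {y. \<forall>a\<in>A. a \<bullet> y \<le> 0}"
proof -
  obtain F where F: "finite F" "B = \<Inter>F" "\<forall>h\<in>F. \<exists>a b. a \<noteq> 0 \<and> h = {x. a \<bullet> x \<le> b}"
    using assms(1) unfolding polyhedron_def by blast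
  then obtain a b where ab: "\<And>h. h \<in> F \<Longrightarrow> h = {x. a h \<bullet> x \<le> b h}"
    by metis
  have b: "0 \<le> b h" if "h \<in> F" for h
  proof -
    have "0 \<in> h"
      using convex_cone_contains_0[OF assms(2)] F(2) that by blast
    then show ?thesis
      by (subst (asm) ab[OF that]) simp
  qed
  have "a h \<bullet> y \<le> 0" if y: "y \<in> B" and h: "h \<in> F" for y h
  proof (rule ccontr)
    assume *: "\<not> a h \<bullet> y \<le> 0"
    define r where "r = (b h + 1) / (a h \<bullet> y)"
    have "r *\<^sub>R y \<in> B"
      using assms(2) y * b[OF h] by (intro convex_cone_scaleR) (auto simp: r_def)
    then have "a h \<bullet> (r *\<^sub>R y) \<le> b h"
      using F(2) ab[OF h] h by blast
    moreover have "a h \<bullet> (r *\<^sub>R y) = b h + 1"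
      using * by (simp add: r_def)
    ultimately show False
      by simp
  qed
  moreover have "y \<in> B" if "\<And>h. h \<in> F \<Longrightarrow> a h \<bullet> y \<le> 0" for y
  proof -
    have "y \<in> h" if h: "h \<in> F" for h
      using ab[OF h] order_trans[OF \<open>\<And>h. h \<in> F \<Longrightarrow> a h \<bullet> y \<le> 0\<close>[OF h] b[OF h]] by blast
    with F(2) show ?thesis by blast
  qed
  ultimately have "B = {y. \<forall>c\<in>a ` F. c \<bullet> y \<le> 0}"
    by auto
  with F(1) that show ?thesis
    by blast
qed

section \<open>Weak and strong duality in a single scenario\<close>

lemma price_fiber_le_superhedge:
  assumes "y \<in> price_fiber s K B" "\<gamma> \<in> B" "\<And>z. z \<in> K \<Longrightarrow> snd z \<le> x + \<gamma> \<bullet> (fst z - s)"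
  shows "y \<le> x"
proof -
  obtain s' b where *: "(s', y) \<in> rel_interior (convex hull K)" "b \<in> polar B" "s = s' - b"
    using assms(1) by (auto simp: price_fiber_def minkowski_diff_def)
  \<comment> \<open>The hedging inequality is a half-space for the pair of price and value, so it
    extends from \<open>K\<close> to its convex hull. The shift by \<open>b\<close> only lowers the
    gain, as \<open>\<gamma>\<close> lies in \<open>B\<close> and \<open>b\<close> in its
    polar.\<close>
  let ?H = "{z. (- \<gamma>, 1) \<bullet> z \<le> x - \<gamma> \<bullet> s}"
  have "convex hull K \<subseteq> ?H"
  proof (intro hull_minimal convex_halfspace_le subsetI CollectI)
    fix z assume "z \<in> K"
    from assms(3)[OF this] show "(- \<gamma>, 1) \<bullet> z \<le> x - \<gamma> \<bullet> s"
      by (simp add: inner_prod_def inner_diff_right)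
  qed
  then have "(s', y) \<in> ?H"
    using *(1) rel_interior_subset by blast
  then have "y \<le> x + \<gamma> \<bullet> (s' - s)"
    by (simp add: inner_diff_right)
  moreover have "\<gamma> \<bullet> (s' - s) \<le> 0"
    using *(2,3) assms(2) by (auto simp: polar_def)
  ultimately show ?thesis
    by simp
qed

text \<open>The sets separated are \<open>D\<close>, which is \<open>R\<close> seen from
  \<open>(s, x)\<close> and pushed down, and the cone of the normals of \<open>B\<close> at height
  0. A common point would produce an element of the fiber above \<open>x\<close>. In the functional
  \<open>(\<eta>, \<beta>)\<close> the signs on the generators say that \<open>- \<eta>\<close> lies
  in \<open>B\<close>, and dividing by the value coefficient \<open>\<beta>\<close> turns
  \<open>- \<eta>\<close> into the hedge.\<close>

lemma superhedge_attained:
  fixes B :: "'b::euclidean_space set"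
  assumes B: "polyhedron B" "convex_cone B" and "K \<noteq> {}"
    and NA: "\<And>\<gamma>. \<gamma> \<in> B \<Longrightarrow> \<forall>z\<in>K. 0 \<le> \<gamma> \<bullet> (fst z - s) \<Longrightarrow> \<forall>z\<in>K. \<gamma> \<bullet> (fst z - s) = 0"
    and x: "\<And>y. y \<in> price_fiber s K B \<Longrightarrow> y \<le> x"
  shows "\<exists>\<gamma>\<in>B. \<forall>z\<in>K. snd z \<le> x + \<gamma> \<bullet> (fst z - s)"
proof -
  obtain A where A: "finite A" "B = {y. \<forall>a\<in>A. a \<bullet> y \<le> 0}"
    using polyhedral_convex_cone_halfspaces[OF B] .
  define R where "R = rel_interior (convex hull K)"
  have "convex R" "R \<noteq> {}" and RK: "K \<subseteq> closure R"
    using \<open>K \<noteq> {}\<close> hull_subset[of K convex] closure_subset[of "convex hull K"]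
    by (auto simp: R_def convex_rel_interior rel_interior_eq_empty convex_closure_rel_interior)
  \<comment> \<open>The removed open downward ray keeps only prices strictly above \<open>x\<close> and forces \<open>\<beta> \<ge> 0\<close> below.\<close>
  define C where "C = (\<Union>z\<in>R. \<Union>w\<in>{0::'b} \<times> {0<..}. {z - w}) "
  define D where "D = (\<lambda>z. - (s, x) + z) ` C"
  define I where "I = (\<lambda>a. (a, 0::real)) ` A"
  have D: "(fst z - s, snd z - x - r) \<in> D" if "z \<in> R" "r > 0" for z r
  proof -
    have "z - (0, r) \<in> C"
      using that unfolding C_def by blast
    then have "- (s, x) + (z - (0, r)) \<in> D"
      unfolding D_def by (rule imageI)
    moreover have "- (s, x) + (z - (0, r)) = (fst z - s, snd z - x - r)"
      by (cases z) auto
    ultimately show ?thesis by simp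
  qed
  have "convex D"
    unfolding D_def C_def using \<open>convex R\<close>
    by (intro convex_translation convex_differences convex_Times) auto
  moreover have "D \<noteq> {}"
    using \<open>R \<noteq> {}\<close> D[of _ 1] by auto
  moreover have "D \<inter> convex_cone hull I = {}"
  proof (rule ccontr)
    assume "D \<inter> convex_cone hull I \<noteq> {}"
    then obtain z where z: "z \<in> D" "z \<in> convex_cone hull I"
      by blast
    have "convex_cone (polar B \<times> {0::real})"
      by (auto simp: convex_cone_iff polar_def inner_add_right mult_nonneg_nonpos add_nonpos_nonpos zero_prod_def)
    then have "convex_cone hull I \<subseteq> polar B \<times> {0}"
      by (intro hull_minimal) (auto simp: I_def A(2) polar_def inner_commute)
    then obtain b where b: "z = (b, 0)" "b \<in> polar B"
      using z(2) by auto
    obtain c r where c: "c \<in> R" "r > 0" "z = - (s, x) + (c - (0, r))"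
      using z(1) by (auto simp: D_def C_def)
    then have "c = (s + b, x + r)"
      using b(1) by (cases c) auto
    with c(1) have "(s + b, x + r) \<in> R"
      by simp
    moreover have "(s, x + r) = (s + b, x + r) - (b, 0)"
      by simp
    ultimately have "x + r \<in> price_fiber s K B"
      using b(2) unfolding price_fiber_def minkowski_diff_def R_def by blast
    with x[of "x + r"] c(2) show False
      by simp
  qed
  ultimately obtain v where v: "\<And>z. z \<in> D \<Longrightarrow> v \<bullet> z \<le> 0" "\<exists>z\<in>D. v \<bullet> z \<noteq> 0" "\<And>a. a \<in> I \<Longrightarrow> 0 \<le> v \<bullet> a"
    using separating_hyperplane_finite_cone[of I D] A(1) unfolding I_def by blast
  obtain \<eta> \<beta> where v_eq: "v = (\<eta>, \<beta>)"
    by (cases v)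
  have \<eta>: "- \<eta> \<in> B"
  proof -
    have "0 \<le> \<eta> \<bullet> a" if "a \<in> A" for a
      using v(3)[of "(a, 0)"] that by (simp add: I_def v_eq)
    then show ?thesis
      by (simp add: A(2) inner_commute)
  qed
  have le: "\<eta> \<bullet> (fst z - s) + \<beta> * (snd z - x - r) \<le> 0" if "z \<in> R" "r > 0" for z r
    using v(1)[OF D[OF that]] by (simp add: v_eq)
  \<comment> \<open>Letting \<open>r\<close> tend to 0 gives the inequality on \<open>R\<close>. It
    passes to \<open>K\<close> because a convex set lies in the closure of its relative
    interior.\<close>
  have cl: "\<eta> \<bullet> (fst z - s) + \<beta> * (snd z - x) \<le> 0" if "z \<in> K" for z
  proof -
    have *: "\<eta> \<bullet> (fst z - s) + \<beta> * (snd z - x) \<le> 0" if "z \<in> R" for z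
    proof (rule tendsto_upperbound)
      show "((\<lambda>r. \<eta> \<bullet> (fst z - s) + \<beta> * (snd z - x - r)) \<longlongrightarrow> \<eta> \<bullet> (fst z - s) + \<beta> * (snd z - x)) (at_right 0)"
        by (auto intro!: tendsto_eq_intros)
      show "\<forall>\<^sub>F r in at_right 0. \<eta> \<bullet> (fst z - s) + \<beta> * (snd z - x - r) \<le> 0"
        using le[OF that] by (simp add: eventually_at_filter)
    qed simp
    have "closure R \<subseteq> {z. \<eta> \<bullet> (fst z - s) + \<beta> * (snd z - x) \<le> 0}"
      using * by (intro closure_minimal closed_Collect_le continuous_intros) auto
    with RK that show ?thesis
      by blast
  qed
  obtain z0 where z0: "z0 \<in> R"
    using \<open>R \<noteq> {}\<close> by blast
  have "\<beta> \<ge> 0"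
  proof (rule ccontr)
    assume \<beta>: "\<not> \<beta> \<ge> 0"
    define c where "c = \<eta> \<bullet> (fst z0 - s) + \<beta> * (snd z0 - x)"
    define r where "r = (\<bar>c\<bar> + 1) / - \<beta>"
    have "r > 0"
      unfolding r_def using \<beta> by (intro divide_pos_pos) auto
    have "c - \<beta> * r \<le> 0"
      using le[OF z0 \<open>r > 0\<close>] by (simp add: c_def algebra_simps)
    moreover have "\<beta> * r = - (\<bar>c\<bar> + 1)"
      using \<beta> by (simp add: r_def)
    ultimately have "c + (\<bar>c\<bar> + 1) \<le> 0"
      by simp
    then show False
      by linarith
  qed
  moreover have "\<beta> \<noteq> 0"
  proof
    assume \<beta>: "\<beta> = 0"
    then have "\<forall>z\<in>K. 0 \<le> (- \<eta>) \<bullet> (fst z - s)"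
      using cl by simp
    with NA[OF \<eta>] have "K \<subseteq> {z. (\<eta>, 0) \<bullet> z = \<eta> \<bullet> s}"
      by (auto simp: inner_diff_right)
    then have "convex hull K \<subseteq> {z. (\<eta>, 0) \<bullet> z = \<eta> \<bullet> s}"
      by (intro hull_minimal convex_hyperplane)
    then have "R \<subseteq> {z. (\<eta>, 0) \<bullet> z = \<eta> \<bullet> s}"
      using rel_interior_subset unfolding R_def by blast
    then have "\<forall>z\<in>D. v \<bullet> z = 0"
      by (auto simp: D_def C_def v_eq \<beta> inner_add_right inner_diff_right)
    with v(2) show False
      by blast
  qed
  ultimately have "\<beta> > 0"
    by simp
  have "(1 / \<beta>) *\<^sub>R (- \<eta>) \<in> B"
    using \<eta> B(2) \<open>\<beta> > 0\<close> by (intro convex_cone_scaleR) auto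
  moreover have "snd z \<le> x + ((1 / \<beta>) *\<^sub>R (- \<eta>)) \<bullet> (fst z - s)" if "z \<in> K" for z
    using cl[OF that] \<open>\<beta> > 0\<close> by (simp add: field_simps)
  ultimately show ?thesis
    by blast
qed

section \<open>Closed supports and measurable selection\<close>

lemma closed_support_subset:
  "closed C \<Longrightarrow> emeasure \<mu> (- C) = 0 \<Longrightarrow> closed_support \<mu> \<subseteq> C"
  by (auto simp: closed_support_def)

lemma closed_closed_support: "closed (closed_support \<mu>)"
  unfolding closed_support_def by (intro closed_Inter) auto

text \<open>The complement is a union of open null sets, uncountably many in general; by second
  countability countably many of them already cover it.\<close>

lemma emeasure_Compl_closed_support:
  fixes \<mu> :: "'c::second_countable_topology measure"
  assumes "sets \<mu> = sets borel"
  shows "emeasure \<mu> (- closed_support \<mu>) = 0"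
proof -
  define W where "W = {V. open V \<and> emeasure \<mu> V = 0}"
  obtain W' where W': "W' \<subseteq> W" "countable W'" "\<Union>W' = \<Union>W"
    using Lindelof[of W] by (auto simp: W_def)
  have "- closed_support \<mu> \<subseteq> \<Union>W"
  proof
    fix z assume "z \<in> - closed_support \<mu>"
    then obtain C where C: "closed C" "emeasure \<mu> (- C) = 0" "z \<notin> C"
      by (auto simp: closed_support_def)
    then have "- C \<in> W"
      by (simp add: W_def open_Compl)
    with C(3) show "z \<in> \<Union>W"
      by blast
  qed
  moreover have "(\<Union>V\<in>W'. V) \<in> null_sets \<mu>"
  proof (rule null_sets_UN')
    show "V \<in> null_sets \<mu>" if "V \<in> W'" for V
      using that W'(1) assms by (auto simp: W_def null_sets_def)
  qed (rule W'(2))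
  moreover have "- closed_support \<mu> \<in> sets \<mu>"
    using closed_closed_support[of \<mu>] assms by (auto intro: borel_open open_Compl)
  ultimately show ?thesis
    using W'(3) null_sets_subset[of "\<Union>W'" \<mu> "- closed_support \<mu>"] by (auto simp: null_sets_def)
qed

text \<open>Meeting the support becomes a statement about mass. This is how conditions on the random
  set \<open>closed_support (\<kappa> \<omega>)\<close> become measurable: for a kernel, the mass of
  an open set is a measurable function of \<open>\<omega>\<close>.\<close>

lemma closed_support_Int_open_eq_empty_iff:
  fixes \<mu> :: "'c::second_countable_topology measure"
  assumes "open U" "sets \<mu> = sets borel"
  shows "closed_support \<mu> \<inter> U = {} \<longleftrightarrow> emeasure \<mu> U = 0"
proof
  assume "closed_support \<mu> \<inter> U = {}"
  then have "emeasure \<mu> U \<le> emeasure \<mu> (- closed_support \<mu>)"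
    using closed_closed_support[of \<mu>] assms(2) by (intro emeasure_mono) (auto intro: borel_open open_Compl)
  then show "emeasure \<mu> U = 0"
    using emeasure_Compl_closed_support[OF assms(2)] by simp
next
  assume "emeasure \<mu> U = 0"
  with assms(1) show "closed_support \<mu> \<inter> U = {}"
    using closed_support_subset[of "- U" \<mu>] by (auto simp: closed_Compl)
qed

lemma AE_closed_support:
  fixes \<mu> :: "'c::second_countable_topology measure"
  assumes "sets \<mu> = sets borel"
  shows "AE z in \<mu>. z \<in> closed_support \<mu>"
  using emeasure_Compl_closed_support[OF assms] closed_closed_support[of \<mu>] assms
    sets_eq_imp_space_eq[OF assms]
  by (intro AE_I[of _ _ "- closed_support \<mu>"]) (auto intro: borel_open open_Compl)

lemma closed_support_nonempty:
  fixes \<mu> :: "'c::second_countable_topology measure"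
  assumes "prob_space \<mu>" "sets \<mu> = sets borel"
  shows "closed_support \<mu> \<noteq> {}"
proof
  assume "closed_support \<mu> = {}"
  then have "emeasure \<mu> (space \<mu>) = 0"
    using emeasure_Compl_closed_support[OF assms(2)] sets_eq_imp_space_eq[OF assms(2)] by simp
  then show False
    using prob_space.emeasure_space_1[OF assms(1)] by simp
qed

text \<open>The theorem of Kuratowski and Ryll-Nardzewski. The selection is approximated by points
  of a countable dense sequence \<open>d\<close>, always with the least admissible index: the
  indices take countably many values, so their measurability reduces to the events that
  \<open>G\<close> meets an open set. The approximations converge, and points of \<open>G\<close>
  close to them carry the limit into the closed set.\<close>

theorem measurable_selection:
  fixes G :: "'a \<Rightarrow> 'b::polish_space set"
  assumes closed: "\<And>\<omega>. \<omega> \<in> space H \<Longrightarrow> closed (G \<omega>)"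
    and nonempty: "\<And>\<omega>. \<omega> \<in> space H \<Longrightarrow> G \<omega> \<noteq> {}"
    and meas: "\<And>U. open U \<Longrightarrow> {\<omega>\<in>space H. G \<omega> \<inter> U \<noteq> {}} \<in> sets H"
  shows "\<exists>g\<in>borel_measurable H. \<forall>\<omega>\<in>space H. g \<omega> \<in> G \<omega>"
proof -
  obtain D :: "'b set" where D: "countable D" "\<And>U. open U \<Longrightarrow> U \<noteq> {} \<Longrightarrow> \<exists>x\<in>D. x \<in> U"
    using countable_dense_setE by blast
  then have "D \<noteq> {}"
    using open_UNIV by blast
  define d where "d = from_nat_into D"
  have dense: "\<exists>n. x \<in> ball (d n) e" if "e > 0" for x e
  proof -
    obtain y where "y \<in> D" "y \<in> ball x e"
      using D(2)[OF open_ball, of x e] \<open>e > 0\<close> by (metis ball_eq_empty not_le)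
    moreover then obtain n where "d n = y"
      using from_nat_into_surj[OF D(1), of y] unfolding d_def by (auto simp: that)
    ultimately show ?thesis
      by (auto simp: dist_commute intro!: exI[of _ n])
  qed
  \<comment> \<open>The next ball, of half the radius, has to meet \<open>G \<omega>\<close> inside
    the current ball. A point of this intersection bounds the distance of the two centres and lets
    the construction continue at the next stage.\<close>
  define P where "P k c n \<omega> \<longleftrightarrow> G \<omega> \<inter> (ball (d n) ((1/2)^Suc k) \<inter> ball (d c) ((1/2)^k)) \<noteq> {}" for k c n \<omega>
  define N where "N = rec_nat (\<lambda>\<omega>. LEAST n. G \<omega> \<inter> ball (d n) 1 \<noteq> {}) (\<lambda>k c \<omega>. LEAST n. P k (c \<omega>) n \<omega>)"
  have N0: "N 0 = (\<lambda>\<omega>. LEAST n. G \<omega> \<inter> ball (d n) 1 \<noteq> {})" and NS: "N (Suc k) = (\<lambda>\<omega>. LEAST n. P k (N k \<omega>) n \<omega>)" for k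
    by (simp_all add: N_def)
  have N_meas: "N k \<in> measurable H (count_space UNIV)" for k
  proof (induction k)
    case 0
    show ?case
      unfolding N0 by (intro measurable_Least) (auto simp: pred_def intro!: meas)
  next
    case (Suc k)
    have "Measurable.pred H (\<lambda>\<omega>. P k (N k \<omega>) n \<omega>)" for n
    proof (rule measurable_compose_countable[OF _ Suc])
      show "Measurable.pred H (\<lambda>\<omega>. P k c n \<omega>)" for c
        unfolding P_def pred_def by (intro meas open_Int open_ball)
    qed
    then show ?case
      unfolding NS by (intro measurable_Least)
  qed
  have inv: "G \<omega> \<inter> ball (d (N k \<omega>)) ((1/2)^k) \<noteq> {} \<and> P k (N k \<omega>) (N (Suc k) \<omega>) \<omega>" if \<omega>: "\<omega> \<in> space H" for k \<omega>
  proof (induction k)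
    case 0
    obtain y where "y \<in> G \<omega>"
      using nonempty[OF \<omega>] by blast
    then have "\<exists>n. G \<omega> \<inter> ball (d n) 1 \<noteq> {}"
      using dense[of 1 y] by (metis IntI empty_iff zero_less_one)
    then have *: "G \<omega> \<inter> ball (d (N 0 \<omega>)) 1 \<noteq> {}"
      unfolding N0 by (rule LeastI_ex)
    then obtain z where z: "z \<in> G \<omega>" "z \<in> ball (d (N 0 \<omega>)) 1"
      by blast
    moreover obtain n where "z \<in> ball (d n) ((1/2)^Suc 0)"
      using dense[of "(1/2)^Suc 0" z] by auto
    ultimately have "\<exists>n. P 0 (N 0 \<omega>) n \<omega>"
      unfolding P_def power_0 by blast
    then show ?case
      using * LeastI_ex[of "\<lambda>n. P 0 (N 0 \<omega>) n \<omega>"] by (simp add: NS)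
  next
    case (Suc k)
    have *: "G \<omega> \<inter> ball (d (N (Suc k) \<omega>)) ((1/2)^Suc k) \<noteq> {}"
      using Suc unfolding P_def by blast
    then obtain z where z: "z \<in> G \<omega>" "z \<in> ball (d (N (Suc k) \<omega>)) ((1/2)^Suc k)"
      by blast
    moreover obtain n where "z \<in> ball (d n) ((1/2)^Suc (Suc k))"
      using dense[of "(1/2)^Suc (Suc k)" z] by auto
    ultimately have "\<exists>n. P (Suc k) (N (Suc k) \<omega>) n \<omega>"
      unfolding P_def by blast
    then show ?case
      using * LeastI_ex[of "\<lambda>n. P (Suc k) (N (Suc k) \<omega>) n \<omega>"] by (simp add: NS[of "Suc k"])
  qed
  define f where "f k \<omega> = d (N k \<omega>)" for k \<omega>
  have f_meas: "f k \<in> borel_measurable H" for k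
    unfolding f_def by (rule measurable_compose[OF N_meas]) simp
  have dist_Suc: "dist (f k \<omega>) (f (Suc k) \<omega>) < 2 * (1/2)^k" if \<omega>: "\<omega> \<in> space H" for k \<omega>
  proof -
    obtain z where "dist (f (Suc k) \<omega>) z < (1/2)^Suc k" "dist (f k \<omega>) z < (1/2)^k"
      using inv[OF \<omega>, of k] by (auto simp: P_def f_def simp del: power_Suc)
    moreover have "(1/2)^Suc k < (1/2::real)^k"
      by simp
    ultimately show ?thesis
      using dist_triangle2[of "f k \<omega>" "f (Suc k) \<omega>" z] by linarith
  qed
  have conv: "convergent (\<lambda>k. f k \<omega>)" if "\<omega> \<in> space H" for \<omega>
  proof (rule Cauchy_convergent)
    show "Cauchy (\<lambda>k. f k \<omega>)"
    proof (rule metric_CauchyI)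
      fix e :: real assume "e > 0"
      then obtain k0 where k0: "(1/2)^k0 < e / 4"
        using real_arch_pow_inv[of "e/4" "1/2"] by auto
      \<comment> \<open>A step of size \<open>2 * (1/2)^k\<close> equals
        \<open>4 * (1/2)^k - 4 * (1/2)^Suc k\<close>, so the bounds telescope.\<close>
      have step: "dist (f m \<omega>) (f (m + j) \<omega>) \<le> 4 * (1/2)^m - 4 * (1/2)^(m + j)" for m j
      proof (induction j)
        case (Suc j)
        have "dist (f m \<omega>) (f (m + Suc j) \<omega>) \<le> dist (f m \<omega>) (f (m + j) \<omega>) + dist (f (m + j) \<omega>) (f (Suc (m + j)) \<omega>)"
          using dist_triangle by simp
        also have "\<dots> \<le> (4 * (1/2)^m - 4 * (1/2)^(m + j)) + 2 * (1/2)^(m + j)"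
          using Suc dist_Suc[OF that, of "m + j"] by (intro add_mono) auto
        finally show ?case
          by simp
      qed simp
      have close: "dist (f m \<omega>) (f n \<omega>) < e" if "k0 \<le> m" "m \<le> n" for m n
      proof -
        have "dist (f m \<omega>) (f n \<omega>) \<le> 4 * (1/2)^m"
        proof -
          have "dist (f m \<omega>) (f n \<omega>) \<le> 4 * (1/2)^m - 4 * (1/2)^n"
            using step[of m "n - m"] that(2) by simp
          moreover have "0 \<le> (1/2::real)^n"
            by simp
          ultimately show ?thesis
            by linarith
        qed
        also have "\<dots> \<le> 4 * (1/2)^k0"
          using that(1) by (simp add: power_decreasing)
        finally show ?thesis
          using k0 by simp
      qed
      show "\<exists>k0. \<forall>m\<ge>k0. \<forall>n\<ge>k0. dist (f m \<omega>) (f n \<omega>) < e"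
      proof (intro exI allI impI)
        fix m n assume "k0 \<le> m" "k0 \<le> n"
        then show "dist (f m \<omega>) (f n \<omega>) < e"
          using close[of m n] close[of n m] by (cases "m \<le> n") (auto simp: dist_commute)
      qed
    qed
  qed
  define g where "g \<omega> = lim (\<lambda>k. f k \<omega>)" for \<omega>
  have lim: "(\<lambda>k. f k \<omega>) \<longlonglongrightarrow> g \<omega>" if "\<omega> \<in> space H" for \<omega>
    using conv[OF that] unfolding g_def by (simp add: convergent_LIMSEQ_iff)
  have "g \<in> borel_measurable H"
    using f_meas lim by (rule borel_measurable_LIMSEQ_metric)
  moreover have "g \<omega> \<in> G \<omega>" if \<omega>: "\<omega> \<in> space H" for \<omega>
  proof -
    have "\<exists>z. z \<in> G \<omega> \<and> dist (f k \<omega>) z < (1/2)^k" for k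
      using inv[OF \<omega>, of k] by (auto simp: f_def)
    then obtain z where z: "\<And>k. z k \<in> G \<omega>" "\<And>k. dist (f k \<omega>) (z k) < (1/2)^k"
      by metis
    have "(\<lambda>k. (1/2)^k + dist (f k \<omega>) (g \<omega>)) \<longlonglongrightarrow> 0 + 0"
      using lim[OF \<omega>] by (intro tendsto_add LIMSEQ_power_zero) (simp_all add: tendsto_dist_iff[symmetric])
    moreover have "dist (z k) (g \<omega>) \<le> (1/2)^k + dist (f k \<omega>) (g \<omega>)" for k
      using z(2)[of k] dist_triangle3[of "z k" "g \<omega>" "f k \<omega>"] by linarith
    ultimately have "(\<lambda>k. dist (z k) (g \<omega>)) \<longlonglongrightarrow> 0"
      by (intro Lim_null_comparison[of "\<lambda>k. dist (z k) (g \<omega>)" "\<lambda>k. (1/2)^k + dist (f k \<omega>) (g \<omega>)"])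
         (simp_all add: always_eventually)
    then have "z \<longlonglongrightarrow> g \<omega>"
      by (simp only: tendsto_dist_iff[of z])
    then show ?thesis
      using closed_sequentially[OF closed[OF \<omega>]] z(1) by blast
  qed
  ultimately show ?thesis
    by blast
qed

section \<open>Regular conditional distributions\<close>

lemma prob_algebra_kernelD:
  assumes "\<kappa> \<in> measurable H (prob_algebra N)" "\<omega> \<in> space H"
  shows "prob_space (\<kappa> \<omega>)" "sets (\<kappa> \<omega>) = sets N"
  using measurable_space[OF assms] by (auto simp: space_prob_algebra)

lemma set_integral_indicator_vimage:
  assumes E: "E \<in> sets M"
  shows "(\<integral>\<omega>\<in>E. indicat_real (\<eta> -` A) \<omega> \<partial>M) = measure M (E \<inter> \<eta> -` A)"
proof -
  have "(\<integral>\<omega>\<in>E. indicat_real (\<eta> -` A) \<omega> \<partial>M) = (\<integral>\<omega>. indicator (E \<inter> \<eta> -` A) \<omega> \<partial>M)"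
    unfolding set_lebesgue_integral_def by (intro Bochner_Integration.integral_cong) (auto split: split_indicator)
  then show ?thesis
    using sets.sets_into_space[OF E] by (simp add: Int_absorb2 inf.coboundedI1)
qed

text \<open>Integrating over sets of \<open>H\<close> replaces a null set for each \<open>A\<close>
  by identities without exceptions: \<open>\<kappa>\<close> is a version exactly if it gives the
  right mass to all rectangles \<open>E \<times> A\<close>. Identities of this form are what
  uniqueness of measures on a generator asks for.\<close>

lemma regular_cond_distr_iff:
  fixes \<eta> :: "'a \<Rightarrow> 'c::euclidean_space"
  assumes M: "prob_space M" and H: "subalgebra M H" and \<eta>[measurable]: "\<eta> \<in> borel_measurable M"
  shows "regular_cond_distr M H \<eta> \<kappa> \<longleftrightarrow>
    \<kappa> \<in> measurable H (prob_algebra borel) \<and>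
    (\<forall>E\<in>sets H. \<forall>A\<in>sets borel. (\<integral>\<^sup>+\<omega>\<in>E. emeasure (\<kappa> \<omega>) A \<partial>M) = emeasure M (E \<inter> \<eta> -` A))"
proof (cases "\<kappa> \<in> measurable H (prob_algebra borel)")
  case \<kappa>: True
  interpret M: prob_space M by (rule M)
  interpret finite_measure_subalgebra M H
    using H by unfold_locales
  have space: "space H = space M" and sets: "sets H \<subseteq> sets M"
    using H by (auto simp: subalgebra_def)
  have *: "(AE \<omega> in M. measure (\<kappa> \<omega>) A = real_cond_exp M H (indicat_real (\<eta> -` A)) \<omega>) \<longleftrightarrow>
      (\<forall>E\<in>sets H. (\<integral>\<^sup>+\<omega>\<in>E. emeasure (\<kappa> \<omega>) A \<partial>M) = emeasure M (E \<inter> \<eta> -` A))"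
    (is "?L \<longleftrightarrow> ?R") if A[measurable]: "A \<in> sets borel" for A
  proof -
    let ?k = "\<lambda>\<omega>. measure (\<kappa> \<omega>) A" and ?i = "indicat_real (\<eta> -` A)"
    have kH: "?k \<in> borel_measurable H"
      using measurable_prob_algebraD[OF \<kappa>] A by (rule measurable_compose[OF _ measurable_measure_subprob_algebra])
    then have kM[measurable]: "?k \<in> borel_measurable M"
      by (rule measurable_from_subalg[OF H])
    have iM[measurable]: "?i \<in> borel_measurable M"
      by measurable
    have int_k: "integrable M ?k"
      using prob_algebra_kernelD(1)[OF \<kappa>] prob_space.prob_le_1 space
      by (intro M.integrable_const_bound[of _ 1] AE_I2) auto
    have int_i: "integrable M ?i"
      by (intro M.integrable_const_bound[of _ 1] AE_I2) auto
    have nn: "(\<integral>\<^sup>+\<omega>\<in>E. emeasure (\<kappa> \<omega>) A \<partial>M) = ennreal (\<integral>\<omega>\<in>E. ?k \<omega> \<partial>M)" if "E \<in> sets H" for E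
    proof -
      have E: "E \<in> sets M"
        using that sets by blast
      have "(\<integral>\<^sup>+\<omega>\<in>E. emeasure (\<kappa> \<omega>) A \<partial>M) = (\<integral>\<^sup>+\<omega>. ennreal (indicator E \<omega> *\<^sub>R ?k \<omega>) \<partial>M)"
      proof (rule nn_integral_cong)
        fix \<omega> assume "\<omega> \<in> space M"
        then interpret K: prob_space "\<kappa> \<omega>"
          using prob_algebra_kernelD(1)[OF \<kappa>] space by auto
        show "emeasure (\<kappa> \<omega>) A * indicator E \<omega> = ennreal (indicator E \<omega> *\<^sub>R ?k \<omega>)"
          by (auto simp: K.emeasure_eq_measure split: split_indicator)
      qed
      also have "\<dots> = ennreal (\<integral>\<omega>\<in>E. ?k \<omega> \<partial>M)"
        unfolding set_lebesgue_integral_def using integrable_mult_indicator[OF E int_k]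
        by (intro nn_integral_eq_integral) auto
      finally show ?thesis .
    qed
    have mi: "emeasure M (E \<inter> \<eta> -` A) = ennreal (\<integral>\<omega>\<in>E. ?i \<omega> \<partial>M)" if "E \<in> sets H" for E
    proof -
      have E: "E \<in> sets M"
        using that sets by blast
      then show ?thesis
        by (simp add: M.emeasure_eq_measure set_integral_indicator_vimage)
    qed
    have nonneg: "0 \<le> (\<integral>\<omega>\<in>E. ?k \<omega> \<partial>M)" "0 \<le> (\<integral>\<omega>\<in>E. ?i \<omega> \<partial>M)" for E
      by (auto simp: set_lebesgue_integral_def intro!: integral_nonneg)
    have R: "?R \<longleftrightarrow> (\<forall>E\<in>sets H. (\<integral>\<omega>\<in>E. ?k \<omega> \<partial>M) = (\<integral>\<omega>\<in>E. ?i \<omega> \<partial>M))"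
      using nn mi nonneg by (intro ball_cong refl) (simp add: ennreal_inj)
    show ?thesis
    proof
      assume L: ?L
      show ?R
        unfolding R
      proof
        fix E assume E: "E \<in> sets H"
        have "(\<integral>\<omega>\<in>E. ?k \<omega> \<partial>M) = (\<integral>\<omega>\<in>E. real_cond_exp M H ?i \<omega> \<partial>M)"
          unfolding set_lebesgue_integral_def
        proof (rule integral_cong_AE)
          have [measurable]: "E \<in> sets M"
            using E sets by blast
          show "(\<lambda>\<omega>. indicat_real E \<omega> *\<^sub>R ?k \<omega>) \<in> borel_measurable M"
            by measurable
          show "(\<lambda>\<omega>. indicat_real E \<omega> *\<^sub>R real_cond_exp M H ?i \<omega>) \<in> borel_measurable M"
            by measurable
          show "AE \<omega> in M. indicat_real E \<omega> *\<^sub>R ?k \<omega> = indicat_real E \<omega> *\<^sub>R real_cond_exp M H ?i \<omega>"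
            using L by eventually_elim simp
        qed
        then show "(\<integral>\<omega>\<in>E. ?k \<omega> \<partial>M) = (\<integral>\<omega>\<in>E. ?i \<omega> \<partial>M)"
          using real_cond_exp_intA[OF int_i E] by simp
      qed
    next
      assume ?R
      then have "AE \<omega> in M. real_cond_exp M H ?i \<omega> = ?k \<omega>"
        unfolding R using int_i int_k kH by (intro real_cond_exp_charact) auto
      then show ?L
        by eventually_elim simp
    qed
  qed
  show ?thesis
    unfolding regular_cond_distr_def using \<kappa> * by blast
qed (simp add: regular_cond_distr_def)

text \<open>Disintegration, needed because \<open>P\<close> varies with \<open>\<omega>\<close>
  whereas a conditional distribution is defined through fixed Borel sets. The law \<open>N2\<close>
  of \<open>(\<omega>, \<eta> \<omega>)\<close> and the measure \<open>N1\<close> composed of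
  \<open>M\<close> and \<open>\<kappa>\<close> agree on rectangles, hence on the whole product with
  \<open>H\<close>, and so they give the same mass to the set where \<open>P\<close> fails.\<close>

lemma AE_regular_cond_distr_iff:
  fixes \<eta> :: "'a \<Rightarrow> 'c::euclidean_space"
  assumes M: "prob_space M" and H: "subalgebra M H" and \<eta>[measurable]: "\<eta> \<in> borel_measurable M"
    and \<kappa>: "regular_cond_distr M H \<eta> \<kappa>"
    and P[measurable]: "Measurable.pred (H \<Otimes>\<^sub>M borel) (\<lambda>(\<omega>, z). P \<omega> z)"
  shows "(AE \<omega> in M. P \<omega> (\<eta> \<omega>)) \<longleftrightarrow> (AE \<omega> in M. AE z in \<kappa> \<omega>. P \<omega> z)"
proof -
  interpret M: prob_space M by (rule M)
  let ?N = "H \<Otimes>\<^sub>M (borel :: 'c measure)"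
  have space: "space H = space M" and sets: "sets H \<subseteq> sets M"
    using H by (auto simp: subalgebra_def)
  have \<kappa>H: "\<kappa> \<in> measurable H (prob_algebra borel)"
    and \<kappa>E: "\<And>E A. E \<in> sets H \<Longrightarrow> A \<in> sets borel \<Longrightarrow> (\<integral>\<^sup>+\<omega>\<in>E. emeasure (\<kappa> \<omega>) A \<partial>M) = emeasure M (E \<inter> \<eta> -` A)"
    using \<kappa> regular_cond_distr_iff[OF M H \<eta>] by blast+
  note \<kappa>D = prob_algebra_kernelD[OF \<kappa>H]
  have K1: "(\<lambda>\<omega>. distr (\<kappa> \<omega>) ?N (Pair \<omega>)) \<in> measurable H (subprob_algebra ?N)"
    by (rule measurable_distr2[OF _ measurable_prob_algebraD[OF \<kappa>H]]) simp
  then have K: "(\<lambda>\<omega>. distr (\<kappa> \<omega>) ?N (Pair \<omega>)) \<in> measurable M (subprob_algebra ?N)"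
    by (rule measurable_from_subalg[OF H])
  define N1 where "N1 = M \<bind> (\<lambda>\<omega>. distr (\<kappa> \<omega>) ?N (Pair \<omega>))"
  have idH: "(\<lambda>\<omega>. \<omega>) \<in> measurable M H"
    by (rule measurable_from_subalg[OF H]) simp
  have pair[measurable]: "(\<lambda>\<omega>. (\<omega>, \<eta> \<omega>)) \<in> measurable M ?N"
    using idH by measurable
  define N2 where "N2 = distr M ?N (\<lambda>\<omega>. (\<omega>, \<eta> \<omega>))"
  have slice: "emeasure (distr (\<kappa> \<omega>) ?N (Pair \<omega>)) Z = emeasure (\<kappa> \<omega>) (Pair \<omega> -` Z)"
    if Z: "Z \<in> sets ?N" and \<omega>: "\<omega> \<in> space H" for Z \<omega>
  proof -
    have s: "sets (\<kappa> \<omega>) = sets borel"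
      using \<kappa>D(2) \<omega> by simp
    have "Pair \<omega> \<in> measurable (\<kappa> \<omega>) ?N"
      using \<omega> by (simp add: measurable_cong_sets[OF s refl])
    from emeasure_distr[OF this Z] show ?thesis
      by (simp add: sets_eq_imp_space_eq[OF s])
  qed
  have N1: "emeasure N1 Z = (\<integral>\<^sup>+\<omega>. emeasure (\<kappa> \<omega>) (Pair \<omega> -` Z) \<partial>M)" if Z: "Z \<in> sets ?N" for Z
  proof -
    have "emeasure N1 Z = (\<integral>\<^sup>+\<omega>. emeasure (distr (\<kappa> \<omega>) ?N (Pair \<omega>)) Z \<partial>M)"
      unfolding N1_def using M.not_empty K Z by (rule emeasure_bind)
    also have "\<dots> = (\<integral>\<^sup>+\<omega>. emeasure (\<kappa> \<omega>) (Pair \<omega> -` Z) \<partial>M)"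
      using slice[OF Z] space by (intro nn_integral_cong) simp
    finally show ?thesis .
  qed
  have sets_N1: "sets N1 = sets ?N"
    unfolding N1_def by (rule sets_bind) (simp_all add: M.not_empty)
  have "N1 = N2"
  proof (rule measure_eqI_generator_eq)
    let ?E = "{a \<times> b | a b. a \<in> sets H \<and> b \<in> sets (borel :: 'c measure)}"
    show "Int_stable ?E"
      by (rule Int_stable_pair_measure_generator)
    show "?E \<subseteq> Pow (space H \<times> UNIV)"
      using pair_measure_closed[of H "borel :: 'c measure"] by simp
    show "sets N1 = sigma_sets (space H \<times> UNIV) ?E"
      unfolding sets_N1 sets_pair_measure by simp
    show "sets N2 = sigma_sets (space H \<times> UNIV) ?E"
      unfolding N2_def sets_distr sets_pair_measure by simp
    show "range (\<lambda>_::nat. space H \<times> UNIV) \<subseteq> ?E"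
      using sets.top[of H] sets.top[of "borel :: 'c measure"] by (simp only: space_borel) blast
    fix Z assume "Z \<in> ?E"
    then obtain E A where Z: "Z = E \<times> A" "E \<in> sets H" "A \<in> sets borel"
      by blast
    then have Z': "Z \<in> sets ?N"
      by simp
    have "emeasure N1 Z = (\<integral>\<^sup>+\<omega>\<in>E. emeasure (\<kappa> \<omega>) A \<partial>M)"
      unfolding N1[OF Z'] by (rule nn_integral_cong) (auto simp: Z(1) split: split_indicator)
    also have "\<dots> = emeasure M (E \<inter> \<eta> -` A)"
      using \<kappa>E Z by blast
    also have "E \<inter> \<eta> -` A = (\<lambda>\<omega>. (\<omega>, \<eta> \<omega>)) -` Z \<inter> space M"
      using Z(1) sets.sets_into_space[of E M] Z(2) sets by auto
    also have "emeasure M \<dots> = emeasure N2 Z"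
      unfolding N2_def using pair Z' by (simp add: emeasure_distr)
    finally show "emeasure N1 Z = emeasure N2 Z" .
  next
    have "emeasure N1 (space H \<times> UNIV) = (\<integral>\<^sup>+\<omega>. 1 \<partial>M)"
    proof (subst N1)
      show "(\<integral>\<^sup>+\<omega>. emeasure (\<kappa> \<omega>) (Pair \<omega> -` (space H \<times> UNIV)) \<partial>M) = (\<integral>\<^sup>+\<omega>. 1 \<partial>M)"
      proof (rule nn_integral_cong)
        fix \<omega> assume \<omega>: "\<omega> \<in> space M"
        then interpret K: prob_space "\<kappa> \<omega>"
          using \<kappa>D(1) space by simp
        have "Pair \<omega> -` (space H \<times> UNIV) = space (\<kappa> \<omega>)"
          using \<omega> space sets_eq_imp_space_eq[OF \<kappa>D(2)[of \<omega>]] by auto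
        then show "emeasure (\<kappa> \<omega>) (Pair \<omega> -` (space H \<times> UNIV)) = 1"
          by (simp add: K.emeasure_space_1)
      qed
    qed auto
    then show "emeasure N1 (space H \<times> UNIV) \<noteq> \<infinity>"
      by (simp add: M.emeasure_space_1)
  qed auto
  define Z where "Z = {x\<in>space ?N. \<not> (case x of (\<omega>, z) \<Rightarrow> P \<omega> z)}"
  have Z: "Z \<in> sets ?N"
    unfolding Z_def by measurable
  have "(AE \<omega> in M. P \<omega> (\<eta> \<omega>)) \<longleftrightarrow> emeasure M {\<omega>\<in>space M. \<not> P \<omega> (\<eta> \<omega>)} = 0"
  proof (rule AE_iff_measurable[OF _ refl])
    have "{\<omega>\<in>space M. \<not> P \<omega> (\<eta> \<omega>)} = (\<lambda>\<omega>. (\<omega>, \<eta> \<omega>)) -` Z \<inter> space M"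
      using space by (auto simp: Z_def space_pair_measure)
    also have "\<dots> \<in> sets M"
      using pair Z by (rule measurable_sets)
    finally show "{\<omega>\<in>space M. \<not> P \<omega> (\<eta> \<omega>)} \<in> sets M" .
  qed
  also have "{\<omega>\<in>space M. \<not> P \<omega> (\<eta> \<omega>)} = (\<lambda>\<omega>. (\<omega>, \<eta> \<omega>)) -` Z \<inter> space M"
    using space by (auto simp: Z_def space_pair_measure)
  also have "emeasure M \<dots> = emeasure N2 Z"
    unfolding N2_def using pair Z by (simp add: emeasure_distr)
  also have "\<dots> = (\<integral>\<^sup>+\<omega>. emeasure (\<kappa> \<omega>) (Pair \<omega> -` Z) \<partial>M)"
    using \<open>N1 = N2\<close> N1[OF Z] by simp
  also have "\<dots> = 0 \<longleftrightarrow> (AE \<omega> in M. emeasure (\<kappa> \<omega>) (Pair \<omega> -` Z) = 0)"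
  proof (rule nn_integral_0_iff_AE)
    have "(\<lambda>\<omega>. emeasure (distr (\<kappa> \<omega>) ?N (Pair \<omega>)) Z) \<in> borel_measurable H"
      using K1 Z by (rule measurable_compose[OF _ measurable_emeasure_subprob_algebra])
    then have "(\<lambda>\<omega>. emeasure (\<kappa> \<omega>) (Pair \<omega> -` Z)) \<in> borel_measurable H"
      by (rule measurable_cong[THEN iffD1, rotated]) (rule slice[OF Z])
    then show "(\<lambda>\<omega>. emeasure (\<kappa> \<omega>) (Pair \<omega> -` Z)) \<in> borel_measurable M"
      by (rule measurable_from_subalg[OF H])
  qed
  also have "\<dots> \<longleftrightarrow> (AE \<omega> in M. AE z in \<kappa> \<omega>. P \<omega> z)"
  proof (rule AE_cong)
    fix \<omega> assume \<omega>: "\<omega> \<in> space M"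
    then have s: "sets (\<kappa> \<omega>) = sets borel"
      using \<kappa>D(2) space by simp
    have "Pair \<omega> -` Z \<in> sets (\<kappa> \<omega>)"
      using sets_Pair1[OF Z] s by simp
    moreover have "{z\<in>space (\<kappa> \<omega>). \<not> P \<omega> z} = Pair \<omega> -` Z"
      using \<omega> space sets_eq_imp_space_eq[OF s] by (auto simp: Z_def space_pair_measure)
    ultimately show "emeasure (\<kappa> \<omega>) (Pair \<omega> -` Z) = 0 \<longleftrightarrow> (AE z in \<kappa> \<omega>. P \<omega> z)"
      by (rule AE_iff_measurable[symmetric])
  qed
  finally show ?thesis .
qed

section \<open>Existence of regular conditional distributions in Euclidean spaces\<close>

lemma set_nn_integral_real_cond_exp_indicator:
  fixes \<eta> :: "'a \<Rightarrow> 'c::euclidean_space"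
  assumes M: "prob_space M" and H: "subalgebra M H" and \<eta>[measurable]: "\<eta> \<in> borel_measurable M"
    and E: "E \<in> sets H" and A[measurable]: "A \<in> sets borel"
  shows "(\<integral>\<^sup>+\<omega>\<in>E. ennreal (real_cond_exp M H (indicat_real (\<eta> -` A)) \<omega>) \<partial>M) = emeasure M (E \<inter> \<eta> -` A)"
proof -
  interpret M: prob_space M by (rule M)
  interpret finite_measure_subalgebra M H
    using H by unfold_locales
  let ?i = "indicat_real (\<eta> -` A)"
  let ?r = "real_cond_exp M H ?i"
  have E_M[measurable]: "E \<in> sets M"
    using E H by (auto simp: subalgebra_def)
  have int_i: "integrable M ?i"
    by (intro M.integrable_const_bound[of _ 1] AE_I2) auto
  have "AE \<omega> in M. 0 \<le> ?r \<omega>"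
    by (intro real_cond_exp_pos) auto
  then have nonneg: "AE \<omega> in M. 0 \<le> indicator E \<omega> *\<^sub>R ?r \<omega>"
    by eventually_elim simp
  have "(\<integral>\<^sup>+\<omega>\<in>E. ennreal (?r \<omega>) \<partial>M) = (\<integral>\<^sup>+\<omega>. ennreal (indicator E \<omega> *\<^sub>R ?r \<omega>) \<partial>M)"
    by (intro nn_integral_cong) (auto split: split_indicator)
  also have "\<dots> = ennreal (\<integral>\<omega>\<in>E. ?r \<omega> \<partial>M)"
    unfolding set_lebesgue_integral_def
    using integrable_mult_indicator[OF E_M real_cond_exp_int(1)[OF int_i]] nonneg
    by (intro nn_integral_eq_integral)
  also have "(\<integral>\<omega>\<in>E. ?r \<omega> \<partial>M) = (\<integral>\<omega>\<in>E. ?i \<omega> \<partial>M)"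
    using real_cond_exp_intA[OF int_i E] by simp
  also have "\<dots> = measure M (E \<inter> \<eta> -` A)"
    using E_M by (rule set_integral_indicator_vimage)
  finally show ?thesis
    by (simp add: M.emeasure_eq_measure)
qed

text \<open>Serves two purposes: to pass from a real-valued code back to the vector that it encodes,
  and to change the sign of the value coordinate when lower prices are reduced to upper
  prices.\<close>

lemma regular_cond_distr_distr:
  fixes \<eta> :: "'a \<Rightarrow> 'c::euclidean_space" and g :: "'c \<Rightarrow> 'd::euclidean_space"
  assumes M: "prob_space M" and H: "subalgebra M H" and \<eta>[measurable]: "\<eta> \<in> borel_measurable M"
    and \<kappa>: "regular_cond_distr M H \<eta> \<kappa>" and g[measurable]: "g \<in> borel_measurable borel"
  shows "regular_cond_distr M H (\<lambda>\<omega>. g (\<eta> \<omega>)) (\<lambda>\<omega>. distr (\<kappa> \<omega>) borel g)"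
proof -
  have \<kappa>H: "\<kappa> \<in> measurable H (prob_algebra borel)"
    and \<kappa>E: "\<And>E A. E \<in> sets H \<Longrightarrow> A \<in> sets borel \<Longrightarrow> (\<integral>\<^sup>+\<omega>\<in>E. emeasure (\<kappa> \<omega>) A \<partial>M) = emeasure M (E \<inter> \<eta> -` A)"
    using \<kappa> regular_cond_distr_iff[OF M H \<eta>] by blast+
  have g\<eta>: "(\<lambda>\<omega>. g (\<eta> \<omega>)) \<in> borel_measurable M"
    by measurable
  show ?thesis
    unfolding regular_cond_distr_iff[OF M H g\<eta>]
  proof (intro conjI ballI)
    show "(\<lambda>\<omega>. distr (\<kappa> \<omega>) borel g) \<in> measurable H (prob_algebra borel)"
      using \<kappa>H measurable_distr_prob_space[OF g] by (rule measurable_compose)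
    fix E A assume E: "E \<in> sets H" and A: "A \<in> sets (borel :: 'd measure)"
    have "(\<integral>\<^sup>+\<omega>\<in>E. emeasure (distr (\<kappa> \<omega>) borel g) A \<partial>M) = (\<integral>\<^sup>+\<omega>\<in>E. emeasure (\<kappa> \<omega>) (g -` A) \<partial>M)"
    proof (rule nn_integral_cong)
      fix \<omega> assume "\<omega> \<in> space M"
      then have s: "sets (\<kappa> \<omega>) = sets borel"
        using prob_algebra_kernelD(2)[OF \<kappa>H] H by (simp add: subalgebra_def)
      have "g \<in> measurable (\<kappa> \<omega>) borel"
        by (simp add: measurable_cong_sets[OF s refl])
      from emeasure_distr[OF this A]
      show "emeasure (distr (\<kappa> \<omega>) borel g) A * indicator E \<omega> = emeasure (\<kappa> \<omega>) (g -` A) * indicator E \<omega>"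
        by (simp add: sets_eq_imp_space_eq[OF s])
    qed
    also have "\<dots> = emeasure M (E \<inter> \<eta> -` (g -` A))"
      using measurable_sets[OF g A] by (intro \<kappa>E E) simp
    finally show "(\<integral>\<^sup>+\<omega>\<in>E. emeasure (distr (\<kappa> \<omega>) borel g) A \<partial>M) = emeasure M (E \<inter> (\<lambda>\<omega>. g (\<eta> \<omega>)) -` A)"
      by (simp add: vimage_def)
  qed
qed

text \<open>For fixed \<open>E\<close> both sides are finite measures in the Borel set, obtained
  from the restriction of \<open>M\<close> to \<open>E\<close> by composing with
  \<open>\<kappa>\<close> and by taking the image under \<open>X\<close>. So the half-lines, a
  generator closed under intersection, decide.\<close>

lemma real_kernel_eqI:
  fixes X :: "'a \<Rightarrow> real"
  assumes M: "prob_space M" and H: "subalgebra M H" and X[measurable]: "X \<in> borel_measurable M"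
    and \<kappa>H: "\<kappa> \<in> measurable H (prob_algebra borel)"
    and \<kappa>E: "\<And>E x. E \<in> sets H \<Longrightarrow> (\<integral>\<^sup>+\<omega>\<in>E. emeasure (\<kappa> \<omega>) {..x} \<partial>M) = emeasure M (E \<inter> X -` {..x})"
  shows "regular_cond_distr M H X \<kappa>"
  unfolding regular_cond_distr_iff[OF M H X]
proof (intro conjI ballI \<kappa>H)
  interpret M: prob_space M by (rule M)
  fix E A assume E: "E \<in> sets H" and A: "A \<in> sets (borel :: real measure)"
  then have E_M[measurable]: "E \<in> sets M"
    using H by (auto simp: subalgebra_def)
  let ?D = "density M (indicator E)"
  have \<kappa>M: "\<kappa> \<in> measurable M (subprob_algebra borel)"
    using H measurable_prob_algebraD[OF \<kappa>H] by (rule measurable_from_subalg)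
  then have \<kappa>D: "\<kappa> \<in> measurable ?D (subprob_algebra borel)"
    by (simp add: measurable_def)
  define N1 where "N1 = ?D \<bind> \<kappa>"
  define N2 where "N2 = distr ?D borel X"
  have N1: "emeasure N1 C = (\<integral>\<^sup>+\<omega>\<in>E. emeasure (\<kappa> \<omega>) C \<partial>M)" if C: "C \<in> sets borel" for C
  proof -
    have meas: "(\<lambda>\<omega>. emeasure (\<kappa> \<omega>) C) \<in> borel_measurable M"
      using \<kappa>M C by (rule measurable_compose[OF _ measurable_emeasure_subprob_algebra])
    have "emeasure N1 C = (\<integral>\<^sup>+\<omega>. emeasure (\<kappa> \<omega>) C \<partial>?D)"
      unfolding N1_def using M.not_empty by (intro emeasure_bind[OF _ \<kappa>D C]) simp
    also have "\<dots> = (\<integral>\<^sup>+\<omega>. indicator E \<omega> * emeasure (\<kappa> \<omega>) C \<partial>M)"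
      using meas by (intro nn_integral_density) auto
    finally show ?thesis
      by (simp add: mult.commute)
  qed
  have N2: "emeasure N2 C = emeasure M (E \<inter> X -` C)" if C: "C \<in> sets borel" for C
  proof -
    have XC: "X -` C \<inter> space M \<in> sets M"
      using X C by (rule measurable_sets)
    have "emeasure N2 C = emeasure ?D (X -` C \<inter> space M)"
      unfolding N2_def using C by (subst emeasure_distr) auto
    also have "\<dots> = emeasure M (E \<inter> (X -` C \<inter> space M))"
      using XC by (subst emeasure_density) (auto simp: indicator_inter_arith[symmetric] nn_integral_indicator)
    also have "E \<inter> (X -` C \<inter> space M) = E \<inter> X -` C"
      using sets.sets_into_space[OF E_M] by blast
    finally show ?thesis .
  qed
  have "N1 = N2"
  proof (rule measure_eqI_generator_eq[where \<Omega> = UNIV and E = "range atMost" and A = "\<lambda>i. {..real i}"])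
    show "sets N1 = sigma_sets UNIV (range atMost)"
    proof -
      have "sets N1 = sets (borel :: real measure)"
        unfolding N1_def using \<kappa>D M.not_empty by (intro sets_bind) (auto dest: measurable_space simp: space_subprob_algebra)
      then show ?thesis
        by (simp add: borel_eq_atMost)
    qed
    show "sets N2 = sigma_sets UNIV (range atMost)"
      unfolding N2_def by (simp add: borel_eq_atMost)
    show "emeasure N1 C = emeasure N2 C" if "C \<in> range atMost" for C
      using that \<kappa>E[OF E] by (auto simp: N1 N2)
    show "emeasure N1 {..real i} \<noteq> \<infinity>" for i
      using \<kappa>E[OF E] by (simp add: N1)
    show "(\<Union>i::nat. {..real i}) = UNIV"
      by (auto intro: real_arch_simple)
  qed (auto simp: Int_stable_def)
  then show "(\<integral>\<^sup>+\<omega>\<in>E. emeasure (\<kappa> \<omega>) A \<partial>M) = emeasure M (E \<inter> X -` A)"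
    using N1[OF A] N2[OF A] by simp
qed

text \<open>The kernel is built from a conditional distribution function. The conditional
  expectations \<open>R x\<close> have the required properties only outside null sets depending on
  \<open>x\<close>; for the rationals one null set is enough, and the values there determine a
  right-continuous function. The bounds on \<open>X\<close> make the limits at both ends trivial,
  since this function is 0 below 0 and 1 from 1 on.\<close>

lemma regular_cond_distr_exists_unit_interval:
  fixes X :: "'a \<Rightarrow> real"
  assumes M: "prob_space M" and H: "subalgebra M H" and X[measurable]: "X \<in> borel_measurable M"
    and X01: "\<And>\<omega>. 0 \<le> X \<omega>" "\<And>\<omega>. X \<omega> \<le> 1"
  shows "\<exists>\<kappa>. regular_cond_distr M H X \<kappa>"
proof -
  interpret M: prob_space M by (rule M)
  interpret finite_measure_subalgebra M H
    using H by unfold_locales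
  have space: "space H = space M" and sets: "sets H \<subseteq> sets M"
    using H by (auto simp: subalgebra_def)
  have int_i: "integrable M (indicat_real (X -` {..x}))" for x
    by (intro M.integrable_const_bound[of _ 1] AE_I2) auto
  define R where "R x = real_cond_exp M H (indicat_real (X -` {..x}))" for x
  have R_meas[measurable]: "R x \<in> borel_measurable H" for x
    unfolding R_def by simp
  have R_mono: "AE \<omega> in M. R x \<omega> \<le> R y \<omega>" if "x \<le> y" for x y
    unfolding R_def using that int_i by (intro real_cond_exp_mono) (auto simp: indicator_def)
  have R_const: "AE \<omega> in M. R x \<omega> = c" if "\<And>\<omega>. indicat_real (X -` {..x}) \<omega> = c" for x c
  proof -
    have "indicat_real (X -` {..x}) = (\<lambda>_. c)"
      using that by auto
    then show ?thesis
      unfolding R_def by (simp add: real_cond_exp_F_meas)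
  qed
  define good where "good \<omega> \<longleftrightarrow> (\<forall>p q::rat. p \<le> q \<longrightarrow> R (of_rat p) \<omega> \<le> R (of_rat q) \<omega>) \<and>
      (\<forall>q::rat. q < 0 \<longrightarrow> R (of_rat q) \<omega> = 0) \<and> (\<forall>q::rat. 1 \<le> q \<longrightarrow> R (of_rat q) \<omega> = 1)" for \<omega>
  have good_meas[measurable]: "Measurable.pred H good"
    unfolding good_def[abs_def] by measurable
  have AE_good: "AE \<omega> in M. good \<omega>"
    unfolding good_def
  proof (intro AE_conjI)
    show "AE \<omega> in M. \<forall>p q::rat. p \<le> q \<longrightarrow> R (of_rat p) \<omega> \<le> R (of_rat q) \<omega>"
      unfolding AE_all_countable using R_mono by (auto simp: of_rat_less_eq)
    show "AE \<omega> in M. \<forall>q::rat. q < 0 \<longrightarrow> R (of_rat q) \<omega> = 0"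
      unfolding AE_all_countable
    proof
      fix q :: rat
      show "AE \<omega> in M. q < 0 \<longrightarrow> R (of_rat q) \<omega> = 0"
      proof (cases "q < 0")
        case True
        then have "X \<omega> > of_rat q" for \<omega>
          using X01(1)[of \<omega>] by (metis less_le_trans of_rat_less_0_iff)
        then show ?thesis
          using R_const[of "of_rat q" 0] by (auto simp: not_le)
      qed simp
    qed
    show "AE \<omega> in M. \<forall>q::rat. 1 \<le> q \<longrightarrow> R (of_rat q) \<omega> = 1"
      unfolding AE_all_countable
    proof
      fix q :: rat
      show "AE \<omega> in M. 1 \<le> q \<longrightarrow> R (of_rat q) \<omega> = 1"
      proof (cases "1 \<le> q")
        case True
        then have "X \<omega> \<le> of_rat q" for \<omega>
          using X01(2)[of \<omega>] by (metis order_trans one_le_of_rat_iff)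
        then show ?thesis
          using R_const[of "of_rat q" 1] by auto
      qed simp
    qed
  qed
  \<comment> \<open>On the exceptional set the distribution function of the point mass at 0 is used,
    so every scenario has a probability law.\<close>
  define J where "J q \<omega> = (if good \<omega> then R (of_rat q) \<omega> else of_bool (0 \<le> q))" for q :: rat and \<omega>
  have J_mono: "J p \<omega> \<le> J q \<omega>" if "p \<le> q" for p q \<omega>
    using that by (auto simp: J_def good_def)
  have J0: "J q \<omega> = 0" if "q < 0" for q \<omega>
    using that by (auto simp: J_def good_def)
  have J1: "J q \<omega> = 1" if "1 \<le> q" for q \<omega>
    using that by (auto simp: J_def good_def)
  have J_nonneg: "0 \<le> J q \<omega>" for q \<omega>
    using J_mono[of "min q (-1)" q \<omega>] J0[of "min q (-1)" \<omega>] by simp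
  have J_meas[measurable]: "J q \<in> borel_measurable H" for q
    unfolding J_def[abs_def] by measurable
  have bdd: "bdd_below ((\<lambda>q. J q \<omega>) ` Q)" for Q \<omega>
    using J_nonneg by (auto intro!: bdd_belowI2[of _ 0])
  have ne: "{q. x < of_rat q} \<noteq> {}" for x :: real
    using of_rat_dense[of x "x + 1"] by auto
  \<comment> \<open>Taking rationals strictly above \<open>x\<close> makes \<open>G \<omega>\<close>
    right-continuous by construction.\<close>
  define G where "G \<omega> x = (INF q\<in>{q. x < of_rat q}. J q \<omega>)" for \<omega> and x :: real
  have G_le: "G \<omega> x \<le> J q \<omega>" if "x < of_rat q" for \<omega> x q
    unfolding G_def using that by (intro cINF_lower bdd) auto
  have G_ge: "c \<le> G \<omega> x" if "\<And>q. x < of_rat q \<Longrightarrow> c \<le> J q \<omega>" for \<omega> c and x :: real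
    unfolding G_def using that by (intro cINF_greatest ne) auto
  have G_mono: "G \<omega> x \<le> G \<omega> y" if "x \<le> y" for \<omega> x y
    using that by (intro G_ge G_le) simp
  have G_right: "continuous (at_right x) (G \<omega>)" for x \<omega>
  proof (subst continuous_at_right_real_increasing, rule G_mono, assumption, intro allI impI)
    fix e :: real assume "e > 0"
    have "\<exists>q. x < of_rat q \<and> J q \<omega> < G \<omega> x + e"
      using G_ge[of x "G \<omega> x + e" \<omega>] \<open>e > 0\<close> by (meson less_add_same_cancel1 not_le)
    then obtain q where q: "x < of_rat q" "J q \<omega> < G \<omega> x + e"
      by blast
    define \<delta> where "\<delta> = (of_rat q - x) / 2"
    have "x + \<delta> < of_rat q" "\<delta> > 0"
      using q(1) by (auto simp: \<delta>_def field_simps)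
    with q(2) G_le[of "x + \<delta>" q \<omega>] show "\<exists>\<delta>>0. G \<omega> (x + \<delta>) - G \<omega> x < e"
      by (intro exI[of _ \<delta>]) simp
  qed
  have G0: "G \<omega> x = 0" if "x < 0" for \<omega> x
  proof (rule antisym)
    obtain q where "x < of_rat q" "of_rat q < (0::real)"
      using of_rat_dense[OF \<open>x < 0\<close>] by blast
    then show "G \<omega> x \<le> 0"
      using G_le[of x q \<omega>] J0[of q \<omega>] by simp
    show "0 \<le> G \<omega> x"
      using J_nonneg by (rule G_ge)
  qed
  have G1: "G \<omega> x = 1" if "1 \<le> x" for \<omega> x
  proof (rule antisym)
    have J1': "J q \<omega> = 1" if "x < of_rat q" for q
      using that \<open>1 \<le> x\<close> by (intro J1) (metis less_imp_le order_trans one_le_of_rat_iff)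
    obtain q where "x < of_rat q"
      using ne by blast
    then show "G \<omega> x \<le> 1"
      using G_le[of x q \<omega>] J1' by simp
    show "1 \<le> G \<omega> x"
      using J1' by (intro G_ge) simp
  qed
  have G_bot: "(G \<omega> \<longlongrightarrow> 0) at_bot" for \<omega>
    using G0 by (intro tendsto_eventually) (auto intro: eventually_at_bot_dense[THEN iffD2])
  have G_top: "(G \<omega> \<longlongrightarrow> 1) at_top" for \<omega>
    using G1 by (intro tendsto_eventually) (auto intro: eventually_at_top_linorder[THEN iffD2])
  have G_meas[measurable]: "(\<lambda>\<omega>. G \<omega> x) \<in> borel_measurable H" for x
    unfolding G_def by measurable
  define \<kappa> where "\<kappa> \<omega> = interval_measure (G \<omega>)" for \<omega>
  have \<kappa>_Iic: "emeasure (\<kappa> \<omega>) {..x} = ennreal (G \<omega> x)" for \<omega> x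
    unfolding \<kappa>_def using G_mono G_right G_bot by (rule emeasure_interval_measure_Iic)
  have "regular_cond_distr M H X \<kappa>"
  proof (rule real_kernel_eqI[OF M H X])
    show "\<kappa> \<in> measurable H (prob_algebra borel)"
    proof (rule measurable_prob_algebra_generated[where \<Omega> = UNIV and G = "range atMost"])
      show "sets borel = sigma_sets UNIV (range (atMost :: real \<Rightarrow> _))"
        by (simp add: borel_eq_atMost)
      show "prob_space (\<kappa> \<omega>)" for \<omega>
        using real_distribution_interval_measure[OF G_mono G_right G_bot G_top]
        by (simp add: \<kappa>_def real_distribution_def)
      show "(\<lambda>\<omega>. emeasure (\<kappa> \<omega>) C) \<in> borel_measurable H" if "C \<in> range atMost" for C
        using that by (auto simp: \<kappa>_Iic)
    qed (auto simp: Int_stable_def \<kappa>_def)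
  next
    fix E x assume E: "E \<in> sets H"
    then have E_M[measurable]: "E \<in> sets M"
      using sets by blast
    have R_int: "(\<integral>\<^sup>+\<omega>\<in>E. ennreal (R y \<omega>) \<partial>M) = emeasure M (E \<inter> X -` {..y})" for y
      unfolding R_def using E by (intro set_nn_integral_real_cond_exp_indicator M H X) auto
    \<comment> \<open>Two bounds on the integral replace a pointwise identification of
      \<open>G \<omega> x\<close> with \<open>R x \<omega>\<close>. From above,
      \<open>G \<omega> x\<close> is almost surely at most \<open>R\<close> at a rational just right
      of \<open>x\<close>, and continuity from above of \<open>M\<close> removes the gap
      \<open>1 / Suc n\<close>. From below, \<open>R\<close> is almost surely monotone.\<close>
    have "(\<integral>\<^sup>+\<omega>\<in>E. ennreal (G \<omega> x) \<partial>M) \<le> emeasure M (E \<inter> X -` {..x + 1 / Suc n})" for n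
    proof -
      obtain q where q: "x < of_rat q" "of_rat q < x + 1 / Suc n"
        using of_rat_dense[of x "x + 1 / Suc n"] by auto
      have "(\<integral>\<^sup>+\<omega>\<in>E. ennreal (G \<omega> x) \<partial>M) \<le> (\<integral>\<^sup>+\<omega>\<in>E. ennreal (R (of_rat q) \<omega>) \<partial>M)"
      proof (rule nn_integral_mono_AE)
        show "AE \<omega> in M. ennreal (G \<omega> x) * indicator E \<omega> \<le> ennreal (R (of_rat q) \<omega>) * indicator E \<omega>"
          using AE_good
        proof eventually_elim
          case (elim \<omega>)
          then show ?case
            using G_le[OF q(1), of \<omega>] by (auto simp: J_def ennreal_leI split: split_indicator)
        qed
      qed
      also have "\<dots> = emeasure M (E \<inter> X -` {..of_rat q})"
        by (rule R_int)
      also have "\<dots> \<le> emeasure M (E \<inter> X -` {..x + 1 / Suc n})"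
      proof (rule emeasure_mono)
        have "E \<inter> X -` {..x + 1 / Suc n} = E \<inter> (X -` {..x + 1 / Suc n} \<inter> space M)"
          using sets.sets_into_space[OF E_M] by blast
        then show "E \<inter> X -` {..x + 1 / Suc n} \<in> sets M"
          by simp
      qed (use q(2) in auto)
      finally show ?thesis .
    qed
    moreover have "(\<lambda>n. emeasure M (E \<inter> X -` {..x + 1 / Suc n})) \<longlonglongrightarrow> emeasure M (\<Inter>n. E \<inter> X -` {..x + 1 / Suc n})"
    proof (rule Lim_emeasure_decseq)
      have "E \<inter> X -` {..x + 1 / Suc n} = E \<inter> (X -` {..x + 1 / Suc n} \<inter> space M)" for n
        using sets.sets_into_space[OF E_M] by blast
      then show "range (\<lambda>n. E \<inter> X -` {..x + 1 / Suc n}) \<subseteq> sets M"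
        by auto
      show "decseq (\<lambda>n. E \<inter> X -` {..x + 1 / Suc n})"
      proof (intro decseq_SucI Int_mono order_refl vimage_mono)
        fix n
        have "1 / real (Suc (Suc n)) \<le> 1 / real (Suc n)"
          by (intro divide_left_mono) auto
        then show "{..x + 1 / real (Suc (Suc n))} \<subseteq> {..x + 1 / real (Suc n)}"
          by simp
      qed
    qed (simp add: M.emeasure_eq_measure)
    moreover have "(\<Inter>n. E \<inter> X -` {..x + 1 / Suc n}) = E \<inter> X -` {..x}"
    proof -
      have "(\<forall>n. X \<omega> \<le> x + 1 / Suc n) \<longleftrightarrow> X \<omega> \<le> x" for \<omega>
      proof
        assume *: "\<forall>n. X \<omega> \<le> x + 1 / Suc n"
        show "X \<omega> \<le> x"
        proof (rule ccontr)
          assume "\<not> X \<omega> \<le> x"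
          then obtain n where "1 / Suc n < X \<omega> - x"
            using nat_approx_posE[of "X \<omega> - x"] by auto
          with * show False
            by (auto simp: not_le[symmetric] algebra_simps)
        qed
      next
        show "\<forall>n. X \<omega> \<le> x + 1 / Suc n" if "X \<omega> \<le> x"
          using that by (intro allI add_increasing2) auto
      qed
      then show ?thesis
        by auto
    qed
    ultimately have le: "(\<integral>\<^sup>+\<omega>\<in>E. ennreal (G \<omega> x) \<partial>M) \<le> emeasure M (E \<inter> X -` {..x})"
      by (intro LIMSEQ_le_const[where X = "\<lambda>n. emeasure M (E \<inter> X -` {..x + 1 / Suc n})"]) auto
    have "AE \<omega> in M. \<forall>q. x < of_rat q \<longrightarrow> R x \<omega> \<le> R (of_rat q) \<omega>"
      unfolding AE_all_countable using R_mono by auto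
    with AE_good have "AE \<omega> in M. R x \<omega> \<le> G \<omega> x"
      by eventually_elim (auto intro!: G_ge simp: J_def)
    then have "(\<integral>\<^sup>+\<omega>\<in>E. ennreal (R x \<omega>) \<partial>M) \<le> (\<integral>\<^sup>+\<omega>\<in>E. ennreal (G \<omega> x) \<partial>M)"
      by (intro nn_integral_mono_AE) (auto elim!: eventually_mono simp: ennreal_leI split: split_indicator)
    with le show "(\<integral>\<^sup>+\<omega>\<in>E. emeasure (\<kappa> \<omega>) {..x} \<partial>M) = emeasure M (E \<inter> X -` {..x})"
      unfolding R_int \<kappa>_Iic by (rule antisym)
  qed
  then show ?thesis
    by blast
qed

text \<open>Base three with digits 0 and 1 only: the rest of the expansion after any position,
  rescaled, is at most 1/2. So the floor recovers each digit; in base two a tail of ones would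
  already be ambiguous.\<close>

lemma ternary_digit:
  fixes d :: "nat \<Rightarrow> real"
  assumes d: "\<And>i. d i = 0 \<or> d i = 1"
  shows "summable (\<lambda>i. d i * (1/3)^Suc i)" "0 \<le> (\<Sum>i. d i * (1/3)^Suc i)" "(\<Sum>i. d i * (1/3)^Suc i) \<le> 1/2"
    and "\<lfloor>3^Suc k * (\<Sum>i. d i * (1/3)^Suc i)\<rfloor> mod 3 = 1 \<longleftrightarrow> d k = 1"
proof -
  have *: "summable (\<lambda>i. d i * (1/3)^Suc i) \<and> 0 \<le> (\<Sum>i. d i * (1/3)^Suc i) \<and> (\<Sum>i. d i * (1/3)^Suc i) \<le> 1/2"
    if d: "\<And>i. d i = 0 \<or> d i = 1" for d :: "nat \<Rightarrow> real"
  proof -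
    have g: "(\<lambda>i. (1/3) * (1/3)^i) sums ((1/3) * (1 / (1 - 1/3::real)))"
      by (intro sums_mult geometric_sums) simp
    then have g': "(\<lambda>i. (1/3)^Suc i) sums (1/2::real)"
      by simp
    have le: "d i * (1/3)^Suc i \<le> (1/3)^Suc i" and ge: "0 \<le> d i * (1/3)^Suc i" for i
      using d[of i] by auto
    have s: "summable (\<lambda>i. d i * (1/3)^Suc i)"
      using le ge by (intro summable_comparison_test[OF _ sums_summable[OF g']]) (auto intro!: exI[of _ 0] simp del: power_Suc)
    moreover have "(\<Sum>i. d i * (1/3)^Suc i) \<le> (\<Sum>i. (1/3)^Suc i)"
      using le s sums_summable[OF g'] by (rule suminf_le)
    ultimately show ?thesis
      using suminf_nonneg[OF s ge] sums_unique[OF g'] by simp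
  qed
  from *[of d] d show "summable (\<lambda>i. d i * (1/3)^Suc i)" "0 \<le> (\<Sum>i. d i * (1/3)^Suc i)" "(\<Sum>i. d i * (1/3)^Suc i) \<le> 1/2"
    by auto
  note s = \<open>summable (\<lambda>i. d i * (1/3)^Suc i)\<close>
  \<comment> \<open>\<open>n k\<close> is the integer with the first \<open>k\<close> digits and
    \<open>r\<close> the rescaled rest. Multiplying the code by \<open>3^Suc k\<close> gives
    \<open>n (Suc k) + r\<close>, and modulo 3 only the digit at position \<open>k\<close> is
    left.\<close>
  define n :: "nat \<Rightarrow> int" where "n k = (\<Sum>i<k. (if d i = 1 then 1 else 0) * 3^(k - Suc i))" for k
  define r where "r = (\<Sum>i. d (i + Suc k) * (1/3)^Suc i)"
  have r: "0 \<le> r" "r < 1"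
    using *[of "\<lambda>i. d (i + Suc k)"] d unfolding r_def by force+
  have n_Suc: "n (Suc k) = 3 * n k + (if d k = 1 then 1 else 0)"
  proof -
    have "(\<Sum>i<k. (if d i = 1 then 1 else 0) * 3^(Suc k - Suc i)) = 3 * n k"
      unfolding n_def sum_distrib_left by (intro sum.cong refl) (auto simp: Suc_diff_le power_Suc[symmetric] Suc_diff_Suc simp del: power_Suc)
    then show ?thesis
      by (simp add: n_def)
  qed
  have "3^Suc k * (\<Sum>i. d i * (1/3)^Suc i) = 3^Suc k * (\<Sum>i. d (i + Suc k) * (1/3)^Suc (i + Suc k)) + 3^Suc k * (\<Sum>i<Suc k. d i * (1/3)^Suc i)"
    unfolding suminf_split_initial_segment[OF s, of "Suc k"] by (simp only: distrib_left)
  also have "3^Suc k * (\<Sum>i<Suc k. d i * (1/3)^Suc i) = of_int (n (Suc k))"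
  proof -
    have "3^Suc k * (d i * (1/3)^Suc i) = of_int ((if d i = 1 then 1 else 0) * 3^(Suc k - Suc i))" if "i < Suc k" for i
    proof -
      have "(3::real)^Suc k = 3^(Suc k - Suc i) * 3^Suc i"
        using that by (simp only: power_add[symmetric]) simp
      then show ?thesis
        using d[of i] by (auto simp: power_one_over)
    qed
    then show ?thesis
      unfolding n_def sum_distrib_left of_int_sum by (intro sum.cong) auto
  qed
  also have "3^Suc k * (\<Sum>i. d (i + Suc k) * (1/3)^Suc (i + Suc k)) = r"
  proof -
    have "summable (\<lambda>i. d (i + Suc k) * (1/3)^Suc (i + Suc k))"
      using s by (rule summable_ignore_initial_segment)
    then have "3^Suc k * (\<Sum>i. d (i + Suc k) * (1/3)^Suc (i + Suc k)) = (\<Sum>i. 3^Suc k * (d (i + Suc k) * (1/3)^Suc (i + Suc k)))"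
      by (rule suminf_mult[symmetric])
    also have "\<dots> = r"
      unfolding r_def by (intro suminf_cong) (simp add: power_add power_one_over)
    finally show ?thesis .
  qed
  finally have "\<lfloor>3^Suc k * (\<Sum>i. d i * (1/3)^Suc i)\<rfloor> = n (Suc k)"
    using r by (simp add: floor_eq_iff)
  then show "\<lfloor>3^Suc k * (\<Sum>i. d i * (1/3)^Suc i)\<rfloor> mod 3 = 1 \<longleftrightarrow> d k = 1"
    by (simp add: n_Suc)
qed

text \<open>
  The real number \<open>\<phi> x\<close> lists, as ternary digits 0 and 1, the answers to all questions whether
  a rational number lies below a given coordinate of \<open>x\<close>.
\<close>

lemma borel_coding_unit_interval:
  "\<exists>(\<phi> :: 'c::euclidean_space \<Rightarrow> real) \<psi>. \<phi> \<in> borel_measurable borel \<and> \<psi> \<in> borel_measurable borel \<and>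
     (\<forall>x. \<psi> (\<phi> x) = x \<and> 0 \<le> \<phi> x \<and> \<phi> x \<le> 1)"
proof -
  define e :: "nat \<Rightarrow> 'c \<times> rat" where "e = from_nat_into (Basis \<times> UNIV)"
  have e: "range e = Basis \<times> UNIV"
    unfolding e_def by (intro range_from_nat_into countable_SIGMA) (auto intro: countable_finite)
  define bit where "bit i x \<longleftrightarrow> of_rat (snd (e i)) < x \<bullet> fst (e i)" for i x
  define d :: "nat \<Rightarrow> 'c \<Rightarrow> real" where "d i x = of_bool (bit i x)" for i x
  define \<phi> where "\<phi> x = (\<Sum>i. d i x * (1/3)^Suc i)" for x
  define digit where "digit i y \<longleftrightarrow> \<lfloor>3^Suc i * y\<rfloor> mod 3 = 1" for i and y :: real
  \<comment> \<open>The coordinate is recovered as the supremum of the rationals answered with yes;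
    the value \<open>- \<infinity>\<close> removes the others. Extended reals give a meaning to
    numbers \<open>y\<close> that are no codes, so \<open>\<psi>\<close> is defined and measurable
    on the whole line.\<close>
  define coord where "coord b y = (SUP i\<in>{i. fst (e i) = b}. if digit i y then ereal (of_rat (snd (e i))) else - \<infinity>)" for b y
  define \<psi> where "\<psi> y = (\<Sum>b\<in>Basis. real_of_ereal (coord b y) *\<^sub>R b)" for y
  have d01: "d i x = 0 \<or> d i x = 1" for i x
    by (auto simp: d_def)
  have digit: "digit i (\<phi> x) \<longleftrightarrow> bit i x" for i x
    using ternary_digit(4)[of "\<lambda>i. d i x" i] d01 by (simp add: digit_def \<phi>_def d_def)
  have "d i \<in> borel_measurable borel" for i
    unfolding d_def[abs_def] bit_def by measurable
  then have "\<phi> \<in> borel_measurable borel"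
    unfolding \<phi>_def[abs_def] by measurable
  moreover have "Measurable.pred borel (digit i)" for i
    unfolding digit_def[abs_def] by measurable
  then have "\<psi> \<in> borel_measurable borel"
    unfolding \<psi>_def[abs_def] coord_def by measurable
  moreover have "coord b (\<phi> x) = ereal (x \<bullet> b)" if b: "b \<in> Basis" for b x
  proof (rule antisym)
    show "coord b (\<phi> x) \<le> ereal (x \<bullet> b)"
      unfolding coord_def by (intro SUP_least) (auto simp: digit bit_def less_imp_le)
    show "ereal (x \<bullet> b) \<le> coord b (\<phi> x)"
    proof (rule dense_le)
      fix z assume "z < ereal (x \<bullet> b)"
      then obtain r where r: "z < ereal r" "r < x \<bullet> b"
        using ereal_dense2[of z "ereal (x \<bullet> b)"] by auto
      then obtain q where q: "r < of_rat q" "of_rat q < x \<bullet> b"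
        using of_rat_dense by blast
      have "(b, q) \<in> range e"
        using e b by simp
      then obtain i where i: "e i = (b, q)"
        by (metis rangeE)
      have "z \<le> (if digit i (\<phi> x) then ereal (of_rat (snd (e i))) else - \<infinity>)"
        using r q i by (auto simp: digit bit_def intro: order_trans[of z "ereal r"])
      also have "\<dots> \<le> coord b (\<phi> x)"
        unfolding coord_def by (intro SUP_upper) (simp add: i)
      finally show "z \<le> coord b (\<phi> x)" .
    qed
  qed
  then have "\<psi> (\<phi> x) = x" for x
    unfolding \<psi>_def by (simp add: euclidean_representation)
  moreover have "0 \<le> \<phi> x \<and> \<phi> x \<le> 1" for x
    using ternary_digit(2,3)[of "\<lambda>i. d i x"] d01 by (simp add: \<phi>_def)
  ultimately show ?thesis
    by blast
qed

text \<open>The conditional law of the real code \<open>\<phi> (\<eta> \<omega>)\<close> is pushed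
  forward along the decoder \<open>\<psi>\<close>; since \<open>\<psi> (\<phi> x) = x\<close>, the
  image belongs to \<open>\<eta>\<close> itself.\<close>

theorem regular_cond_distr_exists:
  fixes \<eta> :: "'a \<Rightarrow> 'c::euclidean_space"
  assumes M: "prob_space M" and H: "subalgebra M H" and \<eta>[measurable]: "\<eta> \<in> borel_measurable M"
  shows "\<exists>\<kappa>. regular_cond_distr M H \<eta> \<kappa>"
proof -
  obtain \<phi> :: "'c \<Rightarrow> real" and \<psi> where
    \<phi>[measurable]: "\<phi> \<in> borel_measurable borel" and \<psi>: "\<psi> \<in> borel_measurable borel"
    and \<phi>\<psi>: "\<And>x. \<psi> (\<phi> x) = x" "\<And>x. 0 \<le> \<phi> x" "\<And>x. \<phi> x \<le> 1"
    using borel_coding_unit_interval[where 'c = 'c] by blast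
  have X: "(\<lambda>\<omega>. \<phi> (\<eta> \<omega>)) \<in> borel_measurable M"
    by measurable
  obtain \<kappa> where "regular_cond_distr M H (\<lambda>\<omega>. \<phi> (\<eta> \<omega>)) \<kappa>"
    using regular_cond_distr_exists_unit_interval[OF M H X] \<phi>\<psi>(2,3) by blast
  from regular_cond_distr_distr[OF M H X this \<psi>] show ?thesis
    by (auto simp: \<phi>\<psi>(1))
qed

section \<open>Transfer between a random vector and its conditional support\<close>

lemma AE_regular_cond_distrI:
  fixes \<eta> :: "'a \<Rightarrow> 'c::euclidean_space"
  assumes M: "prob_space M" and H: "subalgebra M H" and \<eta>: "\<eta> \<in> borel_measurable M"
    and \<kappa>: "regular_cond_distr M H \<eta> \<kappa>"
    and P: "Measurable.pred (H \<Otimes>\<^sub>M borel) (\<lambda>(\<omega>, z). P \<omega> z)"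
    and supp: "AE \<omega> in M. \<forall>z\<in>closed_support (\<kappa> \<omega>). P \<omega> z"
  shows "AE \<omega> in M. P \<omega> (\<eta> \<omega>)"
  unfolding AE_regular_cond_distr_iff[OF M H \<eta> \<kappa> P]
proof -
  have \<kappa>H: "\<kappa> \<in> measurable H (prob_algebra borel)" and space: "space H = space M"
    using \<kappa> H by (auto simp: regular_cond_distr_def subalgebra_def)
  show "AE \<omega> in M. AE z in \<kappa> \<omega>. P \<omega> z"
    using supp AE_space
  proof eventually_elim
    case (elim \<omega>)
    from elim(2) have "AE z in \<kappa> \<omega>. z \<in> closed_support (\<kappa> \<omega>)"
      using prob_algebra_kernelD(2)[OF \<kappa>H] space by (intro AE_closed_support) simp
    then show ?case
      by eventually_elim (use elim(1) in blast)
  qed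
qed

text \<open>An almost sure property holds a priori only on a set of full conditional mass. It
  reaches every point of the support because the points satisfying it form a closed set, which then
  contains the support.\<close>

lemma AE_closed_support_regular_cond_distr:
  fixes \<eta> :: "'a \<Rightarrow> 'c::euclidean_space"
  assumes M: "prob_space M" and H: "subalgebra M H" and \<eta>: "\<eta> \<in> borel_measurable M"
    and \<kappa>: "regular_cond_distr M H \<eta> \<kappa>"
    and P: "Measurable.pred (H \<Otimes>\<^sub>M borel) (\<lambda>(\<omega>, z). P \<omega> z)"
    and closed: "\<And>\<omega>. \<omega> \<in> space M \<Longrightarrow> closed {z. P \<omega> z}"
    and AE: "AE \<omega> in M. P \<omega> (\<eta> \<omega>)"
  shows "AE \<omega> in M. \<forall>z\<in>closed_support (\<kappa> \<omega>). P \<omega> z"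
proof -
  have \<kappa>H: "\<kappa> \<in> measurable H (prob_algebra borel)" and space: "space H = space M"
    using \<kappa> H by (auto simp: regular_cond_distr_def subalgebra_def)
  have "AE \<omega> in M. AE z in \<kappa> \<omega>. P \<omega> z"
    using AE unfolding AE_regular_cond_distr_iff[OF M H \<eta> \<kappa> P] .
  then show ?thesis
    using AE_space
  proof eventually_elim
    case (elim \<omega>)
    have s: "sets (\<kappa> \<omega>) = sets borel"
      using prob_algebra_kernelD(2)[OF \<kappa>H] elim(2) space by simp
    have "{z\<in>space (\<kappa> \<omega>). \<not> P \<omega> z} = - {z. P \<omega> z}"
      using sets_eq_imp_space_eq[OF s] by auto
    moreover have "- {z. P \<omega> z} \<in> sets (\<kappa> \<omega>)"
      using closed[OF elim(2)] s by (auto intro: borel_open open_Compl)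
    ultimately have "emeasure (\<kappa> \<omega>) (- {z. P \<omega> z}) = 0"
      using AE_iff_measurable[of "- {z. P \<omega> z}" "\<kappa> \<omega>" "P \<omega>"] elim(1) by blast
    then show ?case
      using closed_support_subset[OF closed[OF elim(2)]] by blast
  qed
qed

text \<open>The events that \<open>X\<close> is below a rational level have probability 0 or 1, so
  almost all scenarios agree on every such comparison. Any one of these scenarios supplies the
  constant.\<close>

lemma AE_const_if_trivial:
  fixes X :: "'a \<Rightarrow> real"
  assumes M: "prob_space M" and H: "subalgebra M H" and X[measurable]: "X \<in> borel_measurable H"
    and triv: "\<And>A. A \<in> sets H \<Longrightarrow> measure M A = 0 \<or> measure M A = 1"
  shows "\<exists>c. AE \<omega> in M. X \<omega> = c"
proof -
  interpret M: prob_space M by (rule M)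
  have space: "space H = space M" and sets: "sets H \<subseteq> sets M"
    using H by (auto simp: subalgebra_def)
  define A where "A q = {\<omega>\<in>space M. X \<omega> \<le> of_rat q}" for q :: rat
  have A: "A q \<in> sets H" for q
    unfolding A_def space[symmetric] by measurable
  have "AE \<omega> in M. X \<omega> \<le> of_rat q \<longleftrightarrow> M.prob (A q) = 1" for q
  proof (cases "M.prob (A q) = 1")
    case True
    then have "AE \<omega> in M. \<omega> \<in> A q"
      using A[of q] sets by (subst M.AE_in_set_eq_1) auto
    with True show ?thesis
      by (auto simp: A_def)
  next
    case False
    then have "M.prob (A q) = 0"
      using triv[OF A] by blast
    then have "A q \<in> null_sets M"
      using A[of q] sets by (auto simp: null_sets_def M.emeasure_eq_measure)
    then have "AE \<omega> in M. \<omega> \<notin> A q"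
      by (rule AE_not_in)
    then show ?thesis
      using AE_space by eventually_elim (use False in \<open>auto simp: A_def\<close>)
  qed
  then have AE: "AE \<omega> in M. \<forall>q. X \<omega> \<le> of_rat q \<longleftrightarrow> M.prob (A q) = 1"
    unfolding AE_all_countable by blast
  then obtain \<omega>0 where \<omega>0: "\<forall>q. X \<omega>0 \<le> of_rat q \<longleftrightarrow> M.prob (A q) = 1"
    using eventually_happens'[OF M.ae_filter_bot] by blast
  from AE have "AE \<omega> in M. X \<omega> = X \<omega>0"
  proof eventually_elim
    case (elim \<omega>)
    have iff: "X \<omega> \<le> of_rat q \<longleftrightarrow> X \<omega>0 \<le> of_rat q" for q
      using elim \<omega>0 by simp
    show ?case
    proof (rule antisym; rule ccontr)
      assume "\<not> X \<omega> \<le> X \<omega>0"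
      then obtain q where "X \<omega>0 < of_rat q" "of_rat q < X \<omega>"
        using of_rat_dense[of "X \<omega>0" "X \<omega>"] by auto
      with iff[of q] show False
        by simp
    next
      assume "\<not> X \<omega>0 \<le> X \<omega>"
      then obtain q where "X \<omega> < of_rat q" "of_rat q < X \<omega>0"
        using of_rat_dense[of "X \<omega>" "X \<omega>0"] by auto
      with iff[of q] show False
        by simp
    qed
  qed
  then show ?thesis
    by blast
qed

section \<open>Measurability of the set of one-step hedges\<close>

text \<open>\<open>h\<close> stays general because the set has two uses: with \<open>h\<close> the
  value still to be covered after spending the capital, its elements are superhedges; with
  \<open>h\<close> the indicator of a ball, they are portfolios with nonnegative gain on the support
  that gain at least 1 in the ball.\<close>

definition hedges :: "'c set \<Rightarrow> ('c \<Rightarrow> real) \<Rightarrow> 'b::real_inner set \<Rightarrow> ('c \<Rightarrow> 'b) \<Rightarrow> 'b set" where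
  "hedges K h B p = {\<gamma>\<in>B. \<forall>z\<in>K. h z \<le> \<gamma> \<bullet> p z}"

lemma closed_hedges:
  assumes "closed B"
  shows "closed (hedges K h B p)"
proof -
  have "hedges K h B p = B \<inter> (\<Inter>z\<in>K. {\<gamma>. h z \<le> \<gamma> \<bullet> p z})"
    by (auto simp: hedges_def)
  also have "closed \<dots>"
    using assms by (intro closed_Int closed_INT ballI closed_Collect_le continuous_intros)
  finally show ?thesis .
qed

text \<open>
  By compactness of the ball, a hedge exists as soon as approximate hedges \<open>q\<close> with arbitrarily small
  error exist in a countable dense set; the error \<open>norm (p z) / Suc m\<close> is what Cauchy-Schwarz allows
  for replacing a hedge by a point within \<open>1 / Suc m\<close> of it.
\<close>

lemma hedges_Int_cball_iff:
  fixes B :: "'b::euclidean_space set"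
  assumes "closed B" and Q: "\<And>U::'b set. open U \<Longrightarrow> U \<noteq> {} \<Longrightarrow> \<exists>q\<in>Q. q \<in> U"
  shows "hedges K h B p \<inter> cball c r \<noteq> {} \<longleftrightarrow>
    (\<forall>m. \<exists>q\<in>Q. q \<in> ball c (r + 1 / Suc m) \<and> B \<inter> ball q (1 / Suc m) \<noteq> {} \<and>
       K \<inter> {z. q \<bullet> p z + 1 / Suc m * norm (p z) < h z} = {})" (is "?L \<longleftrightarrow> ?R")
proof
  assume ?L
  then obtain \<gamma> where \<gamma>: "\<gamma> \<in> B" "\<And>z. z \<in> K \<Longrightarrow> h z \<le> \<gamma> \<bullet> p z" "dist c \<gamma> \<le> r"
  proof -
    from \<open>?L\<close> obtain \<gamma> where "\<gamma> \<in> hedges K h B p" "\<gamma> \<in> cball c r"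
      by blast
    then show ?thesis
      by (intro that[of \<gamma>]) (auto simp: hedges_def)
  qed
  show ?R
  proof
    fix m
    obtain q where q: "q \<in> Q" "q \<in> ball \<gamma> (1 / Suc m)"
      using Q[OF open_ball, of \<gamma> "1 / Suc m"] by auto
    have "dist c q \<le> dist c \<gamma> + dist \<gamma> q"
      by (rule dist_triangle)
    then have "q \<in> ball c (r + 1 / Suc m)"
      using \<gamma>(3) q(2) by simp
    moreover have "\<gamma> \<in> B \<inter> ball q (1 / Suc m)"
      using \<gamma>(1) q(2) by (simp add: dist_commute)
    moreover have "\<not> q \<bullet> p z + 1 / Suc m * norm (p z) < h z" if "z \<in> K" for z
    proof -
      have "(\<gamma> - q) \<bullet> p z \<le> norm (\<gamma> - q) * norm (p z)"
        by (rule norm_cauchy_schwarz)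
      also have "\<dots> \<le> 1 / Suc m * norm (p z)"
        using q(2) by (intro mult_right_mono) (auto simp: dist_norm)
      finally show ?thesis
        using \<gamma>(2)[OF that] by (simp add: inner_diff_left not_less)
    qed
    ultimately show "\<exists>q\<in>Q. q \<in> ball c (r + 1 / Suc m) \<and> B \<inter> ball q (1 / Suc m) \<noteq> {} \<and>
       K \<inter> {z. q \<bullet> p z + 1 / Suc m * norm (p z) < h z} = {}"
      using q(1) by blast
  qed
next
  assume ?R
  then have "\<forall>m. \<exists>q. q \<in> ball c (r + 1 / Suc m) \<and> B \<inter> ball q (1 / Suc m) \<noteq> {} \<and>
       K \<inter> {z. q \<bullet> p z + 1 / Suc m * norm (p z) < h z} = {}"
    by blast
  then have "\<exists>q. \<forall>m. q m \<in> ball c (r + 1 / Suc m) \<and> B \<inter> ball (q m) (1 / Suc m) \<noteq> {} \<and>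
       K \<inter> {z. q m \<bullet> p z + 1 / Suc m * norm (p z) < h z} = {}"
    by (rule choice)
  then obtain q where q: "\<And>m. q m \<in> ball c (r + 1 / Suc m)" "\<And>m. B \<inter> ball (q m) (1 / Suc m) \<noteq> {}"
    "\<And>m. K \<inter> {z. q m \<bullet> p z + 1 / Suc m * norm (p z) < h z} = {}"
    by blast
  have "\<exists>b. b \<in> B \<and> dist (q m) b < 1 / Suc m" for m
    using q(2)[of m] by auto
  then obtain b where b: "\<And>m. b m \<in> B" "\<And>m. dist (q m) (b m) < 1 / Suc m"
    by metis
  have "q m \<in> cball c (r + 1)" for m
  proof -
    have "dist c (q m) < r + 1 / Suc m"
      using q(1)[of m] by simp
    also have "\<dots> \<le> r + 1"
      by simp
    finally show ?thesis
      by simp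
  qed
  then obtain \<gamma> \<sigma> where \<sigma>: "strict_mono \<sigma>" "(q \<circ> \<sigma>) \<longlonglongrightarrow> \<gamma>"
    using compact_cball[of c "r + 1"] unfolding compact_def by blast
  have inv0: "(\<lambda>m. 1 / real (Suc m)) \<longlonglongrightarrow> 0"
    by (rule LIMSEQ_Suc[OF lim_1_over_n])
  have inv: "(\<lambda>m. 1 / real (Suc (\<sigma> m))) \<longlonglongrightarrow> 0"
    using LIMSEQ_subseq_LIMSEQ[OF inv0 \<sigma>(1)] by (simp add: o_def)
  have qs: "(\<lambda>m. q (\<sigma> m)) \<longlonglongrightarrow> \<gamma>"
    using \<sigma>(2) by (simp add: o_def)
  have "(\<lambda>m. dist (b (\<sigma> m)) \<gamma>) \<longlonglongrightarrow> 0"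
  proof (rule Lim_null_comparison[where g = "\<lambda>m. 1 / Suc (\<sigma> m) + dist (q (\<sigma> m)) \<gamma>"])
    show "(\<lambda>m. 1 / Suc (\<sigma> m) + dist (q (\<sigma> m)) \<gamma>) \<longlonglongrightarrow> 0"
      using tendsto_add[OF inv tendsto_dist_iff[THEN iffD1, OF qs]] by simp
    have "dist (b (\<sigma> m)) \<gamma> \<le> 1 / Suc (\<sigma> m) + dist (q (\<sigma> m)) \<gamma>" for m
      using b(2)[of "\<sigma> m"] dist_triangle3[of "b (\<sigma> m)" \<gamma> "q (\<sigma> m)"] by linarith
    then show "\<forall>\<^sub>F m in sequentially. norm (dist (b (\<sigma> m)) \<gamma>) \<le> 1 / Suc (\<sigma> m) + dist (q (\<sigma> m)) \<gamma>"
      by simp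
  qed
  then have "(\<lambda>m. b (\<sigma> m)) \<longlonglongrightarrow> \<gamma>"
    by (rule tendsto_dist_iff[THEN iffD2])
  then have "\<gamma> \<in> B"
    using closed_sequentially[OF assms(1), of "\<lambda>m. b (\<sigma> m)"] b(1) by blast
  moreover have "h z \<le> \<gamma> \<bullet> p z" if "z \<in> K" for z
  proof -
    have "h z \<le> q (\<sigma> m) \<bullet> p z + 1 / Suc (\<sigma> m) * norm (p z)" for m
      using q(3)[of "\<sigma> m"] that unfolding disjoint_iff mem_Collect_eq not_less by blast
    moreover have "(\<lambda>m. q (\<sigma> m) \<bullet> p z + 1 / Suc (\<sigma> m) * norm (p z)) \<longlonglongrightarrow> \<gamma> \<bullet> p z + 0 * norm (p z)"
      by (intro tendsto_add tendsto_mult tendsto_inner tendsto_const qs inv)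
    ultimately show ?thesis
      using LIMSEQ_le_const[of _ "\<gamma> \<bullet> p z" "h z"] by simp
  qed
  moreover have "dist c \<gamma> \<le> r"
  proof -
    have "(\<lambda>m. r + 1 / Suc (\<sigma> m)) \<longlonglongrightarrow> r + 0"
      by (intro tendsto_intros inv)
    moreover have "(\<lambda>m. dist c (q (\<sigma> m))) \<longlonglongrightarrow> dist c \<gamma>"
      by (intro tendsto_intros qs)
    moreover have "dist c (q (\<sigma> m)) \<le> r + 1 / Suc (\<sigma> m)" for m
      using q(1)[of "\<sigma> m"] by simp
    ultimately show ?thesis
      using LIMSEQ_le[of "\<lambda>m. dist c (q (\<sigma> m))" "dist c \<gamma>" "\<lambda>m. r + 1 / Suc (\<sigma> m)"] by auto
  qed
  ultimately show ?L
    by (auto simp: hedges_def)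
qed

text \<open>Meeting a closed ball splits, over a countable dense set of approximate hedges, into the
  conditions that \<open>B \<omega>\<close> meets a ball and that \<open>\<kappa> \<omega>\<close>
  gives no mass to the set \<open>V\<close> where the approximate hedge fails. \<open>V\<close> is
  open because \<open>h\<close> is lower semicontinuous, an assumption that also admits indicators
  of open balls. An open \<open>U\<close> is a countable union of closed balls.\<close>

lemma hedges_measurable:
  fixes B :: "'a \<Rightarrow> 'b::euclidean_space set" and p :: "'a \<Rightarrow> 'c::euclidean_space \<Rightarrow> 'b"
  assumes \<kappa>: "\<kappa> \<in> measurable H (prob_algebra borel)"
    and B: "\<And>U. open U \<Longrightarrow> {\<omega>\<in>space H. B \<omega> \<inter> U \<noteq> {}} \<in> sets H" "\<And>\<omega>. \<omega> \<in> space H \<Longrightarrow> closed (B \<omega>)"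
    and h[measurable]: "(\<lambda>(\<omega>, z). h \<omega> z) \<in> borel_measurable (H \<Otimes>\<^sub>M borel)"
    and h_lsc: "\<And>\<omega> a. \<omega> \<in> space H \<Longrightarrow> open {z. a < h \<omega> z}"
    and p[measurable]: "(\<lambda>(\<omega>, z). p \<omega> z) \<in> borel_measurable (H \<Otimes>\<^sub>M borel)"
    and p_cont: "\<And>\<omega>. \<omega> \<in> space H \<Longrightarrow> continuous_on UNIV (p \<omega>)"
    and U: "open U"
  shows "{\<omega>\<in>space H. hedges (closed_support (\<kappa> \<omega>)) (h \<omega>) (B \<omega>) (p \<omega>) \<inter> U \<noteq> {}} \<in> sets H"
proof -
  obtain Q :: "'b set" where Q: "countable Q" "\<And>U. open U \<Longrightarrow> U \<noteq> {} \<Longrightarrow> \<exists>q\<in>Q. q \<in> U"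
    using countable_dense_setE by blast
  define V where "V q m \<omega> = {z. q \<bullet> p \<omega> z + 1 / Suc m * norm (p \<omega> z) < h \<omega> z}" for q :: 'b and m :: nat and \<omega>
  let ?G = "\<lambda>\<omega>. hedges (closed_support (\<kappa> \<omega>)) (h \<omega>) (B \<omega>) (p \<omega>)"
  have V_open: "open (V q m \<omega>)" if \<omega>: "\<omega> \<in> space H" for q m \<omega>
  proof -
    let ?f = "\<lambda>z. q \<bullet> p \<omega> z + 1 / Suc m * norm (p \<omega> z)"
    \<comment> \<open>The inequality is split at an intermediate number \<open>a\<close>, as for
      \<open>h\<close> only the sets \<open>a < h \<omega> z\<close> are known to be open.\<close>
    have "?f z < h \<omega> z \<longleftrightarrow> (\<exists>a. ?f z < a \<and> a < h \<omega> z)" for z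
      using dense less_trans by blast
    then have "V q m \<omega> = (\<Union>a. {z. ?f z < a} \<inter> {z. a < h \<omega> z})"
      unfolding V_def by blast
    moreover have "open {z. ?f z < a}" for a
      using p_cont[OF \<omega>] by (intro open_Collect_less continuous_intros)
    ultimately show ?thesis
      using h_lsc[OF \<omega>] by (simp add: open_UN open_Int)
  qed
  have V_meas: "{\<omega>\<in>space H. closed_support (\<kappa> \<omega>) \<inter> V q m \<omega> = {}} \<in> sets H" for q m
  proof -
    have "(SIGMA \<omega>:space H. V q m \<omega>) = {x\<in>space (H \<Otimes>\<^sub>M borel). (case x of (\<omega>, z) \<Rightarrow> q \<bullet> p \<omega> z + 1 / Suc m * norm (p \<omega> z) < h \<omega> z)}"
      by (auto simp: V_def space_pair_measure)
    also have "\<dots> \<in> sets (H \<Otimes>\<^sub>M borel)"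
      by measurable
    finally have [measurable]: "(\<lambda>\<omega>. emeasure (\<kappa> \<omega>) (V q m \<omega>)) \<in> borel_measurable H"
      using measurable_prob_algebraD[OF \<kappa>] by (rule emeasure_measurable_subprob_algebra2)
    have "{\<omega>\<in>space H. closed_support (\<kappa> \<omega>) \<inter> V q m \<omega> = {}} = {\<omega>\<in>space H. emeasure (\<kappa> \<omega>) (V q m \<omega>) = 0}"
      by (intro Collect_cong conj_cong refl closed_support_Int_open_eq_empty_iff V_open prob_algebra_kernelD(2)[OF \<kappa>])
    also have "\<dots> \<in> sets H"
      by measurable
    finally show ?thesis .
  qed
  have cball: "{\<omega>\<in>space H. ?G \<omega> \<inter> cball c r \<noteq> {}} \<in> sets H" for c r
  proof -
    have "{\<omega>\<in>space H. ?G \<omega> \<inter> cball c r \<noteq> {}} =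
      {\<omega>\<in>space H. \<forall>m. \<exists>q\<in>Q. q \<in> ball c (r + 1 / Suc m) \<and> B \<omega> \<inter> ball q (1 / Suc m) \<noteq> {} \<and> closed_support (\<kappa> \<omega>) \<inter> V q m \<omega> = {}}"
      unfolding V_def using hedges_Int_cball_iff[OF B(2) Q(2)] by blast
    also have "\<dots> \<in> sets H"
    proof (rule sets.sets_Collect_countable_All)
      fix m
      have "{\<omega>\<in>space H. \<exists>q\<in>Q. q \<in> ball c (r + 1 / Suc m) \<and> B \<omega> \<inter> ball q (1 / Suc m) \<noteq> {} \<and> closed_support (\<kappa> \<omega>) \<inter> V q m \<omega> = {}} =
        (\<Union>q\<in>{q\<in>Q. q \<in> ball c (r + 1 / Suc m)}.
          {\<omega>\<in>space H. B \<omega> \<inter> ball q (1 / Suc m) \<noteq> {}} \<inter> {\<omega>\<in>space H. closed_support (\<kappa> \<omega>) \<inter> V q m \<omega> = {}})"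
        by blast
      also have "\<dots> \<in> sets H"
        using Q(1) B(1) V_meas by (intro sets.countable_UN' sets.Int countable_Collect) auto
      finally show "{\<omega>\<in>space H. \<exists>q\<in>Q. q \<in> ball c (r + 1 / Suc m) \<and> B \<omega> \<inter> ball q (1 / Suc m) \<noteq> {} \<and>
          closed_support (\<kappa> \<omega>) \<inter> V q m \<omega> = {}} \<in> sets H" .
    qed
    finally show ?thesis .
  qed
  define I where "I = {i\<in>Q \<times> (UNIV :: nat set). cball (fst i) (1 / Suc (snd i)) \<subseteq> U}"
  have "countable I"
    unfolding I_def using Q(1) by (intro countable_Collect countable_SIGMA) auto
  have U_eq: "U = (\<Union>i\<in>I. cball (fst i) (1 / Suc (snd i)))"
  proof (intro subset_antisym subsetI)
    fix x assume "x \<in> U"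
    then obtain \<epsilon> where \<epsilon>: "\<epsilon> > 0" "ball x \<epsilon> \<subseteq> U"
      using U open_contains_ball by blast
    then obtain m where m: "1 / Suc m < \<epsilon> / 2"
      using nat_approx_posE[of "\<epsilon> / 2"] by auto
    obtain q where q: "q \<in> Q" "q \<in> ball x (1 / Suc m)"
      using Q(2)[OF open_ball, of x "1 / Suc m"] by auto
    have "y \<in> ball x \<epsilon>" if "y \<in> cball q (1 / Suc m)" for y
    proof -
      have "dist x y \<le> dist x q + dist q y"
        by (rule dist_triangle)
      also have "\<dots> < 1 / Suc m + 1 / Suc m"
        using q(2) that by (intro add_less_le_mono) auto
      finally show ?thesis
        using m by simp
    qed
    with \<epsilon>(2) q(1) have "(q, m) \<in> I"
      by (auto simp: I_def)
    moreover have "x \<in> cball q (1 / Suc m)"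
      using q(2) by (simp add: dist_commute less_imp_le)
    ultimately show "x \<in> (\<Union>i\<in>I. cball (fst i) (1 / Suc (snd i)))"
      by force
  qed (auto simp: I_def)
  have "{\<omega>\<in>space H. ?G \<omega> \<inter> U \<noteq> {}} = (\<Union>i\<in>I. {\<omega>\<in>space H. ?G \<omega> \<inter> cball (fst i) (1 / Suc (snd i)) \<noteq> {}})"
    by (subst (1) U_eq) blast
  also have "\<dots> \<in> sets H"
    using \<open>countable I\<close> cball by (intro sets.countable_UN') auto
  finally show ?thesis .
qed

text \<open>Scenarios without a hedge receive the portfolio 0. So the set selected from is never
  empty, and since 0 lies in \<open>B \<omega>\<close> the constraint holds in all scenarios, not
  only almost surely.\<close>

lemma hedges_selection:
  fixes B :: "'a \<Rightarrow> 'b::euclidean_space set" and p :: "'a \<Rightarrow> 'c::euclidean_space \<Rightarrow> 'b"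
  assumes \<kappa>: "\<kappa> \<in> measurable H (prob_algebra borel)"
    and B: "\<And>U. open U \<Longrightarrow> {\<omega>\<in>space H. B \<omega> \<inter> U \<noteq> {}} \<in> sets H" "\<And>\<omega>. \<omega> \<in> space H \<Longrightarrow> closed (B \<omega>)"
      "\<And>\<omega>. \<omega> \<in> space H \<Longrightarrow> 0 \<in> B \<omega>"
    and h: "(\<lambda>(\<omega>, z). h \<omega> z) \<in> borel_measurable (H \<Otimes>\<^sub>M borel)"
    and h_lsc: "\<And>\<omega> a. \<omega> \<in> space H \<Longrightarrow> open {z. a < h \<omega> z}"
    and p: "(\<lambda>(\<omega>, z). p \<omega> z) \<in> borel_measurable (H \<Otimes>\<^sub>M borel)"
    and p_cont: "\<And>\<omega>. \<omega> \<in> space H \<Longrightarrow> continuous_on UNIV (p \<omega>)"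
  shows "\<exists>g\<in>borel_measurable H. \<forall>\<omega>\<in>space H. g \<omega> \<in> B \<omega> \<and>
    g \<omega> \<in> (if hedges (closed_support (\<kappa> \<omega>)) (h \<omega>) (B \<omega>) (p \<omega>) = {} then {0}
      else hedges (closed_support (\<kappa> \<omega>)) (h \<omega>) (B \<omega>) (p \<omega>))"
proof -
  define G where "G \<omega> = hedges (closed_support (\<kappa> \<omega>)) (h \<omega>) (B \<omega>) (p \<omega>)" for \<omega>
  define G' where "G' \<omega> = (if G \<omega> = {} then {0} else G \<omega>)" for \<omega>
  have meas: "{\<omega>\<in>space H. G \<omega> \<inter> U \<noteq> {}} \<in> sets H" if "open U" for U
    unfolding G_def using \<kappa> B(1,2) h h_lsc p p_cont that by (rule hedges_measurable)
  have "\<exists>g\<in>borel_measurable H. \<forall>\<omega>\<in>space H. g \<omega> \<in> G' \<omega>"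
  proof (rule measurable_selection)
    show "closed (G' \<omega>)" if "\<omega> \<in> space H" for \<omega>
      by (simp add: G'_def G_def closed_hedges[OF B(2)[OF that]])
    show "G' \<omega> \<noteq> {}" for \<omega>
      by (simp add: G'_def)
    fix U :: "'b set" assume U: "open U"
    have "{\<omega>\<in>space H. G' \<omega> \<inter> U \<noteq> {}} = {\<omega>\<in>space H. G \<omega> \<inter> U \<noteq> {}} \<union>
        (if 0 \<in> U then space H - {\<omega>\<in>space H. G \<omega> \<inter> UNIV \<noteq> {}} else {})"
      by (auto simp: G'_def split: if_splits)
    also have "\<dots> \<in> sets H"
      using meas[OF U] meas[OF open_UNIV] by auto
    finally show "{\<omega>\<in>space H. G' \<omega> \<inter> U \<noteq> {}} \<in> sets H" .
  qed
  then obtain g where g: "g \<in> borel_measurable H" "\<And>\<omega>. \<omega> \<in> space H \<Longrightarrow> g \<omega> \<in> G' \<omega>"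
    by blast
  have "g \<omega> \<in> B \<omega>" if "\<omega> \<in> space H" for \<omega>
    using g(2)[OF that] B(3)[OF that] by (auto simp: G'_def G_def hedges_def split: if_splits)
  with g show ?thesis
    unfolding G'_def G_def by blast
qed

section \<open>One trading period\<close>

lemma gain_Suc: "gain S \<gamma> (Suc t) \<omega> = gain S \<gamma> t \<omega> + \<gamma> t \<omega> \<bullet> (S (Suc t) \<omega> - S t \<omega>)"
  by (simp add: gain_def)

lemma gain_0: "gain S \<gamma> 0 \<omega> = 0"
  by (simp add: gain_def)

locale constrained_market =
  fixes M :: "'a measure" and F :: "nat \<Rightarrow> 'a measure" and T :: nat
    and S :: "nat \<Rightarrow> 'a \<Rightarrow> 'b::euclidean_space" and B :: "nat \<Rightarrow> 'a \<Rightarrow> 'b set"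
  assumes filtered: "filtered_prob_space M F T"
    and adapted: "\<And>t. t \<le> T \<Longrightarrow> S t \<in> borel_measurable (F t)"
    and cones: "\<And>t. t < T \<Longrightarrow> random_convex_cone (F t) (B t)"
    and polyhedral: "\<And>t \<omega>. t < T \<Longrightarrow> \<omega> \<in> space M \<Longrightarrow> polyhedron (B t \<omega>)"
    and NA: "no_arbitrage M F S B T"
begin

sublocale prob_space M
  using filtered by (simp add: filtered_prob_space_def)

lemma subalg: "t \<le> T \<Longrightarrow> subalgebra M (F t)"
  using filtered by (simp add: filtered_prob_space_def)

lemma space_F: "t \<le> T \<Longrightarrow> space (F t) = space M"
  using subalg by (simp add: subalgebra_def)

lemma measurable_F_mono: "s \<le> t \<Longrightarrow> t \<le> T \<Longrightarrow> X \<in> measurable (F s) N \<Longrightarrow> X \<in> measurable (F t) N"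
  using filtered space_F[of s] space_F[of t] measurable_mono[OF order_refl refl, of "F s" "F t" N]
  unfolding filtered_prob_space_def by auto

lemma measurable_F_M: "t \<le> T \<Longrightarrow> X \<in> measurable (F t) N \<Longrightarrow> X \<in> measurable M N"
  using subalg by (rule measurable_from_subalg)

lemma cone: "t < T \<Longrightarrow> \<omega> \<in> space M \<Longrightarrow> convex_cone (B t \<omega>)"
  using cones space_F[of t] by (auto simp: random_convex_cone_def)

lemma cone_measurable: "t < T \<Longrightarrow> open U \<Longrightarrow> {\<omega>\<in>space (F t). B t \<omega> \<inter> U \<noteq> {}} \<in> sets (F t)"
  using cones by (auto simp: random_convex_cone_def)

lemma closed_B: "t < T \<Longrightarrow> \<omega> \<in> space (F t) \<Longrightarrow> closed (B t \<omega>)"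
  using polyhedral space_F[of t] by (simp add: polyhedron_imp_closed)

lemma zero_B: "t < T \<Longrightarrow> \<omega> \<in> space (F t) \<Longrightarrow> 0 \<in> B t \<omega>"
  using cone space_F[of t] by (simp add: convex_cone_contains_0)

lemma snd_measurable: "snd \<in> borel_measurable (borel :: ('b \<times> real) measure)"
  by (intro borel_measurable_continuous_onI continuous_intros)

lemma increment_measurable:
  assumes "t < T"
  shows "(\<lambda>(\<omega>, z). fst z - S t \<omega>) \<in> borel_measurable (F t \<Otimes>\<^sub>M (borel :: ('b \<times> real) measure))"
proof -
  have [measurable]: "S t \<in> borel_measurable (F t)"
    using assms adapted by simp
  show ?thesis
    unfolding borel_prod[symmetric] by measurable
qed

end

text \<open>\<open>\<pi>'\<close> and \<open>\<kappa>\<close> are arbitrary, so that the step serves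
  both the construction of a solution and the study of a given one with its own version of the
  conditional law.\<close>

locale market_step = constrained_market M F T S B
  for M :: "'a measure" and F T and S :: "nat \<Rightarrow> 'a \<Rightarrow> 'b::euclidean_space" and B +
  fixes t :: nat and \<pi>' :: "'a \<Rightarrow> real" and \<kappa> :: "'a \<Rightarrow> ('b \<times> real) measure"
  assumes t: "t < T" and \<pi>': "\<pi>' \<in> borel_measurable (F (Suc t))"
    and \<kappa>: "regular_cond_distr M (F t) (\<lambda>\<omega>. (S (Suc t) \<omega>, \<pi>' \<omega>)) \<kappa>"
begin

abbreviation K :: "'a \<Rightarrow> ('b \<times> real) set" where "K \<omega> \<equiv> closed_support (\<kappa> \<omega>)"
abbreviation p :: "'a \<Rightarrow> 'b \<times> real \<Rightarrow> 'b" where "p \<omega> z \<equiv> fst z - S t \<omega>"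

lemma \<kappa>_kernel: "\<kappa> \<in> measurable (F t) (prob_algebra borel)"
  using \<kappa> by (simp add: regular_cond_distr_def)

lemma K_nonempty: "\<omega> \<in> space M \<Longrightarrow> K \<omega> \<noteq> {}"
  using prob_algebra_kernelD[OF \<kappa>_kernel] space_F[of t] t by (intro closed_support_nonempty) auto

lemma \<eta>_measurable: "(\<lambda>\<omega>. (S (Suc t) \<omega>, \<pi>' \<omega>)) \<in> borel_measurable M"
proof -
  have [measurable]: "S (Suc t) \<in> borel_measurable M" "\<pi>' \<in> borel_measurable M"
    using t adapted[of "Suc t"] \<pi>' by (auto intro: measurable_F_M[of "Suc t"])
  show ?thesis
    by (intro borel_measurable_Pair) auto
qed

lemma subalg_t: "subalgebra M (F t)"
  using t by (intro subalg) simp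

lemmas AE_\<eta>I = AE_regular_cond_distrI[OF prob_space_axioms subalg_t \<eta>_measurable \<kappa>]
lemmas AE_KI = AE_closed_support_regular_cond_distr[OF prob_space_axioms subalg_t \<eta>_measurable \<kappa>]
lemmas AE_\<kappa>_iff = AE_regular_cond_distr_iff[OF prob_space_axioms subalg_t \<eta>_measurable \<kappa>]

lemma p_continuous: "continuous_on UNIV (p \<omega>)"
  by (intro continuous_intros)

text \<open>
  A pointwise arbitrage, suitably scaled, gains at least the indicator of a small ball that charges
  the conditional law. There are countably many such balls, and for each one the arbitrages form a
  closed random set with a measurable selection, which the no-arbitrage condition excludes.
\<close>

lemma AE_pointwise_no_arbitrage:
  "AE \<omega> in M. \<forall>\<gamma>\<in>B t \<omega>. (\<forall>z\<in>K \<omega>. 0 \<le> \<gamma> \<bullet> p \<omega> z) \<longrightarrow> (\<forall>z\<in>K \<omega>. \<gamma> \<bullet> p \<omega> z = 0)"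
proof -
  note p_meas[measurable] = increment_measurable[OF t] and snd_measurable[measurable]
  obtain Q :: "('b \<times> real) set" where Q: "countable Q" "\<And>U. open U \<Longrightarrow> U \<noteq> {} \<Longrightarrow> \<exists>q\<in>Q. q \<in> U"
    using countable_dense_setE by blast
  define W where "W q n = ball q (1 / Suc n)" for q :: "'b \<times> real" and n
  define G where "G q n \<omega> = hedges (K \<omega>) (indicat_real (W q n)) (B t \<omega>) (p \<omega>)" for q n \<omega>
  have "AE \<omega> in M. G q n \<omega> = {} \<or> emeasure (\<kappa> \<omega>) (W q n) = 0" for q n
  proof -
    have W: "open (W q n)" and [measurable]: "W q n \<in> sets borel"
      by (auto simp: W_def)
    have ind: "(\<lambda>(\<omega>, z). indicat_real (W q n) z) \<in> borel_measurable (F t \<Otimes>\<^sub>M borel)"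
      by measurable
    have lsc: "open {z. a < indicat_real (W q n) z}" for a
    proof -
      have "{z. a < indicat_real (W q n) z} = (if a < 0 then UNIV else if a < 1 then W q n else {})"
        by (auto simp: indicator_def)
      then show ?thesis
        using W by simp
    qed
    have "\<exists>g\<in>borel_measurable (F t). \<forall>\<omega>\<in>space (F t). g \<omega> \<in> B t \<omega> \<and> g \<omega> \<in> (if G q n \<omega> = {} then {0} else G q n \<omega>)"
      unfolding G_def
      using \<kappa>_kernel cone_measurable[OF t] closed_B[OF t] zero_B[OF t] ind lsc p_meas p_continuous
      by (rule hedges_selection)
    then obtain g where g[measurable]: "g \<in> borel_measurable (F t)" and gB: "\<And>\<omega>. \<omega> \<in> space (F t) \<Longrightarrow> g \<omega> \<in> B t \<omega>"
      and gG: "\<And>\<omega>. \<omega> \<in> space (F t) \<Longrightarrow> g \<omega> \<in> (if G q n \<omega> = {} then {0} else G q n \<omega>)"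
      by blast
    define A where "A = {\<omega>\<in>space (F t). G q n \<omega> \<inter> UNIV \<noteq> {}}"
    have A[measurable]: "A \<in> sets (F t)"
      unfolding A_def G_def
      using \<kappa>_kernel cone_measurable[OF t] closed_B[OF t] ind lsc p_meas p_continuous open_UNIV
      by (rule hedges_measurable)
    \<comment> \<open>The second branch records that nothing is traded outside \<open>A\<close>, so
      that the gain is nonnegative in almost all scenarios and no arbitrage applies.\<close>
    let ?P = "\<lambda>\<omega> z. if \<omega> \<in> A then indicat_real (W q n) z \<le> g \<omega> \<bullet> p \<omega> z else g \<omega> = 0"
    have "AE \<omega> in M. ?P \<omega> (S (Suc t) \<omega>, \<pi>' \<omega>)"
    proof (rule AE_\<eta>I)
      show "Measurable.pred (F t \<Otimes>\<^sub>M borel) (\<lambda>(\<omega>, z). ?P \<omega> z)"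
        by measurable
      show "AE \<omega> in M. \<forall>z\<in>K \<omega>. ?P \<omega> z"
      proof (intro AE_I2 ballI)
        fix \<omega> z assume "\<omega> \<in> space M" and z: "z \<in> K \<omega>"
        then have \<omega>: "\<omega> \<in> space (F t)"
          using space_F[of t] t by simp
        show "?P \<omega> z"
        proof (cases "G q n \<omega> = {}")
          case True
          then show ?thesis
            using gG[OF \<omega>] by (simp add: A_def)
        next
          case False
          then have "\<omega> \<in> A" "g \<omega> \<in> G q n \<omega>"
            using gG[OF \<omega>] \<omega> by (auto simp: A_def)
          with z show ?thesis
            by (simp add: G_def hedges_def)
        qed
      qed
    qed
    then have "AE \<omega> in M. (\<omega> \<in> A \<longrightarrow> indicat_real (W q n) (S (Suc t) \<omega>, \<pi>' \<omega>) \<le> g \<omega> \<bullet> (S (Suc t) \<omega> - S t \<omega>)) \<and>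
        (\<omega> \<notin> A \<longrightarrow> g \<omega> = 0)"
      by (rule eventually_mono) (auto split: if_splits)
    then have ind_le: "AE \<omega> in M. \<omega> \<in> A \<longrightarrow> indicat_real (W q n) (S (Suc t) \<omega>, \<pi>' \<omega>) \<le> g \<omega> \<bullet> (S (Suc t) \<omega> - S t \<omega>)"
      and not_A: "AE \<omega> in M. \<omega> \<notin> A \<longrightarrow> g \<omega> = 0"
      unfolding AE_conj_iff by blast+
    \<comment> \<open>Trading in period \<open>t\<close> only makes the total gain that of this one
      period.\<close>
    define \<gamma> where "\<gamma> s = (if s = t then g else (\<lambda>_. 0))" for s
    have "admissible F B T \<gamma>"
      using gB zero_B by (auto simp: admissible_def \<gamma>_def)
    moreover have gain: "gain S \<gamma> T \<omega> = g \<omega> \<bullet> (S (Suc t) \<omega> - S t \<omega>)" for \<omega>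
    proof -
      have "gain S \<gamma> T \<omega> = (\<Sum>m=1..T. if m = Suc t then g \<omega> \<bullet> (S (Suc t) \<omega> - S t \<omega>) else 0)"
        unfolding gain_def by (intro sum.cong) (auto simp: \<gamma>_def)
      then show ?thesis
        using t by simp
    qed
    moreover have "AE \<omega> in M. 0 \<le> gain S \<gamma> T \<omega>"
      using ind_le not_A
    proof eventually_elim
      case (elim \<omega>)
      then show ?case
        by (cases "\<omega> \<in> A") (auto simp: gain intro: order_trans[of 0 "indicat_real _ _"])
    qed
    ultimately have "AE \<omega> in M. g \<omega> \<bullet> (S (Suc t) \<omega> - S t \<omega>) = 0"
      using NA unfolding no_arbitrage_def by (metis (no_types, lifting) AE_cong)
    \<comment> \<open>On \<open>A\<close> the vanishing gain dominates the indicator, so the next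
      price and value avoid the ball; disintegration turns this into zero conditional mass.\<close>
    with ind_le have "AE \<omega> in M. \<not> (\<omega> \<in> A \<and> (S (Suc t) \<omega>, \<pi>' \<omega>) \<in> W q n)"
      by eventually_elim (auto simp: indicator_def split: if_splits)
    moreover have "Measurable.pred (F t \<Otimes>\<^sub>M borel) (\<lambda>(\<omega>, z). \<not> (\<omega> \<in> A \<and> z \<in> W q n))"
      by measurable
    ultimately have "AE \<omega> in M. AE z in \<kappa> \<omega>. \<not> (\<omega> \<in> A \<and> z \<in> W q n)"
      using AE_\<kappa>_iff[of "\<lambda>\<omega> z. \<not> (\<omega> \<in> A \<and> z \<in> W q n)"] by simp
    then show ?thesis
      using AE_space
    proof eventually_elim
      case (elim \<omega>)
      have s: "sets (\<kappa> \<omega>) = sets borel"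
        using prob_algebra_kernelD(2)[OF \<kappa>_kernel] elim(2) space_F[of t] t by simp
      show ?case
      proof (cases "\<omega> \<in> A")
        case True
        with elim(1) have "AE z in \<kappa> \<omega>. z \<notin> W q n"
          by simp
        moreover have "{z\<in>space (\<kappa> \<omega>). \<not> z \<notin> W q n} = W q n"
          using sets_eq_imp_space_eq[OF s] by auto
        ultimately show ?thesis
          using AE_iff_measurable[of "W q n" "\<kappa> \<omega>" "\<lambda>z. z \<notin> W q n"] s by simp
      next
        case False
        then show ?thesis
          using elim(2) space_F[of t] t by (auto simp: A_def)
      qed
    qed
  qed
  then have "AE \<omega> in M. \<forall>q\<in>Q. \<forall>n. G q n \<omega> = {} \<or> emeasure (\<kappa> \<omega>) (W q n) = 0"
    unfolding AE_ball_countable[OF Q(1)] AE_all_countable by blast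
  then show ?thesis
    using AE_space
  proof eventually_elim
    case (elim \<omega>)
    show ?case
    proof (intro ballI impI, rule ccontr)
      fix \<gamma> z0 assume \<gamma>: "\<gamma> \<in> B t \<omega>" "\<forall>z\<in>K \<omega>. 0 \<le> \<gamma> \<bullet> p \<omega> z" and z0: "z0 \<in> K \<omega>" "\<gamma> \<bullet> p \<omega> z0 \<noteq> 0"
      define c where "c = \<gamma> \<bullet> p \<omega> z0"
      have "c > 0"
        using \<gamma>(2) z0 by (force simp: c_def)
      \<comment> \<open>The factor makes the gain at \<open>z0\<close> equal to 2. So it exceeds 1
        on a neighbourhood of \<open>z0\<close>, which contains a ball of the countable family
        around \<open>z0\<close>.\<close>
      define \<gamma>' where "\<gamma>' = (2 / c) *\<^sub>R \<gamma>"
      have \<gamma>'B: "\<gamma>' \<in> B t \<omega>"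
        unfolding \<gamma>'_def using \<gamma>(1) \<open>c > 0\<close> cone[OF t elim(2)] by (intro convex_cone_scaleR) auto
      have \<gamma>'_nonneg: "0 \<le> \<gamma>' \<bullet> p \<omega> z" if "z \<in> K \<omega>" for z
        using \<gamma>(2) that \<open>c > 0\<close> by (simp add: \<gamma>'_def)
      have "open {z. 1 < \<gamma>' \<bullet> p \<omega> z}"
        by (intro open_Collect_less continuous_intros)
      moreover have "z0 \<in> {z. 1 < \<gamma>' \<bullet> p \<omega> z}"
        using \<open>c > 0\<close> by (simp add: \<gamma>'_def c_def)
      ultimately obtain \<epsilon> where \<epsilon>: "\<epsilon> > 0" "ball z0 \<epsilon> \<subseteq> {z. 1 < \<gamma>' \<bullet> p \<omega> z}"
        by (rule openE)
      obtain n where n: "1 / Suc n < \<epsilon> / 2"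
        using nat_approx_posE[of "\<epsilon> / 2"] \<epsilon>(1) by auto
      obtain q where q: "q \<in> Q" "q \<in> ball z0 (1 / Suc n)"
        using Q(2)[OF open_ball, of z0 "1 / Suc n"] by auto
      have "W q n \<subseteq> ball z0 \<epsilon>"
      proof
        fix z assume "z \<in> W q n"
        have "dist z0 z \<le> dist z0 q + dist q z"
          by (rule dist_triangle)
        also have "\<dots> < 1 / Suc n + 1 / Suc n"
          using q(2) \<open>z \<in> W q n\<close> by (intro add_strict_mono) (auto simp: W_def)
        finally show "z \<in> ball z0 \<epsilon>"
          using n by simp
      qed
      with \<epsilon>(2) have "\<gamma>' \<in> G q n \<omega>"
        using \<gamma>'B \<gamma>'_nonneg by (auto simp: G_def hedges_def indicator_def less_imp_le)
      moreover have "emeasure (\<kappa> \<omega>) (W q n) \<noteq> 0"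
      proof -
        have "z0 \<in> K \<omega> \<inter> W q n"
          using z0(1) q(2) by (simp add: W_def dist_commute)
        then show ?thesis
          using closed_support_Int_open_eq_empty_iff[of "W q n" "\<kappa> \<omega>"]
            prob_algebra_kernelD(2)[OF \<kappa>_kernel] elim(2) space_F[of t] t by (auto simp: W_def)
      qed
      ultimately show False
        using elim(1) q(1) by blast
    qed
  qed
qed

section \<open>Superhedging capitals of a single period\<close>

definition superhedging :: "'a \<Rightarrow> real set" where
  "superhedging \<omega> = {x. \<exists>\<gamma>\<in>B t \<omega>. \<forall>z\<in>K \<omega>. snd z \<le> x + \<gamma> \<bullet> p \<omega> z}"

lemma superhedging_iff: "x \<in> superhedging \<omega> \<longleftrightarrow> hedges (K \<omega>) (\<lambda>z. snd z - x) (B t \<omega>) (p \<omega>) \<noteq> {}"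
  by (auto simp: superhedging_def hedges_def algebra_simps)

lemma superhedging_mono: "x \<in> superhedging \<omega> \<Longrightarrow> x \<le> y \<Longrightarrow> y \<in> superhedging \<omega>"
proof -
  assume "x \<in> superhedging \<omega>" and xy: "x \<le> y"
  then obtain \<gamma> where \<gamma>: "\<gamma> \<in> B t \<omega>" "\<And>z. z \<in> K \<omega> \<Longrightarrow> snd z \<le> x + \<gamma> \<bullet> p \<omega> z"
    unfolding superhedging_def by blast
  have "snd z \<le> y + \<gamma> \<bullet> p \<omega> z" if "z \<in> K \<omega>" for z
    using \<gamma>(2)[OF that] xy by linarith
  with \<gamma>(1) show "y \<in> superhedging \<omega>"
    unfolding superhedging_def by blast
qed

text \<open>Weak and strong duality together, with one null set for all \<open>x\<close>, so that a
  random capital may be inserted afterwards. Taking the supremum in the extended reals also covers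
  an empty and an unbounded fiber.\<close>

lemma AE_superhedging_iff:
  "AE \<omega> in M. \<forall>x. x \<in> superhedging \<omega> \<longleftrightarrow> Sup (ereal ` price_fiber (S t \<omega>) (K \<omega>) (B t \<omega>)) \<le> ereal x"
  using AE_pointwise_no_arbitrage AE_space
proof eventually_elim
  case (elim \<omega>)
  show ?case
  proof (intro allI iffI)
    fix x assume "x \<in> superhedging \<omega>"
    then obtain \<gamma> where \<gamma>: "\<gamma> \<in> B t \<omega>" "\<And>z. z \<in> K \<omega> \<Longrightarrow> snd z \<le> x + \<gamma> \<bullet> p \<omega> z"
      unfolding superhedging_def by blast
    have "ereal y \<le> ereal x" if "y \<in> price_fiber (S t \<omega>) (K \<omega>) (B t \<omega>)" for y
      using price_fiber_le_superhedge[OF that \<gamma>] by simp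
    then show "Sup (ereal ` price_fiber (S t \<omega>) (K \<omega>) (B t \<omega>)) \<le> ereal x"
      by (rule SUP_least)
  next
    fix x assume "Sup (ereal ` price_fiber (S t \<omega>) (K \<omega>) (B t \<omega>)) \<le> ereal x"
    then have "y \<le> x" if "y \<in> price_fiber (S t \<omega>) (K \<omega>) (B t \<omega>)" for y
      using that by (auto simp: SUP_le_iff)
    then show "x \<in> superhedging \<omega>"
      unfolding superhedging_def
      using superhedge_attained[OF polyhedral[OF t elim(2)] cone[OF t elim(2)] K_nonempty[OF elim(2)], of "S t \<omega>" x] elim(1)
      by blast
  qed
qed

lemma AE_superhedging_upper:
  assumes X[measurable]: "X \<in> borel_measurable (F t)" and \<gamma>[measurable]: "\<gamma> \<in> borel_measurable (F t)"
    and \<gamma>B: "\<And>\<omega>. \<omega> \<in> space (F t) \<Longrightarrow> \<gamma> \<omega> \<in> B t \<omega>"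
    and AE: "AE \<omega> in M. \<pi>' \<omega> \<le> X \<omega> + \<gamma> \<omega> \<bullet> (S (Suc t) \<omega> - S t \<omega>)"
  shows "AE \<omega> in M. X \<omega> \<in> superhedging \<omega>"
proof -
  note p_meas[measurable] = increment_measurable[OF t] and snd_measurable[measurable]
  have "AE \<omega> in M. \<forall>z\<in>K \<omega>. snd z \<le> X \<omega> + \<gamma> \<omega> \<bullet> p \<omega> z"
  proof (rule AE_KI)
    show "Measurable.pred (F t \<Otimes>\<^sub>M borel) (\<lambda>(\<omega>, z). snd z \<le> X \<omega> + \<gamma> \<omega> \<bullet> p \<omega> z)"
      by measurable
    show "closed {z. snd z \<le> X \<omega> + \<gamma> \<omega> \<bullet> p \<omega> z}" for \<omega>
      by (intro closed_Collect_le continuous_intros)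
  qed (use AE in simp)
  then show ?thesis
    using AE_space by eventually_elim (use \<gamma>B space_F[of t] t in \<open>auto simp: superhedging_def\<close>)
qed

text \<open>If some \<open>x\<close> below \<open>X \<omega>\<close> were a superhedging capital,
  the superhedge and the sub-hedge could be held together, as the cone is convex, and would gain
  strictly at every point of the support: a pointwise arbitrage.\<close>

lemma AE_superhedging_lower:
  assumes X[measurable]: "X \<in> borel_measurable (F t)" and \<gamma>[measurable]: "\<gamma> \<in> borel_measurable (F t)"
    and \<gamma>B: "\<And>\<omega>. \<omega> \<in> space (F t) \<Longrightarrow> \<gamma> \<omega> \<in> B t \<omega>"
    and AE: "AE \<omega> in M. X \<omega> - \<gamma> \<omega> \<bullet> (S (Suc t) \<omega> - S t \<omega>) \<le> \<pi>' \<omega>"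
  shows "AE \<omega> in M. \<forall>x\<in>superhedging \<omega>. X \<omega> \<le> x"
proof -
  note p_meas[measurable] = increment_measurable[OF t] and snd_measurable[measurable]
  have "AE \<omega> in M. \<forall>z\<in>K \<omega>. X \<omega> - \<gamma> \<omega> \<bullet> p \<omega> z \<le> snd z"
  proof (rule AE_KI)
    show "Measurable.pred (F t \<Otimes>\<^sub>M borel) (\<lambda>(\<omega>, z). X \<omega> - \<gamma> \<omega> \<bullet> p \<omega> z \<le> snd z)"
      by measurable
    show "closed {z. X \<omega> - \<gamma> \<omega> \<bullet> p \<omega> z \<le> snd z}" for \<omega>
      by (intro closed_Collect_le continuous_intros)
  qed (use AE in simp)
  then show ?thesis
    using AE_pointwise_no_arbitrage AE_space
  proof eventually_elim
    case (elim \<omega>)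
    show ?case
    proof (rule ballI, rule ccontr)
      fix x assume "x \<in> superhedging \<omega>" and "\<not> X \<omega> \<le> x"
      then obtain \<gamma>' where \<gamma>': "\<gamma>' \<in> B t \<omega>" "\<forall>z\<in>K \<omega>. snd z \<le> x + \<gamma>' \<bullet> p \<omega> z"
        by (auto simp: superhedging_def)
      have pos: "0 < (\<gamma> \<omega> + \<gamma>') \<bullet> p \<omega> z" if "z \<in> K \<omega>" for z
        using elim(1) \<gamma>'(2) that \<open>\<not> X \<omega> \<le> x\<close> by (force simp: inner_add_left)
      have "\<gamma> \<omega> + \<gamma>' \<in> B t \<omega>"
        using cone[OF t elim(3)] \<gamma>B \<gamma>'(1) elim(3) space_F[of t] t by (intro convex_cone_add) auto
      with elim(2) pos K_nonempty[OF elim(3)] show False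
        by (metis ex_in_conv less_imp_le less_irrefl)
    qed
  qed
qed

lemma superhedging_measurable: "{\<omega>\<in>space (F t). x \<in> superhedging \<omega>} \<in> sets (F t)"
proof -
  have "{\<omega>\<in>space (F t). hedges (K \<omega>) (\<lambda>z. snd z - x) (B t \<omega>) (p \<omega>) \<inter> UNIV \<noteq> {}} \<in> sets (F t)"
  proof (rule hedges_measurable[OF \<kappa>_kernel cone_measurable[OF t] closed_B[OF t] _ _ increment_measurable[OF t] p_continuous open_UNIV])
    show "(\<lambda>(\<omega>, z). snd z - x) \<in> borel_measurable (F t \<Otimes>\<^sub>M (borel :: ('b \<times> real) measure))"
      unfolding borel_prod[symmetric] by measurable
    show "open {z :: 'b \<times> real. a < snd z - x}" for a
      by (intro open_Collect_less continuous_intros)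
  qed
  then show ?thesis
    by (simp add: superhedging_iff)
qed

text \<open>The solution is defined as the infimum \<open>V\<close> of the superhedging capitals
  instead of the supremum over the fiber. Both agree almost surely, but for \<open>V\<close>
  measurability is at hand: the capitals are upward closed, so rational ones suffice, and each
  defines a measurable event. The bounds from \<open>X\<close> and \<open>X'\<close> exclude the
  values \<open>\<infinity>\<close> and \<open>- \<infinity>\<close>.\<close>

lemma step_solution:
  assumes "X \<in> borel_measurable (F t)" "\<gamma> \<in> borel_measurable (F t)" "\<And>\<omega>. \<omega> \<in> space (F t) \<Longrightarrow> \<gamma> \<omega> \<in> B t \<omega>"
    and "AE \<omega> in M. \<pi>' \<omega> \<le> X \<omega> + \<gamma> \<omega> \<bullet> (S (Suc t) \<omega> - S t \<omega>)"
    and "X' \<in> borel_measurable (F t)" "\<gamma>' \<in> borel_measurable (F t)" "\<And>\<omega>. \<omega> \<in> space (F t) \<Longrightarrow> \<gamma>' \<omega> \<in> B t \<omega>"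
    and "AE \<omega> in M. X' \<omega> - \<gamma>' \<omega> \<bullet> (S (Suc t) \<omega> - S t \<omega>) \<le> \<pi>' \<omega>"
  shows "\<exists>\<pi>\<in>borel_measurable (F t). (AE \<omega> in M. X' \<omega> \<le> \<pi> \<omega> \<and> \<pi> \<omega> \<le> X \<omega>) \<and>
    (AE \<omega> in M. ereal (\<pi> \<omega>) = Sup (ereal ` price_fiber (S t \<omega>) (K \<omega>) (B t \<omega>)))"
proof -
  define V where "V \<omega> = Inf (ereal ` superhedging \<omega>)" for \<omega>
  have "V \<in> borel_measurable (F t)"
  proof (rule borel_measurableI_less)
    fix y :: ereal
    have "V \<omega> < y \<longleftrightarrow> (\<exists>q. of_rat q \<in> superhedging \<omega> \<and> ereal (of_rat q) < y)" for \<omega>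
    proof
      assume "V \<omega> < y"
      then obtain x where x: "x \<in> superhedging \<omega>" "ereal x < y"
        by (auto simp: V_def Inf_less_iff)
      then obtain r where r: "x < r" "ereal r < y"
        using ereal_dense2[OF x(2)] by auto
      then obtain q where "x < of_rat q" "of_rat q < r"
        using of_rat_dense by blast
      then show "\<exists>q. of_rat q \<in> superhedging \<omega> \<and> ereal (of_rat q) < y"
        using x(1) r(2) superhedging_mono[of x \<omega> "of_rat q"]
        by (intro exI[of _ q]) (auto intro: less_trans[of _ "ereal r"])
    qed (auto simp: V_def Inf_less_iff)
    then have "{\<omega>\<in>space (F t). V \<omega> < y} = (\<Union>q\<in>{q. ereal (of_rat q) < y}. {\<omega>\<in>space (F t). of_rat q \<in> superhedging \<omega>})"
      by auto
    also have "\<dots> \<in> sets (F t)"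
      using superhedging_measurable by (intro sets.countable_UN') auto
    finally show "{\<omega>\<in>space (F t). V \<omega> < y} \<in> sets (F t)" .
  qed
  then have "(\<lambda>\<omega>. real_of_ereal (V \<omega>)) \<in> borel_measurable (F t)"
    by measurable
  moreover have upper: "AE \<omega> in M. X \<omega> \<in> superhedging \<omega>"
    using assms(1-4) by (rule AE_superhedging_upper)
  moreover have lower: "AE \<omega> in M. \<forall>x\<in>superhedging \<omega>. X' \<omega> \<le> x"
    using assms(5-8) by (rule AE_superhedging_lower)
  moreover have "AE \<omega> in M. (X' \<omega> \<le> real_of_ereal (V \<omega>) \<and> real_of_ereal (V \<omega>) \<le> X \<omega>) \<and>
      ereal (real_of_ereal (V \<omega>)) = Sup (ereal ` price_fiber (S t \<omega>) (K \<omega>) (B t \<omega>))"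
    using AE_superhedging_iff upper lower
  proof eventually_elim
    case (elim \<omega>)
    let ?s = "Sup (ereal ` price_fiber (S t \<omega>) (K \<omega>) (B t \<omega>))"
    have "?s \<noteq> \<infinity>"
      using elim(1,2) by auto
    moreover have "?s \<noteq> - \<infinity>"
    proof
      assume "?s = - \<infinity>"
      then have "X' \<omega> - 1 \<in> superhedging \<omega>"
        using elim(1) by simp
      with elim(3) show False
        by force
    qed
    ultimately obtain s where s: "?s = ereal s"
      by (cases ?s) auto
    with elim(1) have sh: "superhedging \<omega> = {s..}"
      by auto
    have "V \<omega> = ereal s"
      unfolding V_def sh by (intro antisym INF_lower2[of s] INF_greatest) auto
    with s sh elim(2,3) show ?case
      by simp
  qed
  ultimately show ?thesis
    by (intro bexI[of _ "\<lambda>\<omega>. real_of_ereal (V \<omega>)"]) (auto elim: eventually_mono)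
qed

text \<open>By duality the supremum is itself a superhedging capital. So in almost every scenario
  the set of hedges from capital \<open>\<pi> \<omega>\<close> is nonempty and the selection lies in
  it.\<close>

lemma step_strategy:
  assumes \<pi>[measurable]: "\<pi> \<in> borel_measurable (F t)"
    and AE: "AE \<omega> in M. ereal (\<pi> \<omega>) = Sup (ereal ` price_fiber (S t \<omega>) (K \<omega>) (B t \<omega>))"
  shows "\<exists>\<gamma>\<in>borel_measurable (F t). (\<forall>\<omega>\<in>space (F t). \<gamma> \<omega> \<in> B t \<omega>) \<and>
    (AE \<omega> in M. \<pi>' \<omega> \<le> \<pi> \<omega> + \<gamma> \<omega> \<bullet> (S (Suc t) \<omega> - S t \<omega>))"
proof -
  note p_meas[measurable] = increment_measurable[OF t] and snd_measurable[measurable]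
  have h: "(\<lambda>(\<omega>, z). snd z - \<pi> \<omega>) \<in> borel_measurable (F t \<Otimes>\<^sub>M (borel :: ('b \<times> real) measure))"
    unfolding borel_prod[symmetric] by measurable
  have lsc: "open {z :: 'b \<times> real. a < snd z - \<pi> \<omega>}" for a \<omega>
    by (intro open_Collect_less continuous_intros)
  have "\<exists>g\<in>borel_measurable (F t). \<forall>\<omega>\<in>space (F t). g \<omega> \<in> B t \<omega> \<and>
      g \<omega> \<in> (if hedges (K \<omega>) (\<lambda>z. snd z - \<pi> \<omega>) (B t \<omega>) (p \<omega>) = {} then {0}
        else hedges (K \<omega>) (\<lambda>z. snd z - \<pi> \<omega>) (B t \<omega>) (p \<omega>))"
    using \<kappa>_kernel cone_measurable[OF t] closed_B[OF t] zero_B[OF t] h lsc p_meas p_continuous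
    by (rule hedges_selection)
  then obtain g where g[measurable]: "g \<in> borel_measurable (F t)" and gB: "\<And>\<omega>. \<omega> \<in> space (F t) \<Longrightarrow> g \<omega> \<in> B t \<omega>"
    and gG: "\<And>\<omega>. \<omega> \<in> space (F t) \<Longrightarrow> g \<omega> \<in> (if hedges (K \<omega>) (\<lambda>z. snd z - \<pi> \<omega>) (B t \<omega>) (p \<omega>) = {} then {0}
        else hedges (K \<omega>) (\<lambda>z. snd z - \<pi> \<omega>) (B t \<omega>) (p \<omega>))"
    by blast
  have "AE \<omega> in M. snd (S (Suc t) \<omega>, \<pi>' \<omega>) \<le> \<pi> \<omega> + g \<omega> \<bullet> p \<omega> (S (Suc t) \<omega>, \<pi>' \<omega>)"
  proof (rule AE_\<eta>I)
    show "Measurable.pred (F t \<Otimes>\<^sub>M borel) (\<lambda>(\<omega>, z). snd z \<le> \<pi> \<omega> + g \<omega> \<bullet> p \<omega> z)"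
      by measurable
    show "AE \<omega> in M. \<forall>z\<in>K \<omega>. snd z \<le> \<pi> \<omega> + g \<omega> \<bullet> p \<omega> z"
      using AE AE_superhedging_iff AE_space
    proof eventually_elim
      case (elim \<omega>)
      then have "\<pi> \<omega> \<in> superhedging \<omega>"
        by simp
      then have "g \<omega> \<in> hedges (K \<omega>) (\<lambda>z. snd z - \<pi> \<omega>) (B t \<omega>) (p \<omega>)"
        using gG[of \<omega>] elim(3) space_F[of t] t unfolding superhedging_iff by simp
      then show ?case
        by (auto simp: hedges_def algebra_simps)
    qed
  qed
  then show ?thesis
    by (intro bexI[OF _ g] conjI ballI gB) simp_all
qed

end

section \<open>The recursion\<close>

context constrained_market
begin

lemma gain_measurable:
  assumes \<gamma>: "admissible F B T \<gamma>" and t: "t \<le> T"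
  shows "gain S \<gamma> t \<in> borel_measurable (F t)"
proof -
  have "(\<lambda>\<omega>. \<gamma> (n - 1) \<omega> \<bullet> (S n \<omega> - S (n - 1) \<omega>)) \<in> borel_measurable (F t)" if n: "n \<in> {1..t}" for n
  proof -
    have "\<gamma> (n - 1) \<in> borel_measurable (F (n - 1))"
      using \<gamma> n t by (auto simp: admissible_def)
    then have [measurable]: "\<gamma> (n - 1) \<in> borel_measurable (F t)"
      using n t by (intro measurable_F_mono[of "n - 1" t]) auto
    have [measurable]: "S n \<in> borel_measurable (F t)" "S (n - 1) \<in> borel_measurable (F t)"
    proof -
      have "n \<le> T" "n - 1 \<le> T" "n \<le> t" "n - 1 \<le> t"
        using n t by auto
      then show "S n \<in> borel_measurable (F t)" "S (n - 1) \<in> borel_measurable (F t)"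
        using adapted measurable_F_mono t by blast+
    qed
    show ?thesis
      by measurable
  qed
  then show ?thesis
    unfolding gain_def[abs_def] by (rule borel_measurable_sum)
qed

text \<open>The two hedges enter as an invariant: the values constructed stay between
  \<open>x' - gain\<close> and \<open>x + gain\<close>, and this sandwich makes the next value real
  again. Values and conditional laws are not canonical, so the backward recursion is run as a
  dependent choice.\<close>

lemma upper_recursion_exists:
  assumes f: "f \<in> borel_measurable (F T)"
    and \<gamma>: "admissible F B T \<gamma>" "AE \<omega> in M. f \<omega> \<le> x + gain S \<gamma> T \<omega>"
    and \<gamma>': "admissible F B T \<gamma>'" "AE \<omega> in M. x' - gain S \<gamma>' T \<omega> \<le> f \<omega>"
  shows "\<exists>\<pi>. upper_recursion M F S B T f \<pi>"
proof -
  \<comment> \<open>\<open>n\<close> counts periods backwards from \<open>T\<close>; beyond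
    \<open>T\<close> nothing is demanded, so the choice can continue forever.\<close>
  define P where "P n \<pi> \<longleftrightarrow> (n = 0 \<longrightarrow> \<pi> = f) \<and> (n \<le> T \<longrightarrow> \<pi> \<in> borel_measurable (F (T - n)) \<and>
      (AE \<omega> in M. x' - gain S \<gamma>' (T - n) \<omega> \<le> \<pi> \<omega> \<and> \<pi> \<omega> \<le> x + gain S \<gamma> (T - n) \<omega>))" for n \<pi>
  define Q where "Q n \<pi>' \<pi> \<longleftrightarrow> (n < T \<longrightarrow> (\<exists>\<kappa>. regular_cond_distr M (F (T - Suc n)) (\<lambda>\<omega>. (S (T - n) \<omega>, \<pi>' \<omega>)) \<kappa> \<and>
      (AE \<omega> in M. ereal (\<pi> \<omega>) = Sup (ereal ` price_fiber (S (T - Suc n) \<omega>) (closed_support (\<kappa> \<omega>)) (B (T - Suc n) \<omega>)))))"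
    for n and \<pi>' \<pi> :: "'a \<Rightarrow> real"
  have "\<exists>\<rho>. \<forall>n. P n (\<rho> n) \<and> Q n (\<rho> n) (\<rho> (Suc n))"
  proof (rule dependent_nat_choice)
    have "AE \<omega> in M. x' - gain S \<gamma>' T \<omega> \<le> f \<omega> \<and> f \<omega> \<le> x + gain S \<gamma> T \<omega>"
      using \<gamma>(2) \<gamma>'(2) by eventually_elim simp
    then show "\<exists>\<pi>. P 0 \<pi>"
      using f by (simp add: P_def)
  next
    fix \<pi>' n assume P: "P n \<pi>'"
    show "\<exists>\<pi>. P (Suc n) \<pi> \<and> Q n \<pi>' \<pi>"
    proof (cases "n < T")
      case False
      then show ?thesis
        by (simp add: P_def Q_def)
    next
      case True
      define t where "t = T - Suc n"
      have tT: "t < T" "T - n = Suc t" "T - Suc n = t"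
        using True by (auto simp: t_def)
      have \<pi>': "\<pi>' \<in> borel_measurable (F (Suc t))"
        and bounds: "AE \<omega> in M. x' - gain S \<gamma>' (Suc t) \<omega> \<le> \<pi>' \<omega> \<and> \<pi>' \<omega> \<le> x + gain S \<gamma> (Suc t) \<omega>"
        using P True tT by (auto simp: P_def)
      have [measurable]: "S (Suc t) \<in> borel_measurable M" "\<pi>' \<in> borel_measurable M"
        using tT adapted[of "Suc t"] \<pi>' by (auto intro: measurable_F_M[of "Suc t"])
      have "(\<lambda>\<omega>. (S (Suc t) \<omega>, \<pi>' \<omega>)) \<in> borel_measurable M"
        by (intro borel_measurable_Pair) auto
      then obtain \<kappa> where \<kappa>: "regular_cond_distr M (F t) (\<lambda>\<omega>. (S (Suc t) \<omega>, \<pi>' \<omega>)) \<kappa>"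
        using regular_cond_distr_exists[OF prob_space_axioms subalg] tT(1) by (metis less_imp_le)
      interpret market_step M F T S B t \<pi>' \<kappa>
        using tT(1) \<pi>' \<kappa> by unfold_locales
      have "\<exists>\<pi>\<in>borel_measurable (F t).
          (AE \<omega> in M. x' - gain S \<gamma>' t \<omega> \<le> \<pi> \<omega> \<and> \<pi> \<omega> \<le> x + gain S \<gamma> t \<omega>) \<and>
          (AE \<omega> in M. ereal (\<pi> \<omega>) = Sup (ereal ` price_fiber (S t \<omega>) (K \<omega>) (B t \<omega>)))"
      proof (rule step_solution[where \<gamma> = "\<gamma> t" and \<gamma>' = "\<gamma>' t"])
        show "(\<lambda>\<omega>. x + gain S \<gamma> t \<omega>) \<in> borel_measurable (F t)" "(\<lambda>\<omega>. x' - gain S \<gamma>' t \<omega>) \<in> borel_measurable (F t)"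
          using gain_measurable[OF \<gamma>(1)] gain_measurable[OF \<gamma>'(1)] tT(1) by auto
        show "\<gamma> t \<in> borel_measurable (F t)" "\<gamma>' t \<in> borel_measurable (F t)"
          "\<And>\<omega>. \<omega> \<in> space (F t) \<Longrightarrow> \<gamma> t \<omega> \<in> B t \<omega>" "\<And>\<omega>. \<omega> \<in> space (F t) \<Longrightarrow> \<gamma>' t \<omega> \<in> B t \<omega>"
          using \<gamma>(1) \<gamma>'(1) tT(1) by (auto simp: admissible_def)
        show "AE \<omega> in M. \<pi>' \<omega> \<le> x + gain S \<gamma> t \<omega> + \<gamma> t \<omega> \<bullet> (S (Suc t) \<omega> - S t \<omega>)"
          using bounds by eventually_elim (simp add: gain_Suc add.assoc)
        show "AE \<omega> in M. x' - gain S \<gamma>' t \<omega> - \<gamma>' t \<omega> \<bullet> (S (Suc t) \<omega> - S t \<omega>) \<le> \<pi>' \<omega>"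
          using bounds by eventually_elim (simp add: gain_Suc algebra_simps)
      qed
      then obtain \<pi> where "\<pi> \<in> borel_measurable (F t)"
        "AE \<omega> in M. x' - gain S \<gamma>' t \<omega> \<le> \<pi> \<omega> \<and> \<pi> \<omega> \<le> x + gain S \<gamma> t \<omega>"
        "AE \<omega> in M. ereal (\<pi> \<omega>) = Sup (ereal ` price_fiber (S t \<omega>) (K \<omega>) (B t \<omega>))"
        by blast
      then have "P (Suc n) \<pi>" "Q n \<pi>' \<pi>"
        unfolding P_def Q_def tT(2,3) using \<kappa> by blast+
      then show ?thesis
        by blast
    qed
  qed
  then obtain \<rho> where \<rho>: "\<And>n. P n (\<rho> n)" "\<And>n. Q n (\<rho> n) (\<rho> (Suc n))"
    by blast
  have "upper_recursion M F S B T f (\<lambda>t. \<rho> (T - t))"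
    unfolding upper_recursion_def
  proof (intro conjI allI impI)
    show "\<rho> (T - t) \<in> borel_measurable (F t)" if "t \<le> T" for t
      using \<rho>(1)[of "T - t"] that by (simp add: P_def)
    show "AE \<omega> in M. \<rho> (T - T) \<omega> = f \<omega>"
      using \<rho>(1)[of 0] by (simp add: P_def)
    show "\<exists>\<kappa>. regular_cond_distr M (F t) (\<lambda>\<omega>. (S (Suc t) \<omega>, \<rho> (T - Suc t) \<omega>)) \<kappa> \<and>
        (AE \<omega> in M. ereal (\<rho> (T - t) \<omega>) = Sup (ereal ` price_fiber (S t \<omega>) (closed_support (\<kappa> \<omega>)) (B t \<omega>)))"
      if "t < T" for t
      using \<rho>(2)[of "T - Suc t"] that by (simp add: Q_def Suc_diff_Suc)
  qed
  then show ?thesis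
    by blast
qed

section \<open>Any solution starts at the upper price\<close>

lemma upper_recursion_stepE:
  assumes "upper_recursion M F S B T f \<pi>" "t < T"
  obtains \<kappa> where "market_step M F T S B t (\<pi> (Suc t)) \<kappa>" "\<pi> t \<in> borel_measurable (F t)"
    "AE \<omega> in M. ereal (\<pi> t \<omega>) = Sup (ereal ` price_fiber (S t \<omega>) (closed_support (\<kappa> \<omega>)) (B t \<omega>))"
proof -
  obtain \<kappa> where \<kappa>: "regular_cond_distr M (F t) (\<lambda>\<omega>. (S (Suc t) \<omega>, \<pi> (Suc t) \<omega>)) \<kappa>"
    "AE \<omega> in M. ereal (\<pi> t \<omega>) = Sup (ereal ` price_fiber (S t \<omega>) (closed_support (\<kappa> \<omega>)) (B t \<omega>))"
    using assms unfolding upper_recursion_def by blast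
  have "market_step M F T S B t (\<pi> (Suc t)) \<kappa>"
    using assms \<kappa>(1) by unfold_locales (auto simp: upper_recursion_def)
  moreover have "\<pi> t \<in> borel_measurable (F t)"
    using assms by (auto simp: upper_recursion_def)
  ultimately show thesis
    using \<kappa>(2) by (rule that)
qed

text \<open>Backward in time: if \<open>x + gain\<close> covers \<open>\<pi> (Suc t)\<close>, the
  portfolio \<open>\<gamma> t\<close> shows that \<open>x + gain\<close> at \<open>t\<close> is a
  superhedging capital, and \<open>\<pi> t\<close> is the least one.\<close>

lemma upper_recursion_le:
  assumes \<pi>: "upper_recursion M F S B T f \<pi>"
    and \<gamma>: "admissible F B T \<gamma>" "AE \<omega> in M. f \<omega> \<le> x + gain S \<gamma> T \<omega>" and t: "t \<le> T"
  shows "AE \<omega> in M. \<pi> t \<omega> \<le> x + gain S \<gamma> t \<omega>"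
  using t
proof (induction rule: inc_induct)
  case base
  have "AE \<omega> in M. \<pi> T \<omega> = f \<omega>"
    using \<pi> by (simp add: upper_recursion_def)
  with \<gamma>(2) show ?case
    by eventually_elim simp
next
  case (step t)
  obtain \<kappa> where \<kappa>: "market_step M F T S B t (\<pi> (Suc t)) \<kappa>"
    and AE: "AE \<omega> in M. ereal (\<pi> t \<omega>) = Sup (ereal ` price_fiber (S t \<omega>) (closed_support (\<kappa> \<omega>)) (B t \<omega>))"
    using upper_recursion_stepE[OF \<pi> step.hyps(2)] .
  interpret market_step M F T S B t "\<pi> (Suc t)" \<kappa>
    by (rule \<kappa>)
  have "AE \<omega> in M. x + gain S \<gamma> t \<omega> \<in> superhedging \<omega>"
  proof (rule AE_superhedging_upper[where \<gamma> = "\<gamma> t"])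
    show "(\<lambda>\<omega>. x + gain S \<gamma> t \<omega>) \<in> borel_measurable (F t)"
      using gain_measurable[OF \<gamma>(1)] step.hyps(2) by auto
    show "\<gamma> t \<in> borel_measurable (F t)" "\<And>\<omega>. \<omega> \<in> space (F t) \<Longrightarrow> \<gamma> t \<omega> \<in> B t \<omega>"
      using \<gamma>(1) step.hyps(2) by (auto simp: admissible_def)
    show "AE \<omega> in M. \<pi> (Suc t) \<omega> \<le> x + gain S \<gamma> t \<omega> + \<gamma> t \<omega> \<bullet> (S (Suc t) \<omega> - S t \<omega>)"
      using step.IH by eventually_elim (simp add: gain_Suc add.assoc)
  qed
  with AE AE_superhedging_iff show ?case
    by eventually_elim (metis ereal_less_eq(3))
qed

lemma upper_recursion_strategy:
  assumes \<pi>: "upper_recursion M F S B T f \<pi>"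
  shows "\<exists>\<gamma>. admissible F B T \<gamma> \<and> (AE \<omega> in M. f \<omega> \<le> \<pi> 0 \<omega> + gain S \<gamma> T \<omega>)"
proof -
  have "\<exists>g. t < T \<longrightarrow> g \<in> borel_measurable (F t) \<and> (\<forall>\<omega>\<in>space (F t). g \<omega> \<in> B t \<omega>) \<and>
      (AE \<omega> in M. \<pi> (Suc t) \<omega> \<le> \<pi> t \<omega> + g \<omega> \<bullet> (S (Suc t) \<omega> - S t \<omega>))" for t
  proof (cases "t < T")
    case True
    obtain \<kappa> where \<kappa>: "market_step M F T S B t (\<pi> (Suc t)) \<kappa>" and meas: "\<pi> t \<in> borel_measurable (F t)"
      and AE: "AE \<omega> in M. ereal (\<pi> t \<omega>) = Sup (ereal ` price_fiber (S t \<omega>) (closed_support (\<kappa> \<omega>)) (B t \<omega>))"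
      using upper_recursion_stepE[OF \<pi> True] .
    show ?thesis
      using market_step.step_strategy[OF \<kappa> meas AE] by blast
  qed simp
  then have "\<exists>\<gamma>. \<forall>t. t < T \<longrightarrow> \<gamma> t \<in> borel_measurable (F t) \<and> (\<forall>\<omega>\<in>space (F t). \<gamma> t \<omega> \<in> B t \<omega>) \<and>
      (AE \<omega> in M. \<pi> (Suc t) \<omega> \<le> \<pi> t \<omega> + \<gamma> t \<omega> \<bullet> (S (Suc t) \<omega> - S t \<omega>))"
    by (intro choice allI)
  then obtain \<gamma> where \<gamma>: "\<And>t. t < T \<Longrightarrow> \<gamma> t \<in> borel_measurable (F t) \<and> (\<forall>\<omega>\<in>space (F t). \<gamma> t \<omega> \<in> B t \<omega>) \<and>
      (AE \<omega> in M. \<pi> (Suc t) \<omega> \<le> \<pi> t \<omega> + \<gamma> t \<omega> \<bullet> (S (Suc t) \<omega> - S t \<omega>))"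
    by blast
  have "AE \<omega> in M. \<pi> t \<omega> \<le> \<pi> 0 \<omega> + gain S \<gamma> t \<omega>" if "t \<le> T" for t
    using that
  proof (induction t)
    case (Suc t)
    have "AE \<omega> in M. \<pi> t \<omega> \<le> \<pi> 0 \<omega> + gain S \<gamma> t \<omega>"
      "AE \<omega> in M. \<pi> (Suc t) \<omega> \<le> \<pi> t \<omega> + \<gamma> t \<omega> \<bullet> (S (Suc t) \<omega> - S t \<omega>)"
      using Suc \<gamma>[of t] by auto
    then show ?case
      by eventually_elim (simp add: gain_Suc)
  qed (simp add: gain_0)
  from this[of T] have "AE \<omega> in M. \<pi> T \<omega> \<le> \<pi> 0 \<omega> + gain S \<gamma> T \<omega>"
    by simp
  moreover have "AE \<omega> in M. \<pi> T \<omega> = f \<omega>"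
    using \<pi> by (simp add: upper_recursion_def)
  ultimately have "AE \<omega> in M. f \<omega> \<le> \<pi> 0 \<omega> + gain S \<gamma> T \<omega>"
    by eventually_elim simp
  moreover have "admissible F B T \<gamma>"
    using \<gamma> by (simp add: admissible_def)
  ultimately show ?thesis
    by blast
qed

text \<open>Triviality of \<open>F 0\<close> makes \<open>\<pi> 0\<close> a constant up to a null
  set. This constant superhedges the claim and is a lower bound for all superhedging prices, so the
  infimum in the upper price is attained.\<close>

lemma upper_recursion_eq_upper_price:
  assumes \<pi>: "upper_recursion M F S B T f \<pi>"
  shows "AE \<omega> in M. ereal (\<pi> 0 \<omega>) = upper_price M F S B T f"
proof -
  have "\<pi> 0 \<in> borel_measurable (F 0)"
    using \<pi> by (simp add: upper_recursion_def)
  moreover have "\<And>A. A \<in> sets (F 0) \<Longrightarrow> prob A = 0 \<or> prob A = 1"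
    using filtered by (simp add: filtered_prob_space_def)
  ultimately obtain c where c: "AE \<omega> in M. \<pi> 0 \<omega> = c"
    using AE_const_if_trivial[OF prob_space_axioms subalg[of 0]] by blast
  obtain \<gamma> where \<gamma>: "admissible F B T \<gamma>" "AE \<omega> in M. f \<omega> \<le> \<pi> 0 \<omega> + gain S \<gamma> T \<omega>"
    using upper_recursion_strategy[OF \<pi>] by blast
  from \<gamma>(2) c have "AE \<omega> in M. f \<omega> \<le> c + gain S \<gamma> T \<omega>"
    by eventually_elim simp
  with \<gamma>(1) have "super_hedgeable M F S B T f c"
    by (auto simp: super_hedgeable_def)
  moreover have "c \<le> x" if sup: "super_hedgeable M F S B T f x" for x
  proof -
    obtain \<gamma> where "admissible F B T \<gamma>" "AE \<omega> in M. f \<omega> \<le> x + gain S \<gamma> T \<omega>"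
      using sup unfolding super_hedgeable_def by blast
    then have "AE \<omega> in M. \<pi> 0 \<omega> \<le> x + gain S \<gamma> 0 \<omega>"
      by (rule upper_recursion_le[OF \<pi>]) simp
    with c have "AE \<omega> in M. c \<le> x"
      by eventually_elim (simp add: gain_0)
    then show ?thesis
      by simp
  qed
  ultimately have "upper_price M F S B T f = ereal c"
    unfolding upper_price_def by (intro antisym INF_lower2[of c] INF_greatest) auto
  with c show ?thesis
    by (auto elim: eventually_mono)
qed

text \<open>An infimum over no prices would be \<open>\<infinity>\<close>, and a supremum over none
  \<open>- \<infinity>\<close>. Finiteness thus supplies a superhedge and a sub-hedge; the upper
  recursion alone uses both.\<close>

lemma upper_recursion_exists_if_finite:
  assumes "f \<in> borel_measurable (F T)" "\<bar>upper_price M F S B T f\<bar> \<noteq> \<infinity>" "\<bar>lower_price M F S B T f\<bar> \<noteq> \<infinity>"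
  shows "\<exists>\<pi>. upper_recursion M F S B T f \<pi>"
proof -
  have "{x. super_hedgeable M F S B T f x} \<noteq> {}" "{x. sub_hedgeable M F S B T f x} \<noteq> {}"
  proof -
    show "{x. super_hedgeable M F S B T f x} \<noteq> {}"
    proof
      assume "{x. super_hedgeable M F S B T f x} = {}"
      with assms(2) show False
        by (simp add: upper_price_def top_ereal_def)
    qed
    show "{x. sub_hedgeable M F S B T f x} \<noteq> {}"
    proof
      assume "{x. sub_hedgeable M F S B T f x} = {}"
      with assms(3) show False
        by (simp add: lower_price_def bot_ereal_def)
    qed
  qed
  then show ?thesis
    using upper_recursion_exists[OF assms(1)] unfolding super_hedgeable_def sub_hedgeable_def by blast
qed

end

section \<open>Lower prices by reflection\<close>

abbreviation reflect_snd :: "'b \<times> real \<Rightarrow> 'b \<times> real" where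
  "reflect_snd z \<equiv> (fst z, - snd z)"

lemma reflect_snd_linear: "linear (reflect_snd :: 'b::euclidean_space \<times> real \<Rightarrow> _)"
  by (rule linearI) auto

lemma price_fiber_iff:
  "y \<in> price_fiber s K B \<longleftrightarrow> (\<exists>z\<in>rel_interior (convex hull K). fst z - s \<in> polar B \<and> snd z = y)"
proof
  assume "y \<in> price_fiber s K B"
  then obtain z b where z: "z \<in> rel_interior (convex hull K)" and "b \<in> polar B" "(s, y) = z - (b, 0)"
    by (auto simp: price_fiber_def minkowski_diff_def)
  then have "fst z - s \<in> polar B \<and> snd z = y"
    by (cases z) auto
  with z show "\<exists>z\<in>rel_interior (convex hull K). fst z - s \<in> polar B \<and> snd z = y"
    by blast
next
  assume "\<exists>z\<in>rel_interior (convex hull K). fst z - s \<in> polar B \<and> snd z = y"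
  then obtain z where z: "z \<in> rel_interior (convex hull K)" "fst z - s \<in> polar B" "snd z = y"
    by blast
  moreover have "(s, y) = z - (fst z - s, 0)"
    using z(3) by (cases z) auto
  ultimately show "y \<in> price_fiber s K B"
    unfolding price_fiber_def minkowski_diff_def by blast
qed

text \<open>The reflection is linear and injective, so it commutes with the convex hull and the
  relative interior. The constraint concerns the price coordinate only, which stays fixed.\<close>

lemma price_fiber_reflect:
  fixes B :: "'b::euclidean_space set"
  shows "price_fiber s (reflect_snd ` K) B = uminus ` price_fiber s K B"
proof -
  have inj: "inj (reflect_snd :: 'b \<times> real \<Rightarrow> _)"
    by (auto simp: inj_on_def prod_eq_iff)
  have "convex hull (reflect_snd ` K) = reflect_snd ` (convex hull K)"
    by (rule convex_hull_linear_image[OF reflect_snd_linear, symmetric])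
  then have ri: "rel_interior (convex hull (reflect_snd ` K)) = reflect_snd ` rel_interior (convex hull K)"
    using rel_interior_injective_linear_image[OF reflect_snd_linear[unfolded linear_conv_bounded_linear] inj] by simp
  have "y \<in> price_fiber s (reflect_snd ` K) B \<longleftrightarrow> - y \<in> price_fiber s K B" for y
    unfolding price_fiber_iff ri by (auto simp: minus_equation_iff)
  then show ?thesis
    by (intro set_eqI) (metis (no_types, lifting) image_iff minus_minus)
qed

text \<open>The reflection is its own inverse, so one inclusion suffices: it is proved for any two
  measures related by the reflection and applied in both directions.\<close>

lemma closed_support_reflect:
  fixes \<mu> :: "('b::euclidean_space \<times> real) measure"
  assumes s: "sets \<mu> = sets borel"
  shows "closed_support (distr \<mu> borel reflect_snd) = reflect_snd ` closed_support \<mu>"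
proof -
  have cont: "continuous_on UNIV (reflect_snd :: 'b \<times> real \<Rightarrow> _)"
    by (intro continuous_intros)
  have meas: "reflect_snd \<in> measurable \<mu> borel"
    using borel_measurable_continuous_onI[OF cont] by (simp add: measurable_cong_sets[OF s refl])
  have sub: "reflect_snd ` closed_support \<mu>' \<subseteq> closed_support \<mu>''"
    if "\<And>C. closed C \<Longrightarrow> emeasure \<mu>'' (- C) = emeasure \<mu>' (reflect_snd -` (- C))" for \<mu>' \<mu>'' :: "('b \<times> real) measure"
  proof (intro image_subsetI)
    fix z assume z: "z \<in> closed_support \<mu>'"
    show "reflect_snd z \<in> closed_support \<mu>''"
      unfolding closed_support_def
    proof (intro InterI, safe)
      fix C :: "('b \<times> real) set" assume C: "closed C" "emeasure \<mu>'' (- C) = 0"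
      have "closed (reflect_snd -` C)"
        using C(1) cont by (rule closed_vimage)
      moreover have "emeasure \<mu>' (- (reflect_snd -` C)) = 0"
        using that[OF C(1)] C(2) by (simp add: vimage_Compl)
      ultimately show "reflect_snd z \<in> C"
        using closed_support_subset z by blast
    qed
  qed
  have emeasure: "emeasure (distr \<mu> borel reflect_snd) (- C) = emeasure \<mu> (reflect_snd -` (- C))" if "closed C" for C
    using emeasure_distr[OF meas, of "- C"] that sets_eq_imp_space_eq[OF s] by (simp add: borel_open open_Compl)
  have "reflect_snd ` closed_support (distr \<mu> borel reflect_snd) \<subseteq> closed_support \<mu>"
  proof (rule sub)
    fix C :: "('b \<times> real) set" assume C: "closed C"
    have "closed (reflect_snd -` C)"
      using C cont by (rule closed_vimage)
    from emeasure[OF this] show "emeasure \<mu> (- C) = emeasure (distr \<mu> borel reflect_snd) (reflect_snd -` (- C))"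
      by (simp add: vimage_def Compl_eq)
  qed
  then have "reflect_snd ` reflect_snd ` closed_support (distr \<mu> borel reflect_snd) \<subseteq> reflect_snd ` closed_support \<mu>"
    by (rule image_mono)
  then show ?thesis
    using sub[OF emeasure] by (simp add: image_image)
qed

lemma regular_cond_distr_reflect:
  fixes X :: "'a \<Rightarrow> 'b::euclidean_space" and Y :: "'a \<Rightarrow> real"
  assumes M: "prob_space M" and H: "subalgebra M H" and X: "X \<in> borel_measurable M" and Y: "Y \<in> borel_measurable M"
    and \<kappa>: "regular_cond_distr M H (\<lambda>\<omega>. (X \<omega>, Y \<omega>)) \<kappa>"
  shows "\<exists>\<kappa>'. regular_cond_distr M H (\<lambda>\<omega>. (X \<omega>, - Y \<omega>)) \<kappa>' \<and> (\<forall>\<omega>\<in>space M. \<forall>s B.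
    price_fiber s (closed_support (\<kappa>' \<omega>)) B = uminus ` price_fiber s (closed_support (\<kappa> \<omega>)) B)"
proof (intro exI conjI ballI allI)
  let ?\<kappa>' = "\<lambda>\<omega>. distr (\<kappa> \<omega>) borel reflect_snd"
  have cont: "continuous_on UNIV (reflect_snd :: 'b \<times> real \<Rightarrow> _)"
    by (intro continuous_intros)
  show "regular_cond_distr M H (\<lambda>\<omega>. (X \<omega>, - Y \<omega>)) ?\<kappa>'"
    using regular_cond_distr_distr[OF M H borel_measurable_Pair[OF X Y] \<kappa> borel_measurable_continuous_onI[OF cont]] by simp
  have \<kappa>H: "\<kappa> \<in> measurable H (prob_algebra borel)"
    using \<kappa> by (simp add: regular_cond_distr_def)
  show "price_fiber s (closed_support (?\<kappa>' \<omega>)) B = uminus ` price_fiber s (closed_support (\<kappa> \<omega>)) B"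
    if "\<omega> \<in> space M" for \<omega> s B
    using prob_algebra_kernelD(2)[OF \<kappa>H] that H
    by (simp add: closed_support_reflect price_fiber_reflect subalgebra_def)
qed

lemma Sup_ereal_image_uminus: "Sup (ereal ` uminus ` A) = - Inf (ereal ` A)"
  using ereal_Sup_uminus_image_eq[of "ereal ` A"] by (simp add: image_image)

lemma Inf_ereal_image_uminus: "Inf (ereal ` uminus ` A) = - Sup (ereal ` A)"
  using ereal_Inf_uminus_image_eq[of "ereal ` A"] by (simp add: image_image)

text \<open>Only the value coordinate changes sign, in the claim, in all values and in the
  conditional laws. Prices and cones are the same on both sides, so the results on upper recursions
  apply to \<open>- f\<close> in the same market.\<close>

lemma lower_recursion_iff_upper_recursion:
  fixes S :: "nat \<Rightarrow> 'a \<Rightarrow> 'b::euclidean_space"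
  assumes filtered: "filtered_prob_space M F T" and S: "\<And>t. t \<le> T \<Longrightarrow> S t \<in> borel_measurable (F t)"
  shows "lower_recursion M F S B T f \<pi> \<longleftrightarrow> upper_recursion M F S B T (\<lambda>\<omega>. - f \<omega>) (\<lambda>t \<omega>. - \<pi> t \<omega>)"
proof -
  have M: "prob_space M" and H: "\<And>t. t \<le> T \<Longrightarrow> subalgebra M (F t)"
    using filtered by (auto simp: filtered_prob_space_def)
  have step: "(\<exists>\<kappa>. regular_cond_distr M (F t) (\<lambda>\<omega>. (S (Suc t) \<omega>, \<pi> (Suc t) \<omega>)) \<kappa> \<and>
        (AE \<omega> in M. ereal (\<pi> t \<omega>) = Inf (ereal ` price_fiber (S t \<omega>) (closed_support (\<kappa> \<omega>)) (B t \<omega>)))) \<longleftrightarrow>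
      (\<exists>\<kappa>. regular_cond_distr M (F t) (\<lambda>\<omega>. (S (Suc t) \<omega>, - \<pi> (Suc t) \<omega>)) \<kappa> \<and>
        (AE \<omega> in M. ereal (- \<pi> t \<omega>) = Sup (ereal ` price_fiber (S t \<omega>) (closed_support (\<kappa> \<omega>)) (B t \<omega>))))"
    if t: "t < T" and \<pi>: "\<And>t. t \<le> T \<Longrightarrow> \<pi> t \<in> borel_measurable (F t)" for t
  proof -
    have Ht: "subalgebra M (F t)" and HS: "subalgebra M (F (Suc t))"
      using t by (auto intro: H)
    have XM: "S (Suc t) \<in> borel_measurable M" and YM: "\<pi> (Suc t) \<in> borel_measurable M"
      using t S \<pi> by (auto intro: measurable_from_subalg[OF HS])
    show ?thesis
    proof (intro iffI; elim exE conjE)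
      fix \<kappa> assume \<kappa>: "regular_cond_distr M (F t) (\<lambda>\<omega>. (S (Suc t) \<omega>, \<pi> (Suc t) \<omega>)) \<kappa>"
        and AE: "AE \<omega> in M. ereal (\<pi> t \<omega>) = Inf (ereal ` price_fiber (S t \<omega>) (closed_support (\<kappa> \<omega>)) (B t \<omega>))"
      obtain \<kappa>' where \<kappa>': "regular_cond_distr M (F t) (\<lambda>\<omega>. (S (Suc t) \<omega>, - \<pi> (Suc t) \<omega>)) \<kappa>'"
        and fiber: "\<And>\<omega> s B. \<omega> \<in> space M \<Longrightarrow>
          price_fiber s (closed_support (\<kappa>' \<omega>)) B = uminus ` price_fiber s (closed_support (\<kappa> \<omega>)) B"
        using regular_cond_distr_reflect[OF M Ht XM YM \<kappa>] by blast
      from AE AE_space have "AE \<omega> in M. ereal (- \<pi> t \<omega>) = Sup (ereal ` price_fiber (S t \<omega>) (closed_support (\<kappa>' \<omega>)) (B t \<omega>))"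
        by eventually_elim (simp only: fiber Sup_ereal_image_uminus uminus_ereal.simps(1)[symmetric])
      with \<kappa>' show "\<exists>\<kappa>. regular_cond_distr M (F t) (\<lambda>\<omega>. (S (Suc t) \<omega>, - \<pi> (Suc t) \<omega>)) \<kappa> \<and>
          (AE \<omega> in M. ereal (- \<pi> t \<omega>) = Sup (ereal ` price_fiber (S t \<omega>) (closed_support (\<kappa> \<omega>)) (B t \<omega>)))"
        by blast
    next
      fix \<kappa> assume \<kappa>: "regular_cond_distr M (F t) (\<lambda>\<omega>. (S (Suc t) \<omega>, - \<pi> (Suc t) \<omega>)) \<kappa>"
        and AE: "AE \<omega> in M. ereal (- \<pi> t \<omega>) = Sup (ereal ` price_fiber (S t \<omega>) (closed_support (\<kappa> \<omega>)) (B t \<omega>))"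
      obtain \<kappa>' where \<kappa>': "regular_cond_distr M (F t) (\<lambda>\<omega>. (S (Suc t) \<omega>, - (- \<pi> (Suc t) \<omega>))) \<kappa>'"
        and fiber: "\<And>\<omega> s B. \<omega> \<in> space M \<Longrightarrow>
          price_fiber s (closed_support (\<kappa>' \<omega>)) B = uminus ` price_fiber s (closed_support (\<kappa> \<omega>)) B"
        using regular_cond_distr_reflect[OF M Ht XM borel_measurable_uminus[OF YM] \<kappa>] by blast
      from AE AE_space have "AE \<omega> in M. ereal (- (- \<pi> t \<omega>)) = Inf (ereal ` price_fiber (S t \<omega>) (closed_support (\<kappa>' \<omega>)) (B t \<omega>))"
        by eventually_elim (simp only: fiber Inf_ereal_image_uminus uminus_ereal.simps(1)[symmetric])
      with \<kappa>' show "\<exists>\<kappa>. regular_cond_distr M (F t) (\<lambda>\<omega>. (S (Suc t) \<omega>, \<pi> (Suc t) \<omega>)) \<kappa> \<and>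
          (AE \<omega> in M. ereal (\<pi> t \<omega>) = Inf (ereal ` price_fiber (S t \<omega>) (closed_support (\<kappa> \<omega>)) (B t \<omega>)))"
        by auto
    qed
  qed
  have meas: "(\<lambda>\<omega>. - \<pi> t \<omega>) \<in> borel_measurable (F t) \<longleftrightarrow> \<pi> t \<in> borel_measurable (F t)" for t
    by (rule borel_measurable_uminus_eq)
  show ?thesis
    unfolding lower_recursion_def upper_recursion_def meas using step by auto
qed

text \<open>A sub-hedge subtracts the gain, so the same strategy works for \<open>- f\<close>.
  Reversing the strategy instead could leave the cone.\<close>

lemma sub_hedgeable_iff_super_hedgeable:
  "sub_hedgeable M F S B T f x \<longleftrightarrow> super_hedgeable M F S B T (\<lambda>\<omega>. - f \<omega>) (- x)"
proof -
  have "x - g \<le> y \<longleftrightarrow> - y \<le> - x + g" for g y :: real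
    by linarith
  then show ?thesis
    by (simp add: sub_hedgeable_def super_hedgeable_def)
qed

lemma upper_price_uminus: "upper_price M F S B T (\<lambda>\<omega>. - f \<omega>) = - lower_price M F S B T f"
proof -
  have "{x. super_hedgeable M F S B T (\<lambda>\<omega>. - f \<omega>) x} = uminus ` {x. sub_hedgeable M F S B T f x}"
    unfolding sub_hedgeable_iff_super_hedgeable by (auto intro: image_eqI[of x uminus "- x" for x])
  then show ?thesis
    by (simp add: upper_price_def lower_price_def Inf_ereal_image_uminus)
qed

lemma lower_price_uminus: "lower_price M F S B T (\<lambda>\<omega>. - f \<omega>) = - upper_price M F S B T f"
  using upper_price_uminus[of M F S B T "\<lambda>\<omega>. - f \<omega>"] by simp

theorem theorem2:
  fixes M :: "'a measure"
    and F :: "nat \<Rightarrow> 'a measure"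
    and T :: nat
    and S :: "nat \<Rightarrow> 'a \<Rightarrow> real ^ 'd"
    and B :: "nat \<Rightarrow> 'a \<Rightarrow> (real ^ 'd) set"
    and f :: "'a \<Rightarrow> real"
  assumes "filtered_prob_space M F T"
    and "\<forall>t\<le>T. S t \<in> borel_measurable (F t)"
    and "\<forall>t<T. random_convex_cone (F t) (B t)"
    and "\<forall>t<T. \<forall>\<omega>\<in>space M. polyhedron (B t \<omega>)"
    and "no_arbitrage M F S B T"
    and "f \<in> borel_measurable (F T)"
    and "\<bar>upper_price M F S B T f\<bar> \<noteq> \<infinity>"
    and "\<bar>lower_price M F S B T f\<bar> \<noteq> \<infinity>"
  shows "(\<exists>\<pi>. upper_recursion M F S B T f \<pi>) \<and>
         (\<forall>\<pi>. upper_recursion M F S B T f \<pi> \<longrightarrow>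
            (AE \<omega> in M. ereal (\<pi> 0 \<omega>) = upper_price M F S B T f)) \<and>
         (\<exists>\<pi>. lower_recursion M F S B T f \<pi>) \<and>
         (\<forall>\<pi>. lower_recursion M F S B T f \<pi> \<longrightarrow>
            (AE \<omega> in M. ereal (\<pi> 0 \<omega>) = lower_price M F S B T f))"
proof (intro conjI allI impI)
  interpret constrained_market M F T S B
    using assms(1-5) by unfold_locales auto
  let ?f = "\<lambda>\<omega>. - f \<omega>"
  show "\<exists>\<pi>. upper_recursion M F S B T f \<pi>"
    using assms(6-8) by (rule upper_recursion_exists_if_finite)
  show "AE \<omega> in M. ereal (\<pi> 0 \<omega>) = upper_price M F S B T f" if "upper_recursion M F S B T f \<pi>" for \<pi>
    using that by (rule upper_recursion_eq_upper_price)
  \<comment> \<open>Changing the sign of the claim exchanges the upper and the lower price up to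
    sign, so both are finite for \<open>- f\<close> as well.\<close>
  have "\<exists>\<pi>. upper_recursion M F S B T ?f \<pi>"
    using assms(6-8) by (intro upper_recursion_exists_if_finite) (auto simp: upper_price_uminus lower_price_uminus)
  then obtain \<pi> where "upper_recursion M F S B T ?f \<pi>"
    by blast
  then have "lower_recursion M F S B T f (\<lambda>t \<omega>. - \<pi> t \<omega>)"
    using lower_recursion_iff_upper_recursion[OF filtered adapted, of B f "\<lambda>t \<omega>. - \<pi> t \<omega>"] by simp
  then show "\<exists>\<pi>. lower_recursion M F S B T f \<pi>"
    by blast
  show "AE \<omega> in M. ereal (\<pi> 0 \<omega>) = lower_price M F S B T f" if "lower_recursion M F S B T f \<pi>" for \<pi>
  proof -
    have "AE \<omega> in M. ereal (- \<pi> 0 \<omega>) = upper_price M F S B T ?f"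
      using that lower_recursion_iff_upper_recursion[OF filtered adapted]
      by (intro upper_recursion_eq_upper_price) blast
    then show ?thesis
      unfolding upper_price_uminus uminus_ereal.simps(1)[symmetric] ereal_uminus_eq_iff .
  qed
qed

end
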